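(* Let $U$ be a subdomain of the upper half-plane $\mathbb{H}$ and denote by $\partial U$ the boundary of $U$ in the Riemann sphere $\mathbb{C}_\infty$. Suppose that $[-1,1]\subset\partial U$ and that $\partial U\setminus(-1,1)$ is connected. For $0<\alpha<1$ define the level set \[\gamma_\alpha=\{z\in U\,:\,\omega(z,(-1,1),U)=\alpha\}.\] Then $\Lambda_1(\gamma_{1/2})\le\pi$, with equality if and only if $U=\mathbb{H}$.
   Context: $\mathbb{H}$ is the open upper half-plane. $\omega(z,E,U)$ denotes the harmonic measure of a set $E\subset\partial U$ with respect to the point $z$ in the domain $U$. $\Lambda_1$ denotes one-dimensional Hausdorff measure with respect to the Euclidean metric in $\mathbb{C}$. *)

theory Defs
  imports "HOL-Analysis.Analysis"
begin

text \<open>The Riemann sphere is the one-point compactification of the plane: \<open>Some z\<close> is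
  the finite point \<open>z\<close> and \<open>None\<close> is the point at infinity.\<close>

definition riemann_sphere :: "complex option topology"
  where "riemann_sphere = Alexandroff_compactification euclidean"

definition sphere_boundary :: "complex set \<Rightarrow> complex option set"
  where "sphere_boundary U = riemann_sphere frontier_of (Some ` U)"

definition subharmonic_on :: "(complex \<Rightarrow> real) \<Rightarrow> complex set \<Rightarrow> bool"
  where "subharmonic_on u U \<longleftrightarrow>
    continuous_on U u \<and>
    (\<forall>a r. 0 < r \<and> cball a r \<subseteq> U \<longrightarrow>
      u a \<le> (1 / (2 * pi)) * integral {0..2*pi} (\<lambda>t. u (a + of_real r * cis t)))"

definition perron_family :: "complex set \<Rightarrow> (complex option \<Rightarrow> real) \<Rightarrow> (complex \<Rightarrow> real) set"
  where "perron_family U \<phi> =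
    {u. subharmonic_on u U \<and>
        (\<forall>\<zeta>\<in>sphere_boundary U.
           Limsup (atin_within riemann_sphere \<zeta> (Some ` U)) (\<lambda>p. ereal (u (the p)))
             \<le> ereal (\<phi> \<zeta>))}"

text \<open>Harmonic measure is the Perron solution of the Dirichlet problem whose boundary
  data are the indicator function of \<open>E\<close>.  When \<open>U\<close> is a nonempty domain with nonempty
  boundary and \<open>z \<in> U\<close>, the set below contains \<open>0\<close> and, by the maximum principle, is
  bounded above by \<open>1\<close>.\<close>

definition harmonic_measure :: "complex \<Rightarrow> complex option set \<Rightarrow> complex set \<Rightarrow> real"
  where "harmonic_measure z E U = (SUP u\<in>perron_family U (indicator E). u z)"

definition hausdorff1_content :: "real \<Rightarrow> 'a::metric_space set \<Rightarrow> ennreal"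
  where "hausdorff1_content \<delta> A =
    (INF C\<in>{C :: nat \<Rightarrow> 'a set. A \<subseteq> (\<Union>n. C n) \<and> (\<forall>n. bounded (C n) \<and> diameter (C n) \<le> \<delta>)}.
       \<Sum>n. ennreal (diameter (C n)))"

text \<open>The normalisation is the one for which a line segment has measure equal to its length.\<close>

definition hausdorff1 :: "'a::metric_space set \<Rightarrow> ennreal"
  where "hausdorff1 A = (SUP \<delta>\<in>{0<..}. hausdorff1_content \<delta> A)"

definition open_interval :: "complex option set"
  where "open_interval = Some ` complex_of_real ` {-1<..<1}"

definition closed_interval :: "complex option set"
  where "closed_interval = Some ` complex_of_real ` {-1..1}"

definition level_set :: "complex set \<Rightarrow> real \<Rightarrow> complex set"
  where "level_set U \<alpha> = {z \<in> U. harmonic_measure z open_interval U = \<alpha>}"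

end

theory Submission
  imports Defs "HOL-Complex_Analysis.Complex_Analysis"
begin

text \<open>
  The length of the level curve is controlled by the Schwarz-Pick inequality, and the bound that
  it gives integrates to a quantity that can be read off at the two ends of the curve.

  Suppose that \<open>U\<close> contains the upper half of a disc around every point of an interval
  \<open>(a, b)\<close> inside \<open>(-1, 1)\<close>.  Then \<open>U\<close>, its mirror image and \<open>(a, b)\<close> form a symmetric
  domain, which is simply connected because its boundary on the sphere is connected
  (\<open>simply_connected_reflected_domain\<close>).  It has a conformal map \<open>g\<close> from the strip
  \<open>\<bar>Im s\<bar> < \<pi>/2\<close> that is real on the real axis and sends the upper half of the strip to \<open>U\<close>
  (\<open>symmetric_strip_map\<close>).  The function \<open>1 - (2/\<pi>) Im (g\<inverse> z)\<close> has the boundary values of the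
  harmonic measure of \<open>(a, b)\<close>, so that the level \<open>1/2\<close> is the curve \<open>x \<mapsto> g (x + i\<pi>/4)\<close>.
  Comparing hyperbolic metrics of the half strip and of the half-plane gives
  \<open>\<bar>g'\<bar> \<le> 2 Im g\<close> on this line (\<open>half_strip_schwarz_pick\<close>).  If \<open>Q\<close> is a primitive of \<open>g\<close>, then
  \<open>2 Im g (x + i\<pi>/4)\<close> is the derivative of \<open>\<Phi> x = 2 Im (Q (x + i\<pi>/4) - Q x)\<close>, and by the mean
  value theorem \<open>\<Phi> x = (\<pi>/2) Re g (x + iy)\<close> for some \<open>y\<close> between \<open>0\<close> and \<open>\<pi>/4\<close>.  As \<open>g\<close> tends
  to \<open>a\<close> and \<open>b\<close> at the two ends of the strip (\<open>strip_limit_right\<close>), the length is at most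
  \<open>(\<pi>/2) (b - a) \<le> \<pi>\<close>.  Equality in the Schwarz-Pick inequality at a single point already makes
  \<open>g\<close> map the half strip onto the half-plane, so that equality of the lengths forces \<open>U\<close> to be the
  half-plane (\<open>hausdorff1_level_curve_less\<close>).  There the curve is the unit semicircle, whose
  measure is \<open>\<pi>\<close> (\<open>hausdorff1_semicircle_ge\<close>).

  It remains to find \<open>a\<close> and \<open>b\<close>, because the rest of the boundary may accumulate on \<open>(-1, 1)\<close>.
  A path in \<open>U\<close> between two points of \<open>(-1, 1)\<close> cuts off everything between them from the
  connected set \<open>\<partial>U - (-1, 1)\<close>, which contains \<open>1\<close>.  Hence the points of \<open>(-1, 1)\<close> above which \<open>U\<close>
  contains a vertical segment form an interval, and above a point strictly between two of them \<open>U\<close>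
  contains a half disc (\<open>half_disc_between_accessible\<close>).  Let \<open>a\<close> and \<open>b\<close> be the ends of that
  interval.  Above every point of \<open>(-1, 1)\<close> outside \<open>[a, b]\<close> the vertical line leaves \<open>U\<close> at
  arbitrarily small heights; such places are called dips below.  An interval of dips has harmonic
  measure zero, by an argument of Hall: give the dips a mass whose density over the interval is the
  reciprocal of their height.  Its Green potential is bounded by a universal constant, yet seen from
  a given point it is comparable to the harmonic measure of the interval in the half-plane.
  Adding it to a subharmonic function with bound \<open>M\<close> improves the bound near the interval to a fixed
  fraction of \<open>M\<close>, which is absurd for the best \<open>M > 0\<close> (\<open>subharmonic_nonpos_of_dips\<close>).
\<close>

section \<open>Boundary limits on the sphere and the maximum principle\<close>

lemma topspace_riemann_sphere [simp]: "topspace riemann_sphere = UNIV"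
  using UNIV_option_conv by (auto simp: riemann_sphere_def)

lemma open_vimage_Some:
  assumes "openin riemann_sphere T"
  shows "open (Some -` T)"
  using openin_continuous_map_preimage[OF continuous_map_Some assms[unfolded riemann_sphere_def]]
  by (simp add: vimage_def)

lemma eventually_at_sphere_Some:
  "eventually P (atin_within riemann_sphere (Some c) (Some ` U)) \<longleftrightarrow>
   eventually (\<lambda>z. P (Some z)) (at c within U)"
proof
  assume "eventually P (atin_within riemann_sphere (Some c) (Some ` U))"
  then have "\<exists>T. openin riemann_sphere T \<and> Some c \<in> T \<and> (\<forall>x\<in>T. x \<in> Some ` U \<and> x \<noteq> Some c \<longrightarrow> P x)"
    by (simp only: eventually_atin_within topspace_riemann_sphere UNIV_I not_True_eq_False simp_thms)
  then obtain T where T: "openin riemann_sphere T" "Some c \<in> T"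
    "\<forall>x\<in>T. x \<in> Some ` U \<and> x \<noteq> Some c \<longrightarrow> P x"
    by (elim exE conjE)
  have "open (Some -` T)"
    using T(1) by (rule open_vimage_Some)
  then show "eventually (\<lambda>z. P (Some z)) (at c within U)"
    unfolding eventually_at_topological using T by (intro exI[of _ "Some -` T"]) auto
next
  assume "eventually (\<lambda>z. P (Some z)) (at c within U)"
  then obtain S where S: "open S" "c \<in> S" "\<And>z. z \<in> S \<Longrightarrow> z \<noteq> c \<Longrightarrow> z \<in> U \<Longrightarrow> P (Some z)"
    unfolding eventually_at_topological by auto
  show "eventually P (atin_within riemann_sphere (Some c) (Some ` U))"
    unfolding eventually_atin_within riemann_sphere_def
    using S by (intro disjI2 exI[of _ "Some ` S"]) auto
qed

lemma eventually_at_sphere_infinity: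
  "eventually P (atin_within riemann_sphere None (Some ` U)) \<longleftrightarrow>
   (\<exists>B. \<forall>z\<in>U. norm z > B \<longrightarrow> P (Some z))"
proof
  assume "eventually P (atin_within riemann_sphere None (Some ` U))"
  then have "\<exists>T. openin riemann_sphere T \<and> None \<in> T \<and> (\<forall>x\<in>T. x \<in> Some ` U \<and> x \<noteq> None \<longrightarrow> P x)"
    by (simp only: eventually_atin_within topspace_riemann_sphere UNIV_I not_True_eq_False simp_thms)
  then obtain T where T: "openin riemann_sphere T" "None \<in> T"
    "\<forall>x\<in>T. x \<in> Some ` U \<and> x \<noteq> None \<longrightarrow> P x"
    by (elim exE conjE)
  from T(1,2) obtain C where C: "compact C" "T = insert None (Some ` (- C))"
    unfolding riemann_sphere_def openin_Alexandroff_compactification by (auto simp: Compl_eq_Diff_UNIV)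
  then obtain B where "\<forall>z\<in>C. norm z \<le> B"
    using compact_imp_bounded bounded_iff by metis
  then have "\<forall>z\<in>U. norm z > B \<longrightarrow> P (Some z)"
    using T(3) C(2) by fastforce
  then show "\<exists>B. \<forall>z\<in>U. norm z > B \<longrightarrow> P (Some z)" by blast
next
  assume "\<exists>B. \<forall>z\<in>U. norm z > B \<longrightarrow> P (Some z)"
  then obtain B where B: "\<forall>z\<in>U. norm z > B \<longrightarrow> P (Some z)" by blast
  have "openin riemann_sphere (insert None (Some ` (UNIV - cball (0::complex) B)))"
    unfolding riemann_sphere_def openin_Alexandroff_compactification
    by (intro disjI2 exI[of _ "cball 0 B"]) auto
  then show "eventually P (atin_within riemann_sphere None (Some ` U))"
    unfolding eventually_atin_within
    using B by (intro disjI2 exI[of _ "insert None (Some ` (UNIV - cball 0 B))"]) auto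
qed

lemma openin_riemann_sphere_Some: "openin riemann_sphere (Some ` S) \<longleftrightarrow> open S"
  by (simp add: riemann_sphere_def)

lemma openin_riemann_sphere_minus_compact:
  "compact C \<Longrightarrow> openin riemann_sphere (insert None (Some ` (- C)))"
  unfolding riemann_sphere_def openin_Alexandroff_compactification
  by (intro disjI2 exI[of _ C]) (auto simp: compact_imp_closed Compl_eq_Diff_UNIV)

lemma sphere_boundary_eq:
  assumes "open U"
  shows "sphere_boundary U = Some ` frontier U \<union> (if bounded U then {} else {None})"
proof -
  have int: "riemann_sphere interior_of (Some ` U) = Some ` U"
    using assms by (simp add: interior_of_openin openin_riemann_sphere_Some)
  have fin: "Some c \<in> riemann_sphere closure_of (Some ` U) \<longleftrightarrow> c \<in> closure U" for c
  proof -
    have "Some c \<in> riemann_sphere closure_of (Some ` U) \<longleftrightarrow>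
      (\<forall>T. openin riemann_sphere T \<and> Some c \<in> T \<longrightarrow> (\<exists>y\<in>Some ` U. y \<in> T))"
      by (auto simp: closure_of_def)
    also have "\<dots> \<longleftrightarrow> (\<forall>S. open S \<and> c \<in> S \<longrightarrow> S \<inter> U \<noteq> {})" (is "?A \<longleftrightarrow> ?B")
    proof
      assume A: ?A
      show ?B
      proof (intro allI impI)
        fix S assume "open S \<and> c \<in> S"
        then have "\<exists>y\<in>Some ` U. y \<in> Some ` S"
          using A openin_riemann_sphere_Some[of S] by blast
        then show "S \<inter> U \<noteq> {}" by auto
      qed
    next
      assume B: ?B
      show ?A
      proof (intro allI impI)
        fix T assume T: "openin riemann_sphere T \<and> Some c \<in> T"
        have "open (Some -` T)"
          using T by (blast intro: open_vimage_Some)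
        then show "\<exists>y\<in>Some ` U. y \<in> T" using B T by blast
      qed
    qed
    also have "\<dots> \<longleftrightarrow> c \<in> closure U"
      using open_Int_closure_eq_empty[of _ U] by (metis closure_iff_nhds_not_empty disjoint_iff)
    finally show ?thesis .
  qed
  have inf: "None \<in> riemann_sphere closure_of (Some ` U) \<longleftrightarrow> \<not> bounded U"
  proof
    assume N: "None \<in> riemann_sphere closure_of (Some ` U)"
    show "\<not> bounded U"
    proof
      assume "bounded U"
      then have "compact (closure U)" by simp
      from openin_riemann_sphere_minus_compact[OF this] N
      obtain y where "y \<in> Some ` U" "y \<in> insert None (Some ` (- closure U))"
        unfolding closure_of_def by blast
      then show False using closure_subset[of U] by auto
    qed
  next
    assume N: "\<not> bounded U"
    { fix T assume T: "openin riemann_sphere T" "None \<in> T"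
      then obtain C where C: "compact C" "T = insert None (Some ` (- C))"
        unfolding riemann_sphere_def openin_Alexandroff_compactification by (auto simp: Compl_eq_Diff_UNIV)
      then have "\<not> U \<subseteq> C" using N bounded_subset compact_imp_bounded by blast
      then have "\<exists>y\<in>Some ` U. y \<in> T" using C by auto }
    then show "None \<in> riemann_sphere closure_of (Some ` U)"
      by (auto simp: closure_of_def)
  qed
  have "z \<in> sphere_boundary U \<longleftrightarrow> z \<in> Some ` frontier U \<union> (if bounded U then {} else {None})" for z
    using fin inf int assms by (cases z) (auto simp: sphere_boundary_def frontier_of_def frontier_def interior_open)
  then show ?thesis by blast
qed

text \<open>The boundary condition in the Perron family, freed from extended reals.\<close>
definition limsup_le :: "(complex \<Rightarrow> real) \<Rightarrow> complex set \<Rightarrow> complex option \<Rightarrow> real \<Rightarrow> bool"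
  where "limsup_le w U \<zeta> m \<longleftrightarrow>
    (\<forall>y>m. eventually (\<lambda>p. w (the p) < y) (atin_within riemann_sphere \<zeta> (Some ` U)))"

lemma limsup_le_iff_Limsup:
  "limsup_le w U \<zeta> m \<longleftrightarrow>
    Limsup (atin_within riemann_sphere \<zeta> (Some ` U)) (\<lambda>p. ereal (w (the p))) \<le> ereal m"
  unfolding limsup_le_def Limsup_le_iff
proof safe
  fix y assume *: "\<forall>y>m. \<forall>\<^sub>F p in atin_within riemann_sphere \<zeta> (Some ` U). w (the p) < y" "ereal m < y"
  then show "\<forall>\<^sub>F x in atin_within riemann_sphere \<zeta> (Some ` U). ereal (w (the x)) < y"
    by (cases y) auto
next
  fix y assume *: "\<forall>y>ereal m. \<forall>\<^sub>F x in atin_within riemann_sphere \<zeta> (Some ` U). ereal (w (the x)) < y" "m < y"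
  then show "\<forall>\<^sub>F p in atin_within riemann_sphere \<zeta> (Some ` U). w (the p) < y"
    using *(1)[rule_format, of "ereal y"] by simp
qed

lemma limsup_le_Some:
  "limsup_le w U (Some c) m \<longleftrightarrow> (\<forall>y>m. \<forall>\<^sub>F z in at c within U. w z < y)"
  by (simp add: limsup_le_def eventually_at_sphere_Some)

lemma limsup_le_None:
  "limsup_le w U None m \<longleftrightarrow> (\<forall>y>m. \<exists>B. \<forall>z\<in>U. norm z > B \<longrightarrow> w z < y)"
  by (simp add: limsup_le_def eventually_at_sphere_infinity)

lemma limsup_le_mono:
  assumes "limsup_le w U \<zeta> m" "\<And>z. z \<in> U \<Longrightarrow> w' z \<le> w z" "m \<le> m'"
  shows "limsup_le w' U \<zeta> m'"
proof (cases \<zeta>)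
  case None
  show ?thesis
    unfolding None limsup_le_None
  proof safe
    fix y assume "m' < y"
    then obtain B where "\<forall>z\<in>U. norm z > B \<longrightarrow> w z < y"
      using assms unfolding None limsup_le_None by force
    then show "\<exists>B. \<forall>z\<in>U. norm z > B \<longrightarrow> w' z < y"
      using assms(2) by (intro exI[of _ B]) force
  qed
next
  case (Some c)
  show ?thesis
    unfolding Some limsup_le_Some
  proof safe
    fix y assume "m' < y"
    then have "\<forall>\<^sub>F z in at c within U. w z < y"
      using assms unfolding Some limsup_le_Some by auto
    then show "\<forall>\<^sub>F z in at c within U. w' z < y"
      unfolding eventually_at_filter by eventually_elim (use assms(2) in force)
  qed
qed

lemma limsup_le_add:
  assumes "limsup_le w U \<zeta> m" "limsup_le w' U \<zeta> m'"
  shows "limsup_le (\<lambda>z. w z + w' z) U \<zeta> (m + m')"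
  unfolding limsup_le_def
proof safe
  fix y assume y: "m + m' < y"
  define d where "d = (y - m - m') / 2"
  have d: "d > 0" using y by (simp add: d_def)
  have "eventually (\<lambda>p. w (the p) < m + d) (atin_within riemann_sphere \<zeta> (Some ` U))"
       "eventually (\<lambda>p. w' (the p) < m' + d) (atin_within riemann_sphere \<zeta> (Some ` U))"
    using assms d unfolding limsup_le_def by auto
  then show "eventually (\<lambda>p. w (the p) + w' (the p) < y) (atin_within riemann_sphere \<zeta> (Some ` U))"
  proof eventually_elim
    case (elim p) then show ?case unfolding d_def by argo
  qed
qed

lemma circle_in_cball: "0 \<le> r \<Longrightarrow> a + of_real r * cis t \<in> cball a r"
  by (simp add: dist_norm norm_mult)

lemma continuous_on_circle:
  assumes "continuous_on U w" "0 < r" "cball a r \<subseteq> U"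
  shows "continuous_on S (\<lambda>t. w (a + of_real r * cis t))"
  by (rule continuous_on_compose2[OF assms(1)])
     (use assms circle_in_cball in \<open>auto intro!: continuous_intros continuous_on_cis simp: subset_iff less_imp_le\<close>)

lemma integrable_on_circle:
  assumes "continuous_on U w" "0 < r" "cball a r \<subseteq> U"
  shows "(\<lambda>t. w (a + of_real r * cis t) :: real) integrable_on {0..2*pi}"
  using continuous_on_circle[OF assms] integrable_continuous_real by blast

lemma subharmonic_on_add:
  assumes "subharmonic_on u U" "subharmonic_on v U"
  shows "subharmonic_on (\<lambda>z. u z + v z) U"
  unfolding subharmonic_on_def
proof safe
  show "continuous_on U (\<lambda>z. u z + v z)"
    using assms by (auto simp: subharmonic_on_def intro: continuous_intros)
  fix a r assume r: "0 < r" "cball a r \<subseteq> U"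
  have c: "continuous_on U u" "continuous_on U v" using assms by (auto simp: subharmonic_on_def)
  have "u a + v a \<le> 1 / (2 * pi) * integral {0..2 * pi} (\<lambda>t. u (a + of_real r * cis t))
     + 1 / (2 * pi) * integral {0..2 * pi} (\<lambda>t. v (a + of_real r * cis t))"
    using assms r unfolding subharmonic_on_def by (intro add_mono) auto
  also have "\<dots> = 1 / (2 * pi) * integral {0..2 * pi}
      (\<lambda>t. u (a + of_real r * cis t) + v (a + of_real r * cis t))"
    by (simp only: distrib_left
        Henstock_Kurzweil_Integration.integral_add[OF integrable_on_circle[OF c(1) r] integrable_on_circle[OF c(2) r]])
  finally show "u a + v a \<le> 1 / (2 * pi) * integral {0..2 * pi}
      (\<lambda>t. u (a + of_real r * cis t) + v (a + of_real r * cis t))" .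
qed

text \<open>Boundary limits below the level \<open>y\<close> keep the superlevel set away from the boundary and from infinity.\<close>
lemma compact_superlevel:
  assumes U: "open U" and w: "continuous_on U w"
    and bd: "\<And>\<zeta>. \<zeta> \<in> sphere_boundary U \<Longrightarrow> limsup_le w U \<zeta> m" and y: "m < y"
  shows "compact {z \<in> U. y \<le> w z}" (is "compact ?S")
  unfolding compact_eq_bounded_closed
proof
  show "bounded ?S"
  proof (cases "bounded U")
    case True then show ?thesis by (rule bounded_subset) auto
  next
    case False
    then have "None \<in> sphere_boundary U" by (simp add: sphere_boundary_eq U)
    from bd[OF this] obtain B where "\<forall>z\<in>U. norm z > B \<longrightarrow> w z < y"
      using y by (auto simp: limsup_le_None)
    then have "?S \<subseteq> cball 0 B" by force
    then show ?thesis using bounded_cball bounded_subset by blast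
  qed
  show "closed ?S"
    unfolding closed_limpt
  proof safe
    fix l assume l: "l islimpt ?S"
    have lU: "l \<in> closure U"
      using l islimpt_subset[of l ?S U] by (auto simp: closure_def)
    show "l \<in> U"
    proof (rule ccontr)
      assume "l \<notin> U"
      then have "Some l \<in> sphere_boundary U" using lU U
        by (auto simp: sphere_boundary_eq frontier_def interior_open)
      from bd[OF this] have "\<forall>\<^sub>F z in at l within U. w z < y"
        using y by (auto simp: limsup_le_Some)
      then obtain T where "open T" "l \<in> T" and T: "\<forall>z\<in>T. z \<noteq> l \<longrightarrow> z \<in> U \<longrightarrow> w z < y"
        unfolding eventually_at_topological by (elim exE conjE)
      with islimptE[OF l] show False by (metis (mono_tags, lifting) mem_Collect_eq not_less)
    qed
    then have "continuous (at l) w" using U w continuous_on_eq_continuous_at by blast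
    show "y \<le> w l"
    proof (rule ccontr)
      assume "\<not> y \<le> w l"
      then have "\<forall>\<^sub>F z in at l. w z < y"
        using \<open>continuous (at l) w\<close> order_tendstoD(2)[of w "w l" "at l" y]
        by (simp add: continuous_at)
      then obtain T where "open T" "l \<in> T" and T: "\<forall>z\<in>T. z \<noteq> l \<longrightarrow> z \<in> UNIV \<longrightarrow> w z < y"
        unfolding eventually_at_topological by (elim exE conjE)
      with islimptE[OF l] show False by (metis (mono_tags, lifting) mem_Collect_eq not_less UNIV_I)
    qed
  qed
qed

text \<open>The points where the maximum is attained form a compact set.  At the highest of them the mean
  value inequality forces the whole of a surrounding circle into that set, and the top of the circle
  is higher still.\<close>
lemma maximum_principle:
  assumes U: "open U" and sub: "subharmonic_on w U"
    and bd: "\<And>\<zeta>. \<zeta> \<in> sphere_boundary U \<Longrightarrow> limsup_le w U \<zeta> m" and z: "z \<in> U"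
  shows "w z \<le> m"
proof (rule ccontr)
  assume "\<not> w z \<le> m"
  then have m: "m < w z" by simp
  have w: "continuous_on U w" using sub by (simp add: subharmonic_on_def)
  obtain z0 where z0: "z0 \<in> U" "w z \<le> w z0" "\<And>x. x \<in> U \<Longrightarrow> w x \<le> w z0"
  proof -
    have "compact {x \<in> U. w z \<le> w x}" by (rule compact_superlevel[OF U w bd m])
    moreover have "z \<in> {x \<in> U. w z \<le> w x}" using z by simp
    moreover have "continuous_on {x \<in> U. w z \<le> w x} w"
      by (rule continuous_on_subset[OF w]) auto
    ultimately obtain z0 where z0: "z0 \<in> {x \<in> U. w z \<le> w x}"
      and mx: "\<forall>x\<in>{x \<in> U. w z \<le> w x}. w x \<le> w z0"
      using continuous_attains_sup[of "{x \<in> U. w z \<le> w x}" w] by auto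
    have "w x \<le> w z0" if "x \<in> U" for x
      using mx z0 that by (cases "w z \<le> w x") auto
    with z0 show ?thesis using that[of z0] by auto
  qed
  define S where "S = {x \<in> U. w z0 \<le> w x}"
  have "compact S" unfolding S_def by (rule compact_superlevel[OF U w bd]) (use m z0 in auto)
  moreover have "z0 \<in> S" using z0 by (simp add: S_def)
  moreover have "continuous_on S Im" by (intro continuous_intros)
  ultimately obtain z1 where z1: "z1 \<in> S" "\<And>x. x \<in> S \<Longrightarrow> Im x \<le> Im z1"
    using continuous_attains_sup[of S Im] by auto
  then have "z1 \<in> U" and wz1: "w z1 = w z0" using z0 by (auto simp: S_def intro: antisym)
  then obtain r where r: "0 < r" "cball z1 r \<subseteq> U"
    using U open_contains_cball by blast
  define f where "f = (\<lambda>t. w z0 - w (z1 + of_real r * cis t))"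
  have fc: "continuous_on (cbox 0 (2*pi)) f"
    unfolding f_def by (intro continuous_intros continuous_on_circle[OF w r])
  have fn: "0 \<le> f t" for t
    using z0(3)[of "z1 + of_real r * cis t"] r circle_in_cball[of r z1 t] by (auto simp: f_def)
  have "w z1 \<le> 1 / (2 * pi) * integral {0..2 * pi} (\<lambda>t. w (z1 + of_real r * cis t))"
    using sub r unfolding subharmonic_on_def by blast
  then have "2 * pi * w z0 \<le> integral {0..2 * pi} (\<lambda>t. w (z1 + of_real r * cis t))"
    using wz1 by (simp add: field_simps)
  moreover have "integral {0..2*pi} f = 2 * pi * w z0 - integral {0..2 * pi} (\<lambda>t. w (z1 + of_real r * cis t))"
    unfolding f_def
    using Henstock_Kurzweil_Integration.integral_diff[OF integrable_const_ivl[of "w z0" 0 "2*pi"] integrable_on_circle[OF w r]]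
    by simp
  ultimately have "integral {0..2*pi} f \<le> 0" by simp
  moreover have "integral {0..2*pi} f \<ge> 0"
    using fn by (intro Henstock_Kurzweil_Integration.integral_nonneg integrable_continuous_real) (use fc in auto)
  ultimately have "(f has_integral 0) (cbox 0 (2*pi))"
    using fc integrable_continuous_real[of 0 "2*pi" f] by (metis antisym cbox_interval has_integral_integral)
  then have "f (pi/2) = 0"
    by (intro has_integral_0_cbox_imp_0[OF fc]) (use fn pi_gt_zero in \<open>auto simp del: pi_gt_zero\<close>)
  then have "z1 + of_real r * cis (pi/2) \<in> S"
    using r circle_in_cball[of r z1 "pi/2"] by (auto simp: S_def f_def)
  from z1(2)[OF this] show False using r by simp
qed

section \<open>Harmonic functions\<close>

text \<open>The mean value property is the form of harmonicity that fits \<open>subharmonic_on\<close>; for potentials it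
  follows from Fubini's theorem.\<close>
definition harmonic_on :: "(complex \<Rightarrow> real) \<Rightarrow> complex set \<Rightarrow> bool"
  where "harmonic_on h U \<longleftrightarrow> continuous_on U h \<and>
    (\<forall>a r. 0 < r \<and> cball a r \<subseteq> U \<longrightarrow>
      ((\<lambda>t. h (a + of_real r * cis t)) has_integral 2 * pi * h a) {0..2*pi})"

lemma harmonic_on_imp_subharmonic_on: "harmonic_on h U \<Longrightarrow> subharmonic_on h U"
  unfolding harmonic_on_def subharmonic_on_def
  by (auto dest!: spec simp: integral_unique)

lemma harmonic_on_uminus: "harmonic_on h U \<Longrightarrow> harmonic_on (\<lambda>z. - h z) U"
  unfolding harmonic_on_def
  by (auto intro!: continuous_intros dest: has_integral_neg)

lemma harmonic_on_add: "harmonic_on h U \<Longrightarrow> harmonic_on k U \<Longrightarrow> harmonic_on (\<lambda>z. h z + k z) U"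
  unfolding harmonic_on_def
  by (auto intro!: continuous_intros has_integral_add simp: distrib_left)

lemma harmonic_on_const: "harmonic_on (\<lambda>z. c) U"
proof -
  have "((\<lambda>t. c) has_integral 2 * pi * c) {0..2*pi}"
    using has_integral_const_real[of c 0 "2*pi"] by simp
  then show ?thesis by (simp add: harmonic_on_def)
qed

lemma harmonic_on_cmult: "harmonic_on h U \<Longrightarrow> harmonic_on (\<lambda>z. c * h z) U"
  unfolding harmonic_on_def
  by (auto intro!: continuous_intros) (metis has_integral_mult_right mult.left_commute)

lemma harmonic_on_sum:
  "finite A \<Longrightarrow> (\<And>q. q \<in> A \<Longrightarrow> harmonic_on (f q) U) \<Longrightarrow> harmonic_on (\<lambda>z. \<Sum>q\<in>A. f q z) U"
  by (induction A rule: finite_induct) (auto intro: harmonic_on_add harmonic_on_const[of 0])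

lemma mean_value_holomorphic:
  assumes "f holomorphic_on U" "0 < r" "cball a r \<subseteq> U"
  shows "((\<lambda>t. f (a + of_real r * cis t)) has_integral 2 * of_real pi * f a) {0..2*pi}"
proof -
  have hol: "f holomorphic_on cball a r" using assms holomorphic_on_subset by blast
  have "((\<lambda>u. f u / (u - a)) has_contour_integral (2 * of_real pi * \<i> * f a)) (circlepath a r)"
    using assms(2) by (intro Cauchy_integral_circlepath)
      (auto intro: holomorphic_on_imp_continuous_on holomorphic_on_subset[OF hol] hol)
  then have "((\<lambda>t. f (a + of_real r * cis t) / (a + of_real r * cis t - a) * of_real r * \<i> * cis t)
     has_integral (2 * of_real pi * \<i> * f a)) {0..2*pi}"
    unfolding circlepath_def by (subst (asm) has_contour_integral_part_circlepath_iff) (auto simp: cis_conv_exp mult_ac)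
  moreover have "f (a + of_real r * cis t) / (a + of_real r * cis t - a) * of_real r * \<i> * cis t
     = \<i> * f (a + of_real r * cis t)" for t using assms(2) by simp
  ultimately have "((\<lambda>t. \<i> * f (a + of_real r * cis t)) has_integral (2 * of_real pi * \<i> * f a)) {0..2*pi}"
    by (simp only:)
  from has_integral_mult_right[OF this, of "-\<i>"] show ?thesis by (simp add: mult_ac)
qed

lemma harmonic_on_Re:
  assumes "f holomorphic_on U"
  shows "harmonic_on (\<lambda>z. Re (f z)) U"
  unfolding harmonic_on_def
proof safe
  show "continuous_on U (\<lambda>z. Re (f z))"
    using holomorphic_on_imp_continuous_on[OF assms] by (intro continuous_intros)
  fix a r assume "0 < r" "cball a r \<subseteq> U"
  from has_integral_Re[OF mean_value_holomorphic[OF assms this]]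
  show "((\<lambda>t. Re (f (a + of_real r * cis t))) has_integral 2 * pi * Re (f a)) {0..2*pi}" by simp
qed

lemma harmonic_on_Im:
  assumes "f holomorphic_on U"
  shows "harmonic_on (\<lambda>z. Im (f z)) U"
proof -
  have "(\<lambda>z. - \<i> * f z) holomorphic_on U" using assms by (intro holomorphic_intros)
  from harmonic_on_Re[OF this] show ?thesis by simp
qed

text \<open>On the largest disc around \<open>a\<close> that omits \<open>e\<close>, the quotient \<open>(z - e) / (a - e)\<close> has positive real
  part, so that the function is the real part of a holomorphic logarithm there.\<close>
lemma harmonic_on_ln_norm:
  assumes "e \<notin> U"
  shows "harmonic_on (\<lambda>z. ln (norm (z - e))) U"
  unfolding harmonic_on_def
proof safe
  show "continuous_on U (\<lambda>z. ln (norm (z - e)))"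
    using assms by (intro continuous_intros) auto
  fix a r assume r: "0 < r" "cball a r \<subseteq> U"
  define W where "W = ball a (norm (a - e))"
  have "e \<notin> cball a r" using r assms by auto
  then have sub: "cball a r \<subseteq> W" by (auto simp: W_def dist_norm norm_minus_commute)
  have ae: "a \<noteq> e" using \<open>e \<notin> cball a r\<close> r(1) by auto
  have pos: "Re ((z - e) / (a - e)) > 0" if "z \<in> W" for z
  proof -
    have "(z - e) / (a - e) = 1 + (z - a) / (a - e)" using ae by (simp add: field_simps)
    moreover have "norm ((z - a) / (a - e)) < 1"
      using that ae by (simp add: W_def norm_divide dist_norm norm_minus_commute)
    ultimately show ?thesis using complex_Re_le_cmod[of "- ((z - a) / (a - e))"]
      by (simp add: norm_minus_commute)
  qed
  have hol: "(\<lambda>z. Ln ((z - e) / (a - e))) holomorphic_on W"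
    using pos ae by (intro holomorphic_intros) (auto simp: complex_nonpos_Reals_iff dest: pos)
  have eq: "ln (norm (z - e)) = Re (Ln ((z - e) / (a - e))) + ln (norm (a - e))" if "z \<in> W" for z
  proof -
    have "z \<noteq> e" using pos[OF that] by auto
    then show ?thesis using ae by (simp add: norm_divide ln_div)
  qed
  have "harmonic_on (\<lambda>z. Re (Ln ((z - e) / (a - e))) + ln (norm (a - e))) W"
    by (intro harmonic_on_add harmonic_on_Re hol harmonic_on_const)
  then have "((\<lambda>t. Re (Ln ((a + of_real r * cis t - e) / (a - e))) + ln (norm (a - e)))
    has_integral 2 * pi * (Re (Ln ((a - e) / (a - e))) + ln (norm (a - e)))) {0..2*pi}"
    using r sub unfolding harmonic_on_def by blast
  then have "((\<lambda>t. ln (norm (a + of_real r * cis t - e))) has_integral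
      2 * pi * (Re (Ln ((a - e) / (a - e))) + ln (norm (a - e)))) {0..2*pi}"
  proof (rule has_integral_eq[rotated])
    fix t
    have "a + of_real r * cis t \<in> W" using sub circle_in_cball[of r a t] r(1) by auto
    from eq[OF this]
    show "Re (Ln ((a + of_real r * cis t - e) / (a - e))) + ln (norm (a - e)) =
      ln (norm (a + of_real r * cis t - e))" by simp
  qed
  then show "((\<lambda>t. ln (norm (a + of_real r * cis t - e))) has_integral 2 * pi * ln (norm (a - e))) {0..2*pi}"
    using ae by simp
qed

section \<open>Normalised Green functions of the half-plane\<close>

text \<open>The Green function of the upper half-plane with pole \<open>t + ih\<close> at the point \<open>x + iy\<close>, divided by
  the height \<open>h\<close> of the pole.  In the limit \<open>h \<rightarrow> 0\<close> it becomes \<open>2y / ((x - t)\<^sup>2 + y\<^sup>2)\<close>, which is \<open>2\<pi>\<close>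
  times the Poisson kernel.\<close>
definition green :: "real \<Rightarrow> real \<Rightarrow> real \<Rightarrow> real \<Rightarrow> real"
  where "green x y t h = ln (1 + 4 * y * h / ((x - t)\<^sup>2 + (y - h)\<^sup>2)) / (2 * h)"

lemma green_nonneg: "0 \<le> y \<Longrightarrow> 0 < h \<Longrightarrow> 0 \<le> green x y t h"
  by (auto simp: green_def intro!: divide_nonneg_nonneg)

lemma green_upper:
  assumes "0 < y" "0 < h" "0 < d" "d \<le> (x - t)\<^sup>2 + (y - h)\<^sup>2"
  shows "green x y t h \<le> 2 * y / d"
proof -
  have "ln (1 + 4 * y * h / ((x - t)\<^sup>2 + (y - h)\<^sup>2)) \<le> 4 * y * h / ((x - t)\<^sup>2 + (y - h)\<^sup>2)"
    using assms by (intro ln_add_one_self_le_self) auto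
  also have "\<dots> \<le> 4 * y * h / d" using assms by (intro divide_left_mono mult_pos_pos) auto
  finally show ?thesis using assms by (simp add: green_def field_simps)
qed

text \<open>By \<open>ln (1 + s) \<ge> s / (1 + s)\<close>, a pole that is not higher than the point is felt at least as
  strongly as the Poisson kernel of the doubled height.\<close>
lemma green_lower:
  assumes "0 < h" "h \<le> y" "x \<noteq> t \<or> y \<noteq> h"
  shows "2 * y / ((x - t)\<^sup>2 + 4 * y\<^sup>2) \<le> green x y t h"
proof -
  define q where "q = (x - t)\<^sup>2 + (y - h)\<^sup>2"
  have q: "0 < q" using assms unfolding q_def by (auto simp: add_pos_nonneg add_nonneg_pos)
  define s where "s = 4 * y * h / q"
  have s: "0 < s" using q assms by (simp add: s_def)
  have "s / (1 + s) \<le> ln (1 + s)"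
    using ln_le_minus_one[of "1 / (1 + s)"] s by (simp add: ln_div field_simps)
  moreover have "s / (1 + s) = 4 * y * h / (q + 4 * y * h)" using q by (simp add: s_def field_simps)
  ultimately have "4 * y * h / (q + 4 * y * h) \<le> ln (1 + s)" by simp
  then have "4 * y * h / (q + 4 * y * h) / (2 * h) \<le> green x y t h"
    using divide_right_mono[of "4 * y * h / (q + 4 * y * h)" "ln (1 + s)" "2 * h"] assms
    unfolding green_def s_def q_def by simp
  moreover have "4 * y * h / (q + 4 * y * h) / (2 * h) = 2 * y / (q + 4 * y * h)"
  proof -
    have "q + 4 * y * h > 0" using q assms by (intro add_pos_nonneg) auto
    then show ?thesis using assms by (simp add: divide_simps)
  qed
  moreover have "q + 4 * y * h \<le> (x - t)\<^sup>2 + 4 * y\<^sup>2"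
  proof -
    have "(y + h)\<^sup>2 \<le> (2 * y)\<^sup>2" using assms by (intro power_mono) auto
    then show ?thesis unfolding q_def by (simp add: power2_eq_square algebra_simps)
  qed
  then have "2 * y / ((x - t)\<^sup>2 + 4 * y\<^sup>2) \<le> 2 * y / (q + 4 * y * h)"
    using assms q by (intro divide_left_mono mult_pos_pos add_pos_pos add_nonneg_pos) auto
  ultimately show ?thesis by linarith
qed

text \<open>An integrable majorant in the scaled variable \<open>s = (t - x) / y\<close>, uniform in the height of the pole.
  The singular terms at \<open>s = 0\<close> absorb the logarithmic pole, which can be close when its height is
  comparable to \<open>y\<close>.\<close>
definition green_dom :: "real \<Rightarrow> real"
  where "green_dom s = 16 * inverse (1 + s\<^sup>2)
     + 4 * (indicator {0..1} s * s powr (-1/2) + indicator {0..1} (-s) * (-s) powr (-1/2))"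

text \<open>For \<open>\<bar>s\<bar> > 1\<close> or a low pole, \<open>ln (1 + u) \<le> u\<close> suffices.  If \<open>\<bar>s\<bar> \<le> 1\<close> and \<open>l \<ge> 1/2\<close>, the logarithm
  splits into that of \<open>1 + 4l\<close>, which the division by \<open>2l\<close> makes harmless, and that of \<open>1 / s\<^sup>2\<close>, which is
  dominated by a power of \<open>s\<close>.\<close>
lemma green_dom_bound_unit:
  fixes s l :: real
  assumes "s \<noteq> 0" "0 < l"
  shows "ln (1 + 4 * l / (s\<^sup>2 + (1 - l)\<^sup>2)) / (2 * l) \<le> green_dom s"
proof -
  have eq: "green 0 1 s l = ln (1 + 4 * l / (s\<^sup>2 + (1 - l)\<^sup>2)) / (2 * l)"
    by (simp add: green_def)
  have ab: "green_dom s = 16 / (1 + s\<^sup>2) + (if \<bar>s\<bar> \<le> 1 then 4 * \<bar>s\<bar> powr (-1/2) else 0)"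
    using assms(1) by (auto simp: green_dom_def indicator_def field_simps)
  consider "1 < \<bar>s\<bar>" | "\<bar>s\<bar> \<le> 1" "l < 1/2" | "\<bar>s\<bar> \<le> 1" "l \<ge> 1/2" by linarith
  then have "green 0 1 s l \<le> green_dom s"
  proof cases
    case 1
    then have s2: "1 < s\<^sup>2" using one_less_power[of "\<bar>s\<bar>" 2] by simp
    have "green 0 1 s l \<le> 2 * 1 / s\<^sup>2" using assms by (intro green_upper) auto
    also have "\<dots> = 16 / (8 * s\<^sup>2)" by simp
    also have "\<dots> \<le> 16 / (1 + s\<^sup>2)" using s2 by (intro divide_left_mono mult_pos_pos) auto
    finally show ?thesis using 1 ab by simp
  next
    case 2
    have "(1/2)\<^sup>2 \<le> (1 - l)\<^sup>2" using 2 by (intro power_mono) auto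
    moreover have "(1/2)\<^sup>2 = (1/4 :: real)" by (simp add: power2_eq_square)
    ultimately have "1/4 \<le> (0 - s)\<^sup>2 + (1 - l)\<^sup>2" using zero_le_power2[of "0 - s"] by linarith
    then have "green 0 1 s l \<le> 2 * 1 / (1/4)" using assms by (intro green_upper) auto
    also have "\<dots> \<le> 16 / (1 + s\<^sup>2)"
    proof -
      have "s\<^sup>2 \<le> 1" using 2(1) by (simp add: abs_square_le_1)
      then show ?thesis using zero_le_power2[of s] by (simp add: field_simps add_pos_nonneg)
    qed
    also have "\<dots> \<le> green_dom s" using ab by simp
    finally show ?thesis .
  next
    case 3
    have s2: "0 < s\<^sup>2" "s\<^sup>2 \<le> 1" using assms 3 by (auto simp: abs_square_le_1)
    have "1 + 4 * l / (s\<^sup>2 + (1 - l)\<^sup>2) \<le> 1 + 4 * l / s\<^sup>2"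
      using s2 assms by (intro add_left_mono divide_left_mono mult_pos_pos) (auto simp: add_pos_nonneg)
    also have "\<dots> \<le> (1 + 4 * l) / s\<^sup>2" using s2 by (simp add: add_divide_distrib)
    finally have "ln (1 + 4 * l / (s\<^sup>2 + (1 - l)\<^sup>2)) \<le> ln ((1 + 4 * l) / s\<^sup>2)"
      using assms s2 by (subst ln_le_cancel_iff) (auto intro!: add_pos_nonneg divide_nonneg_nonneg)
    also have "\<dots> = ln (1 + 4 * l) + 4 * ln (\<bar>s\<bar> powr (-1/2))"
      using assms s2 ln_realpow[of "\<bar>s\<bar>" 2] by (simp add: ln_div ln_powr)
    also have "ln (1 + 4 * l) \<le> 4 * l" using assms by (intro ln_add_one_self_le_self) auto
    also have "4 * ln (\<bar>s\<bar> powr (-1/2)) \<le> 4 * (\<bar>s\<bar> powr (-1/2) - 1)"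
      using assms by (intro mult_left_mono ln_le_minus_one) auto
    finally have *: "ln (1 + 4 * l / (s\<^sup>2 + (1 - l)\<^sup>2)) \<le> 4 * l + 4 * (\<bar>s\<bar> powr (-1/2) - 1)" by simp
    have p1: "\<bar>s\<bar> powr (-1/2) \<ge> 1"
      using powr_mono2'[of "-1/2" "\<bar>s\<bar>" 1] 3 assms by simp
    have "4 * (\<bar>s\<bar> powr (-1/2) - 1) \<le> 2 * l * (4 * (\<bar>s\<bar> powr (-1/2) - 1))"
      using 3 p1 mult_right_mono[of 1 "2*l" "4 * (\<bar>s\<bar> powr (-1/2) - 1)"] by simp
    with * have "ln (1 + 4 * l / (s\<^sup>2 + (1 - l)\<^sup>2)) \<le> 2 * l * (4 * \<bar>s\<bar> powr (-1/2))"
      using assms by (simp add: algebra_simps)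
    then have "green 0 1 s l \<le> 4 * \<bar>s\<bar> powr (-1/2)"
      unfolding eq using assms by (simp add: divide_simps mult_ac)
    also have "\<dots> \<le> green_dom s" using ab 3 by simp
    finally show ?thesis .
  qed
  then show ?thesis using eq by simp
qed

lemma green_le_green_dom:
  assumes "0 < y" "0 < h" "t \<noteq> x"
  shows "green x y t h \<le> green_dom ((t - x) / y) / y"
proof -
  have "4 * y * h / ((x - t)\<^sup>2 + (y - h)\<^sup>2) = 4 * (h / y) / (((t - x) / y)\<^sup>2 + (1 - h / y)\<^sup>2)"
  proof -
    have "((t - x) / y)\<^sup>2 + (1 - h / y)\<^sup>2 = ((x - t)\<^sup>2 + (y - h)\<^sup>2) / y\<^sup>2"
      using assms by (simp add: power2_eq_square field_simps)
    then show ?thesis using assms by (simp add: power2_eq_square)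
  qed
  then have "green x y t h = ln (1 + 4 * (h / y) / (((t - x) / y)\<^sup>2 + (1 - h / y)\<^sup>2)) / (2 * (h / y)) / y"
    using assms by (simp add: green_def)
  also have "\<dots> \<le> green_dom ((t - x) / y) / y"
    using assms by (intro divide_right_mono green_dom_bound_unit) auto
  finally show ?thesis .
qed

lemma green_dom_nonneg: "0 \<le> green_dom s"
  by (auto simp: green_dom_def intro!: add_nonneg_nonneg mult_nonneg_nonneg)

lemma integrable_green_dom: "integrable lborel green_dom"
proof -
  have 1: "integrable lborel (\<lambda>s::real. indicator {0..} s * inverse (1 + s\<^sup>2))"
  proof -
    have "(\<integral>\<^sup>+x. ennreal (inverse (1 + x\<^sup>2)) * indicator {0..} x \<partial>lborel) = ennreal (pi/2 - arctan 0)"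
      by (rule nn_integral_FTC_atLeast) (auto intro!: derivative_eq_intros tendsto_arctan_at_top)
    then have "(\<integral>\<^sup>+x. ennreal (indicator {0..} x * inverse (1 + x\<^sup>2)) \<partial>lborel) < \<infinity>"
      by (subst nn_integral_cong[of _ _ "\<lambda>x. ennreal (inverse (1 + x\<^sup>2)) * indicator {0..} x"])
         (auto simp: indicator_def)
    then show ?thesis by (intro integrableI_nonneg) auto
  qed
  have 2: "integrable lborel (\<lambda>s::real. indicator {0..1} s * s powr (-1/2))"
  proof -
    have "(\<lambda>x::real. x powr (-1/2)) integrable_on {0..1}" by (rule integrable_on_powr_from_0) auto
    then have "(\<lambda>x::real. x powr (-1/2)) absolutely_integrable_on {0..1}"
      by (intro nonnegative_absolutely_integrable_1) auto
    then have "integrable lebesgue (\<lambda>s::real. indicator {0..1} s * s powr (-1/2))"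
      by (simp add: set_integrable_def)
    then show ?thesis by (subst (asm) integrable_completion) auto
  qed
  have i1: "integrable lborel (\<lambda>s::real. indicator {0..} (-s) * inverse (1 + s\<^sup>2))"
    using lborel_integrable_real_affine[OF 1, of "-1" 0] by simp
  have i2: "integrable lborel (\<lambda>s::real. indicator {0..1} (-s) * (-s) powr (-1/2))"
    using lborel_integrable_real_affine[OF 2, of "-1" 0] by simp
  have "integrable lborel (\<lambda>s::real. inverse (1 + s\<^sup>2))"
    by (rule Bochner_Integration.integrable_bound[OF Bochner_Integration.integrable_add[OF 1 i1]])
       (auto simp: indicator_def)
  then show ?thesis
    unfolding green_dom_def using 2 i2 by (intro Bochner_Integration.integrable_add integrable_mult_right) auto
qed

text \<open>The universal bound for the potentials of the dips.  The summand \<open>1\<close> is there only to make it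
  visibly positive.\<close>
definition hall_const :: real where "hall_const = 1 + (\<integral>s. green_dom s \<partial>lborel)"

lemma hall_const_pos: "hall_const > 0"
  unfolding hall_const_def using Bochner_Integration.integral_nonneg[of lborel green_dom] green_dom_nonneg by (simp add: add_pos_nonneg)

section \<open>Mean values of Green functions and measurable choice of dips\<close>

lemma green_eq_ln_norm:
  assumes "0 < y" "0 < h" "Complex x y \<noteq> Complex t h"
  shows "green x y t h = (1 / h) * (ln (norm (Complex x y - Complex t (- h))) - ln (norm (Complex x y - Complex t h)))"
proof -
  have n: "ln (norm (Complex x y - Complex t h')) = ln ((x - t)\<^sup>2 + (y - h')\<^sup>2) / 2"
    if "x \<noteq> t \<or> y \<noteq> h'" for h'
  proof -
    have "0 < (x - t)\<^sup>2 + (y - h')\<^sup>2" using that by (auto simp: add_pos_nonneg add_nonneg_pos)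
    then show ?thesis by (simp add: cmod_def ln_sqrt)
  qed
  define q where "q = (x - t)\<^sup>2 + (y - h)\<^sup>2"
  have q: "0 < q" using assms unfolding q_def by (auto simp: add_pos_nonneg add_nonneg_pos)
  have "1 + 4 * y * h / q = ((x - t)\<^sup>2 + (y + h)\<^sup>2) / q"
    using q by (simp add: q_def field_simps power2_eq_square)
  moreover have "0 < (x - t)\<^sup>2 + (y + h)\<^sup>2" using assms by (auto simp: add_nonneg_pos)
  ultimately have "ln (1 + 4 * y * h / q) = ln ((x - t)\<^sup>2 + (y + h)\<^sup>2) - ln q"
    using q by (simp only: ln_divide_pos)
  then show ?thesis
    using n[of h] n[of "-h"] assms unfolding green_def q_def by (auto simp: field_simps)
qed

lemma has_integral_green_circle:
  assumes "cball a r \<subseteq> {z. 0 < Im z}" "0 < r" "0 < h" "Complex t h \<notin> cball a r"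
  shows "((\<lambda>s. green (Re (a + of_real r * cis s)) (Im (a + of_real r * cis s)) t h)
     has_integral 2 * pi * green (Re a) (Im a) t h) {0..2*pi}"
proof -
  have "Complex t (- h) \<notin> cball a r" using assms by force
  then have "harmonic_on (\<lambda>z. (1 / h) * (ln (norm (z - Complex t (- h))) + - ln (norm (z - Complex t h)))) (cball a r)"
    using assms by (intro harmonic_on_cmult harmonic_on_add harmonic_on_uminus harmonic_on_ln_norm)
  then have "((\<lambda>s. (1 / h) * (ln (norm (a + of_real r * cis s - Complex t (- h))) +
       - ln (norm (a + of_real r * cis s - Complex t h))))
     has_integral 2 * pi * ((1 / h) * (ln (norm (a - Complex t (- h))) + - ln (norm (a - Complex t h))))) {0..2*pi}"
    using assms(2) unfolding harmonic_on_def by blast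
  moreover have eq: "(1 / h) * (ln (norm (z - Complex t (- h))) + - ln (norm (z - Complex t h)))
      = green (Re z) (Im z) t h" if "z \<in> cball a r" for z
  proof -
    have "0 < Im z" "z \<noteq> Complex t h" using that assms by auto
    then show ?thesis using green_eq_ln_norm[of "Im z" h "Re z" t] assms(3) by simp
  qed
  moreover have "a \<in> cball a r" using assms(2) by simp
  moreover have "a + of_real r * cis s \<in> cball a r" for s
    using circle_in_cball[of r a s] assms(2) by simp
  ultimately show ?thesis by (simp only: )
qed

text \<open>Take the highest point of \<open>F\<close> above \<open>t\<close> whose height lies between \<open>d\<close> and \<open>H\<close>.  The points \<open>t\<close> at
  which this height is at least \<open>c\<close> form the projection of a compact set.\<close>
lemma selection_measurable:
  fixes F :: "complex set" and \<alpha> \<beta> d H :: real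
  assumes F: "closed F"
  defines "J \<equiv> {t \<in> {\<alpha>..\<beta>}. \<exists>h\<in>{d..H}. Complex t h \<in> F}"
  shows "\<exists>\<eta>. \<eta> \<in> borel_measurable borel \<and> (\<forall>t\<in>J. \<eta> t \<in> {d..H} \<and> Complex t (\<eta> t) \<in> F)" and "closed J"
proof -
  have cl: "closed {t \<in> {\<alpha>..\<beta>}. \<exists>h\<in>{c..H}. Complex t h \<in> F}" for c
  proof -
    have "{t \<in> {\<alpha>..\<beta>}. \<exists>h\<in>{c..H}. Complex t h \<in> F} = Re ` (F \<inter> cbox (Complex \<alpha> c) (Complex \<beta> H))"
      by (force simp: in_cbox_complex_iff image_iff)
    moreover have "compact (F \<inter> cbox (Complex \<alpha> c) (Complex \<beta> H))"
      using F by (intro closed_Int_compact) auto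
    moreover have "continuous_on (F \<inter> cbox (Complex \<alpha> c) (Complex \<beta> H)) Re" by (intro continuous_intros)
    ultimately show ?thesis using compact_continuous_image compact_imp_closed by metis
  qed
  show "closed J" unfolding J_def by (rule cl)
  define S where "S = (\<lambda>t. {h \<in> {d..H}. Complex t h \<in> F})"
  define \<eta> where "\<eta> = (\<lambda>t. if t \<in> J then Sup (S t) else H)"
  have cS: "compact (S t)" for t
  proof -
    have "S t = {d..H} \<inter> (\<lambda>h. Complex t h) -` F" by (auto simp: S_def)
    moreover have "closed ((\<lambda>h. Complex t h) -` F)"
      by (intro continuous_closed_vimage F) (auto simp: Complex_eq intro!: continuous_intros)
    ultimately show ?thesis by (simp add: compact_Int_closed)
  qed
  have sup: "Sup (S t) \<in> S t" "\<And>h. h \<in> S t \<Longrightarrow> h \<le> Sup (S t)" if "t \<in> J" for t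
  proof -
    have ne: "S t \<noteq> {}" using that by (auto simp: S_def J_def)
    have bd: "bdd_above (S t)" by (rule bdd_aboveI[of _ H]) (auto simp: S_def)
    show "Sup (S t) \<in> S t" using closed_contains_Sup[OF ne bd] cS compact_imp_closed by blast
    show "\<And>h. h \<in> S t \<Longrightarrow> h \<le> Sup (S t)" using bd by (simp add: cSup_upper)
  qed
  have "\<eta> \<in> borel_measurable borel"
    unfolding borel_measurable_iff_ge
  proof
    fix c :: real
    have "{t \<in> space borel. c \<le> \<eta> t} = (if c \<le> H then {t \<in> {\<alpha>..\<beta>}. \<exists>h\<in>{max c d..H}. Complex t h \<in> F} \<union> - J else {})"
    proof (intro set_eqI)
      fix t
      show "t \<in> {t \<in> space borel. c \<le> \<eta> t} \<longleftrightarrow>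
        t \<in> (if c \<le> H then {t \<in> {\<alpha>..\<beta>}. \<exists>h\<in>{max c d..H}. Complex t h \<in> F} \<union> - J else {})"
      proof (cases "t \<in> J")
        case False
        then show ?thesis by (auto simp: \<eta>_def)
      next
        case True
        have e1: "c \<le> \<eta> t \<longleftrightarrow> (\<exists>h\<in>{max c d..H}. Complex t h \<in> F)"
        proof
          assume "c \<le> \<eta> t"
          then show "\<exists>h\<in>{max c d..H}. Complex t h \<in> F"
            using sup(1)[OF True] True by (auto simp: \<eta>_def S_def)
        next
          assume "\<exists>h\<in>{max c d..H}. Complex t h \<in> F"
          then obtain h where "h \<in> {max c d..H}" "Complex t h \<in> F" by blast
          then have "h \<in> S t" "c \<le> h" by (auto simp: S_def)
          then show "c \<le> \<eta> t" using sup(2)[OF True] True by (force simp: \<eta>_def)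
        qed
        have e2: "c \<le> \<eta> t \<longrightarrow> c \<le> H" using sup(1)[OF True] True by (auto simp: \<eta>_def S_def)
        have e3: "t \<in> {\<alpha>..\<beta>}" using True by (simp add: J_def)
        show ?thesis
        proof (cases "c \<le> H")
          case c: True
          have "t \<in> {t \<in> space borel. c \<le> \<eta> t} \<longleftrightarrow> c \<le> \<eta> t" by simp
          also note e1
          also have "(\<exists>h\<in>{max c d..H}. Complex t h \<in> F) \<longleftrightarrow>
            t \<in> {t \<in> {\<alpha>..\<beta>}. \<exists>h\<in>{max c d..H}. Complex t h \<in> F} \<union> - J"
            using True e3 by blast
          finally show ?thesis using c by (simp only: if_True)
        next
          case False
          then show ?thesis using e2 by simp
        qed
      qed
    qed
    moreover have "closed {t \<in> {\<alpha>..\<beta>}. \<exists>h\<in>{max c d..H}. Complex t h \<in> F}" by (rule cl)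
    ultimately show "{t \<in> space borel. c \<le> \<eta> t} \<in> sets borel"
      using \<open>closed J\<close> by auto
  qed
  moreover have "\<eta> t \<in> {d..H} \<and> Complex t (\<eta> t) \<in> F" if "t \<in> J" for t
    using sup(1)[OF that] that by (auto simp: \<eta>_def S_def)
  ultimately show "\<exists>\<eta>. \<eta> \<in> borel_measurable borel \<and> (\<forall>t\<in>J. \<eta> t \<in> {d..H} \<and> Complex t (\<eta> t) \<in> F)"
    by blast
qed

section \<open>The potential of the dips\<close>

text \<open>A dip above \<open>t\<close> is a point \<open>t + i \<eta>(t)\<close> outside \<open>U\<close>.  The lower bound \<open>d\<close> for the heights keeps the
  mass on the dips away from the real line, so that its potential vanishes there.\<close>
locale dip_selection =
  fixes U :: "complex set" and \<alpha> \<beta> d H :: real and J :: "real set" and \<eta> :: "real \<Rightarrow> real"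
  assumes openU: "open U" and upper: "U \<subseteq> {z. 0 < Im z}"
    and J: "closed J" "J \<subseteq> {\<alpha>..\<beta>}" and d: "0 < d" and ab: "\<alpha> \<le> \<beta>"
    and meas [measurable]: "\<eta> \<in> borel_measurable borel"
    and \<eta>: "\<And>t. t \<in> J \<Longrightarrow> \<eta> t \<in> {d..H}" "\<And>t. t \<in> J \<Longrightarrow> Complex t (\<eta> t) \<notin> U"
begin

definition kern :: "complex \<Rightarrow> real \<Rightarrow> real"
  where "kern z t = indicator J t * green (Re z) (Im z) t (\<eta> t)"

definition dip_potential :: "complex \<Rightarrow> real"
  where "dip_potential z = (\<integral>t. kern z t \<partial>lborel)"

lemma J_sets [measurable]: "J \<in> sets borel"
  using J by auto

lemma kern_measurable [measurable]: "kern z \<in> borel_measurable lborel"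
  unfolding kern_def green_def by measurable

lemma kern_nonneg: "0 \<le> Im z \<Longrightarrow> 0 \<le> kern z t"
  using \<eta>(1)[of t] d by (auto simp: kern_def indicator_def intro!: green_nonneg)

lemma kern_upper:
  assumes "0 < Im z" "0 < D" "\<And>t. t \<in> J \<Longrightarrow> D \<le> (Re z - t)\<^sup>2 + (Im z - \<eta> t)\<^sup>2"
  shows "kern z t \<le> indicator {\<alpha>..\<beta>} t * (2 * Im z / D)"
  using J(2) green_upper[OF assms(1) _ assms(2) assms(3)[of t]] \<eta>(1)[of t] d assms(1,2)
  by (auto simp: kern_def indicator_def)

lemma dist_dip:
  assumes "ball z r \<subseteq> U" "t \<in> J" "0 < r"
  shows "r\<^sup>2 \<le> (Re z - t)\<^sup>2 + (Im z - \<eta> t)\<^sup>2"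
proof -
  have "Complex t (\<eta> t) \<notin> ball z r" using assms \<eta>(2) by blast
  then have "r \<le> norm (z - Complex t (\<eta> t))" by (simp add: dist_norm)
  then have "r\<^sup>2 \<le> (norm (z - Complex t (\<eta> t)))\<^sup>2" using assms by (intro power_mono) auto
  then show ?thesis by (simp add: cmod_power2)
qed

lemma integrable_const_Icc: "integrable lborel (\<lambda>t. indicator {\<alpha>..\<beta>} t * (c :: real))"
  using ab by (intro integrable_mult_left integrable_real_indicator) (auto simp: emeasure_lborel_Icc)

lemma integral_const_Icc: "(\<integral>t. indicator {\<alpha>..\<beta>} t * (c :: real) \<partial>lborel) = (\<beta> - \<alpha>) * c"
  using ab by simp

lemma kern_integrable:
  assumes "z \<in> U"
  shows "integrable lborel (kern z)"
proof -
  obtain r where r: "0 < r" "ball z r \<subseteq> U" using openU assms open_contains_ball by blast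
  have "norm (kern z t) \<le> norm (indicator {\<alpha>..\<beta>} t * (2 * Im z / r\<^sup>2))" for t
    using kern_upper[of z "r\<^sup>2" t] dist_dip[OF r(2)] r upper assms kern_nonneg[of z t] by auto
  then show ?thesis
    by (intro Bochner_Integration.integrable_bound[OF integrable_const_Icc[of "2 * Im z / r\<^sup>2"]] AE_I2 kern_measurable)
qed

lemma dip_potential_nonneg: "0 \<le> Im z \<Longrightarrow> 0 \<le> dip_potential z"
  unfolding dip_potential_def by (intro Bochner_Integration.integral_nonneg kern_nonneg) auto

lemma dip_potential_upper:
  assumes "z \<in> U" "0 < D" "\<And>t. t \<in> J \<Longrightarrow> D \<le> (Re z - t)\<^sup>2 + (Im z - \<eta> t)\<^sup>2"
  shows "dip_potential z \<le> (\<beta> - \<alpha>) * (2 * Im z / D)"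
proof -
  have "dip_potential z \<le> (\<integral>t. indicator {\<alpha>..\<beta>} t * (2 * Im z / D) \<partial>lborel)"
    unfolding dip_potential_def using assms upper
    by (intro integral_mono kern_integrable integrable_const_Icc kern_upper) auto
  then show ?thesis unfolding integral_const_Icc .
qed

text \<open>In the variable \<open>s = (t - x) / y\<close> the majorant does not depend on \<open>z\<close> any more.  It is not valid for
  a pole exactly above or below \<open>z\<close>, but this concerns a single \<open>t\<close>.\<close>
lemma dip_potential_le_hall_const:
  assumes "z \<in> U"
  shows "dip_potential z \<le> hall_const"
proof -
  have y: "0 < Im z" using upper assms by auto
  have i: "integrable lborel (\<lambda>t. green_dom ((t - Re z) / Im z) / Im z)"
    using lborel_integrable_real_affine[OF integrable_green_dom, of "1 / Im z" "- (Re z / Im z)"] y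
    by (simp add: diff_divide_distrib add.commute)
  have "dip_potential z \<le> (\<integral>t. green_dom ((t - Re z) / Im z) / Im z \<partial>lborel)"
    unfolding dip_potential_def
  proof (rule integral_mono_AE[OF kern_integrable[OF assms] i])
    have "AE t in lborel. t \<noteq> Re z" by (rule AE_lborel_singleton)
    then show "AE t in lborel. kern z t \<le> green_dom ((t - Re z) / Im z) / Im z"
    proof eventually_elim
      case (elim t)
      then show ?case
        using green_le_green_dom[of "Im z" "\<eta> t" t "Re z"] y \<eta>(1)[of t] d green_dom_nonneg[of "(t - Re z) / Im z"]
        by (auto simp: kern_def indicator_def)
    qed
  qed
  also have "\<dots> = (\<integral>s. green_dom s \<partial>lborel)"
    using lborel_integral_real_affine[of "1 / Im z" green_dom "- (Re z / Im z)"] y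
    by (simp add: diff_divide_distrib add.commute)
  finally show ?thesis by (simp add: hall_const_def)
qed

lemma continuous_on_dip_potential: "continuous_on U dip_potential"
  unfolding continuous_on_sequentially
proof safe
  fix x a assume a: "a \<in> U" and x: "\<forall>n. x n \<in> U" and lim: "x \<longlonglongrightarrow> a"
  obtain r where r: "0 < r" "ball a r \<subseteq> U" using openU a open_contains_ball by blast
  obtain N where N: "\<And>n. n \<ge> N \<Longrightarrow> dist (x n) a < r / 2"
    using lim r(1) unfolding lim_sequentially by (meson half_gt_zero)
  have "(\<lambda>n. dip_potential (x (n + N))) \<longlonglongrightarrow> dip_potential a"
    unfolding dip_potential_def
  proof (rule integral_dominated_convergence[where w = "\<lambda>t. indicator {\<alpha>..\<beta>} t * (2 * (Im a + r) / (r/2)\<^sup>2)"])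
    show "AE t in lborel. (\<lambda>i. kern (x (i + N)) t) \<longlonglongrightarrow> kern a t"
    proof (rule AE_I2)
      fix t
      have l: "(\<lambda>i. x (i + N)) \<longlonglongrightarrow> a" using lim by (rule LIMSEQ_ignore_initial_segment)
      show "(\<lambda>i. kern (x (i + N)) t) \<longlonglongrightarrow> kern a t"
      proof (cases "t \<in> J")
        case True
        have h: "0 < \<eta> t" using \<eta>(1)[OF True] d by auto
        have q: "0 < (Re a - t)\<^sup>2 + (Im a - \<eta> t)\<^sup>2"
          using dist_dip[OF r(2) True r(1)] r(1) by (smt (verit) zero_less_power2)
        have "1 + 4 * Im a * \<eta> t / ((Re a - t)\<^sup>2 + (Im a - \<eta> t)\<^sup>2) > 0"
          using upper a h q by (intro add_pos_nonneg divide_nonneg_nonneg) auto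
        then show ?thesis
          unfolding kern_def green_def using l h q by (intro tendsto_intros) auto
      qed (simp add: kern_def)
    qed
    show "AE t in lborel. norm (kern (x (i + N)) t) \<le> indicator {\<alpha>..\<beta>} t * (2 * (Im a + r) / (r/2)\<^sup>2)" for i
    proof (rule AE_I2)
      fix t
      define w where "w = x (i + N)"
      have w: "w \<in> U" "dist w a < r / 2" using x N by (auto simp: w_def)
      have "ball w (r/2) \<subseteq> ball a r" using w(2) by (intro ball_subset_ball_iff[THEN iffD2]) (auto simp: dist_commute)
      then have sub: "ball w (r/2) \<subseteq> U" using r by blast
      have "\<bar>Im w - Im a\<bar> < r / 2" using w(2) abs_Im_le_cmod[of "w - a"] by (simp add: dist_norm)
      then have "Im w \<le> Im a + r" using r(1) by linarith
      then have "2 * Im w / (r/2)\<^sup>2 \<le> 2 * (Im a + r) / (r/2)\<^sup>2"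
        by (intro divide_right_mono) auto
      moreover have "kern w t \<le> indicator {\<alpha>..\<beta>} t * (2 * Im w / (r/2)\<^sup>2)"
        using w upper r(1) by (intro kern_upper dist_dip[OF sub]) auto
      moreover have "0 \<le> kern w t" using w upper by (intro kern_nonneg) auto
      ultimately show "norm (kern (x (i + N)) t) \<le> indicator {\<alpha>..\<beta>} t * (2 * (Im a + r) / (r/2)\<^sup>2)"
        unfolding w_def[symmetric] by (auto simp: indicator_def split: if_splits)
    qed
  qed (auto intro: integrable_const_Icc)
  then show "(dip_potential \<circ> x) \<longlonglongrightarrow> dip_potential a"
    using LIMSEQ_offset[of "dip_potential \<circ> x" N] by (simp add: o_def)
qed

text \<open>Fubini's theorem and the mean value property of each Green function.  The integrand is bounded
  because the circle has positive distance from the complement of \<open>U\<close>, where the poles lie.\<close>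
lemma dip_potential_mean_value:
  assumes r: "0 < r" "cball a r \<subseteq> U"
  shows "((\<lambda>s. dip_potential (a + of_real r * cis s)) has_integral 2 * pi * dip_potential a) {0..2*pi}"
proof -
  define c where "c = (\<lambda>s. a + of_real r * cis s)"
  have cU: "c s \<in> U" for s using circle_in_cball[of r a s] r by (auto simp: c_def)
  have a: "a \<in> U" using r by auto
  obtain e where e: "0 < e" "(\<Union>x\<in>cball a r. ball x e) \<subseteq> U"
    using compact_subset_open_imp_ball_epsilon_subset[OF _ openU r(2)] by auto
  have dd: "ball (c s) e \<subseteq> U" for s
  proof -
    have "c s \<in> cball a r" using circle_in_cball[of r a s] r by (simp add: c_def)
    then show ?thesis using e(2) by blast
  qed
  define B where "B = 2 * (Im a + r) / e\<^sup>2"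
  have B: "kern (c s) t \<le> indicator {\<alpha>..\<beta>} t * B" "0 \<le> kern (c s) t" for s t
  proof -
    have "kern (c s) t \<le> indicator {\<alpha>..\<beta>} t * (2 * Im (c s) / e\<^sup>2)"
      using cU[of s] upper e(1) by (intro kern_upper dist_dip[OF dd]) auto
    moreover have "Im (c s) \<le> Im a + r"
      using r(1) mult_left_le[of "sin s" r] by (simp add: c_def)
    then have "2 * Im (c s) / e\<^sup>2 \<le> B" unfolding B_def by (intro divide_right_mono) auto
    ultimately show "kern (c s) t \<le> indicator {\<alpha>..\<beta>} t * B" by (auto simp: indicator_def split: if_splits)
    show "0 \<le> kern (c s) t" using cU[of s] upper by (intro kern_nonneg) auto
  qed
  define f where "f = (\<lambda>s t. indicator {0..2*pi} s * kern (c s) t)"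
  have mc: "(\<lambda>(s, t). f s t) \<in> borel_measurable (lborel \<Otimes>\<^sub>M lborel)"
    unfolding f_def kern_def green_def c_def by (simp add: case_prod_beta) measurable
  have int: "integrable (lborel \<Otimes>\<^sub>M lborel) (case_prod f)"
  proof (rule integrableI_bounded_set[where A = "{0..2*pi} \<times> {\<alpha>..\<beta>}" and B = B])
    show "emeasure (lborel \<Otimes>\<^sub>M lborel) ({0..2*pi} \<times> {\<alpha>..\<beta>}) < \<infinity>"
      using ab by (subst lborel.emeasure_pair_measure_Times) (auto simp: ennreal_mult_less_top)
    show "AE x\<in>{0..2*pi} \<times> {\<alpha>..\<beta>} in lborel \<Otimes>\<^sub>M lborel. norm (case_prod f x) \<le> B"
    proof (intro AE_I2 impI)
      fix x assume "x \<in> {0..2*pi} \<times> {\<alpha>..\<beta>}"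
      then show "norm (case_prod f x) \<le> B"
        using B[of "fst x" "snd x"] by (auto simp: f_def case_prod_beta indicator_def)
    qed
    show "AE x in lborel \<Otimes>\<^sub>M lborel. x \<notin> {0..2*pi} \<times> {\<alpha>..\<beta>} \<longrightarrow> case_prod f x = 0"
    proof (intro AE_I2 impI)
      fix x assume x: "x \<notin> {0..2*pi} \<times> {\<alpha>..\<beta>}"
      show "case_prod f x = 0"
      proof (cases x)
        case (Pair s t)
        then have "s \<notin> {0..2*pi} \<or> t \<notin> J" using x J(2) by auto
        then show ?thesis using Pair by (auto simp: f_def kern_def)
      qed
    qed
  qed (use mc in auto)
  have inner: "(\<integral>s. f s t \<partial>lborel) = 2 * pi * kern a t" for t
  proof (cases "t \<in> J")
    case True
    define g where "g = (\<lambda>s. green (Re (c s)) (Im (c s)) t (\<eta> t))"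
    have h: "0 < \<eta> t" using \<eta>(1)[OF True] d by auto
    have "(g has_integral 2 * pi * green (Re a) (Im a) t (\<eta> t)) {0..2*pi}"
      unfolding g_def c_def
      using r upper h \<eta>(2)[OF True] by (intro has_integral_green_circle) auto
    moreover have "continuous_on {0..2*pi} g"
    proof -
      have p1: "(Re (c s) - t)\<^sup>2 + (Im (c s) - \<eta> t)\<^sup>2 > 0" for s
        using dist_dip[OF dd True e(1), of s] e(1) by (smt (verit) zero_less_power2)
      have p2: "1 + 4 * Im (c s) * \<eta> t / ((Re (c s) - t)\<^sup>2 + (Im (c s) - \<eta> t)\<^sup>2) > 0" for s
        using upper cU[of s] h by (intro add_pos_nonneg divide_nonneg_nonneg) auto
      have "continuous_on {0..2*pi} c" unfolding c_def by (intro continuous_intros continuous_on_cis)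
      then show ?thesis unfolding g_def green_def
        using h by (intro continuous_intros ballI)
          (simp_all del: sum_power2_eq_zero_iff
             add: less_imp_neq[OF p1, THEN not_sym] less_imp_neq[OF p2, THEN not_sym])
    qed
    then have "(LINT s:{0..2*pi}|lborel. g s) = integral {0..2*pi} g"
      by (intro set_borel_integral_eq_integral borel_integrable_atLeastAtMost')
    ultimately show ?thesis
      using True by (simp add: f_def kern_def g_def set_lebesgue_integral_def integral_unique)
  qed (simp add: f_def kern_def)
  have "(LINT s:{0..2*pi}|lborel. dip_potential (c s)) = (\<integral>s. (\<integral>t. f s t \<partial>lborel) \<partial>lborel)"
    by (simp add: set_lebesgue_integral_def f_def dip_potential_def)
  also have "\<dots> = (\<integral>t. (\<integral>s. f s t \<partial>lborel) \<partial>lborel)"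
    using lborel_pair.Fubini_integral[OF int] by simp
  also have "\<dots> = 2 * pi * dip_potential a" by (simp add: inner dip_potential_def)
  finally have "(LINT s:{0..2*pi}|lborel. dip_potential (c s)) = 2 * pi * dip_potential a" .
  moreover have cont: "continuous_on {0..2*pi} (\<lambda>s. dip_potential (c s))"
    unfolding c_def by (rule continuous_on_circle[OF continuous_on_dip_potential r])
  then have "(LINT s:{0..2*pi}|lborel. dip_potential (c s)) = integral {0..2*pi} (\<lambda>s. dip_potential (c s))"
    by (intro set_borel_integral_eq_integral borel_integrable_atLeastAtMost')
  ultimately have "integral {0..2*pi} (\<lambda>s. dip_potential (c s)) = 2 * pi * dip_potential a" by simp
  with integrable_integral[OF integrable_continuous_real[OF cont]] show ?thesis by (simp add: c_def)
qed

lemma harmonic_on_dip_potential: "harmonic_on dip_potential U"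
  unfolding harmonic_on_def using continuous_on_dip_potential dip_potential_mean_value by blast

lemma dip_potential_boundary_real:
  assumes "Im \<zeta> = 0"
  shows "limsup_le dip_potential U (Some \<zeta>) 0"
  unfolding limsup_le_Some
proof safe
  fix y :: real assume y: "0 < y"
  define K where "K = (\<beta> - \<alpha>) * 2 / (d/2)\<^sup>2"
  have K: "0 \<le> K" using ab by (simp add: K_def)
  define e where "e = min (d/2) (y / (K + 1))"
  have e: "0 < e" using d y K by (simp add: e_def)
  have "dip_potential z < y" if z: "z \<in> U" "dist z \<zeta> < e" for z
  proof -
    have im: "0 < Im z" "Im z < e"
      using z upper abs_Im_le_cmod[of "z - \<zeta>"] assms by (auto simp: dist_norm)
    have "dip_potential z \<le> (\<beta> - \<alpha>) * (2 * Im z / (d/2)\<^sup>2)"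
    proof (rule dip_potential_upper[OF z(1)])
      fix t assume t: "t \<in> J"
      have "d / 2 \<le> \<eta> t - Im z" using im(2) \<eta>(1)[OF t] by (auto simp: e_def)
      then have "(d/2)\<^sup>2 \<le> (\<eta> t - Im z)\<^sup>2" using d by (intro power_mono) auto
      then show "(d/2)\<^sup>2 \<le> (Re z - t)\<^sup>2 + (Im z - \<eta> t)\<^sup>2"
        using zero_le_power2[of "Re z - t"] power2_commute[of "\<eta> t" "Im z"] by linarith
    qed (use d in auto)
    also have "\<dots> = K * Im z" by (simp add: K_def)
    also have "\<dots> \<le> K * e" using im K by (intro mult_left_mono) auto
    also have "\<dots> \<le> K * (y / (K + 1))" using K by (intro mult_left_mono) (auto simp: e_def)
    also have "\<dots> < y" using K y by (simp add: field_simps)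
    finally show ?thesis .
  qed
  then show "\<forall>\<^sub>F z in at \<zeta> within U. dip_potential z < y"
    unfolding eventually_at using e by blast
qed

lemma dip_potential_boundary_infinity: "limsup_le dip_potential U None 0"
  unfolding limsup_le_None
proof safe
  fix y :: real assume y: "0 < y"
  define M where "M = \<bar>\<alpha>\<bar> + \<bar>\<beta>\<bar> + \<bar>H\<bar>"
  define B where "B = max (2 * M + 1) ((\<beta> - \<alpha>) * 8 / y + 1)"
  have "dip_potential z < y" if z: "z \<in> U" "norm z > B" for z
  proof -
    have im: "0 < Im z" "Im z \<le> norm z" using z upper abs_Im_le_cmod[of z] by auto
    have "0 \<le> M" by (simp add: M_def)
    then have nz: "norm z > 2 * M" "norm z > 0" "norm z > (\<beta> - \<alpha>) * 8 / y"
      using z by (auto simp: B_def)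
    have "dip_potential z \<le> (\<beta> - \<alpha>) * (2 * Im z / (norm z / 2)\<^sup>2)"
    proof (rule dip_potential_upper[OF z(1)])
      fix t assume t: "t \<in> J"
      have "norm (Complex t (\<eta> t)) \<le> \<bar>t\<bar> + \<bar>\<eta> t\<bar>" using cmod_le[of "Complex t (\<eta> t)"] by simp
      also have "\<dots> \<le> M" using J(2) t \<eta>(1)[OF t] d by (force simp: M_def)
      finally have "norm z / 2 \<le> norm (z - Complex t (\<eta> t))"
        using norm_triangle_ineq2[of z "Complex t (\<eta> t)"] nz by linarith
      then have "(norm z / 2)\<^sup>2 \<le> (norm (z - Complex t (\<eta> t)))\<^sup>2" by (intro power_mono) auto
      then show "(norm z / 2)\<^sup>2 \<le> (Re z - t)\<^sup>2 + (Im z - \<eta> t)\<^sup>2" by (simp add: cmod_power2)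
    qed (use nz in auto)
    also have "\<dots> \<le> (\<beta> - \<alpha>) * (2 * norm z / (norm z / 2)\<^sup>2)"
      using im ab by (intro mult_left_mono divide_right_mono) auto
    also have "\<dots> = (\<beta> - \<alpha>) * 8 / norm z" using nz by (simp add: power2_eq_square field_simps)
    also have "\<dots> < y" using nz y by (simp add: field_simps)
    finally show ?thesis .
  qed
  then show "\<exists>B. \<forall>z\<in>U. B < norm z \<longrightarrow> dip_potential z < y" by blast
qed

lemma dip_potential_lower:
  assumes "z \<in> U" "H \<le> Im z"
  shows "dip_potential z \<ge> (\<integral>t. indicator J t * (2 * Im z / ((Re z - t)\<^sup>2 + 4 * (Im z)\<^sup>2)) \<partial>lborel)"
  unfolding dip_potential_def
proof (rule integral_mono[OF _ kern_integrable[OF assms(1)]])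
  have y: "0 < Im z" using upper assms by auto
  show "indicator J t * (2 * Im z / ((Re z - t)\<^sup>2 + 4 * (Im z)\<^sup>2)) \<le> kern z t" for t
  proof (cases "t \<in> J")
    case True
    have "Complex t (\<eta> t) \<noteq> z" using \<eta>(2)[OF True] assms by auto
    then have "Re z \<noteq> t \<or> Im z \<noteq> \<eta> t" by (auto simp: complex_eq_iff)
    then show ?thesis using green_lower[of "\<eta> t" "Im z" "Re z" t] True \<eta>(1)[OF True] d assms(2)
      by (auto simp: kern_def)
  qed (simp add: kern_def)
  then show "integrable lborel (\<lambda>t. indicator J t * (2 * Im z / ((Re z - t)\<^sup>2 + 4 * (Im z)\<^sup>2)))"
    using y by (intro Bochner_Integration.integrable_bound[OF kern_integrable[OF assms(1)]] AE_I2)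
      (auto intro!: order_trans[OF _ abs_ge_self])
qed

end

section \<open>Intervals of dips carry no harmonic measure\<close>

lemma limsup_le_bounded:
  assumes "\<And>z. z \<in> U \<Longrightarrow> w z \<le> M"
  shows "limsup_le w U \<zeta> M"
proof (cases \<zeta>)
  case None
  then show ?thesis using assms by (force simp: limsup_le_None)
next
  case (Some c)
  show ?thesis
    unfolding Some limsup_le_Some eventually_at_filter
    using assms by (auto intro!: always_eventually intro: order_le_less_trans)
qed

text \<open>Every dip below the level of \<open>z\<close> contributes at least a Poisson kernel, so that the potential at \<open>z\<close>
  is nearly an angle under which the interval is seen, once the lower bound for the heights of the
  dips is so small that almost no part of the interval is lost.\<close>
lemma hall_potential:
  assumes U: "open U" "U \<subseteq> {z. 0 < Im z}" and ab: "\<alpha> \<le> \<beta>"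
    and dips: "\<And>t e. t \<in> {\<alpha>..\<beta>} \<Longrightarrow> 0 < e \<Longrightarrow> \<exists>h. 0 < h \<and> h < e \<and> Complex t h \<notin> U"
    and z: "z \<in> U" and e: "0 < e"
  obtains P where "harmonic_on P U" "\<And>z. z \<in> U \<Longrightarrow> 0 \<le> P z" "\<And>z. z \<in> U \<Longrightarrow> P z \<le> hall_const"
    "limsup_le P U None 0" "\<And>\<zeta>. Im \<zeta> = 0 \<Longrightarrow> limsup_le P U (Some \<zeta>) 0"
    "P z \<ge> arctan ((\<beta> - Re z) / (2 * Im z)) - arctan ((\<alpha> - Re z) / (2 * Im z)) - e"
proof -
  have y: "0 < Im z" using U z by auto
  define q where "q = (\<lambda>t. 2 * Im z / ((Re z - t)\<^sup>2 + 4 * (Im z)\<^sup>2))"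
  (* Heights of at least 1/(n+1) let the potential vanish on the real line; heights of at most Im z give the Poisson bound at z. *)
  define J where "J = (\<lambda>n. {t \<in> {\<alpha>..\<beta>}. \<exists>h\<in>{1 / real (Suc n)..Im z}. Complex t h \<in> - U})"
  have den: "(Re z - t)\<^sup>2 + 4 * (Im z)\<^sup>2 > 0" for t using y by (intro add_nonneg_pos) auto
  have q0: "0 \<le> q t" for t using y den[of t] by (simp add: q_def)
  have Jc: "closed (J n)" for n
    unfolding J_def by (rule selection_measurable(2)) (use U(1) in auto)
  have iq: "integrable lborel (\<lambda>t. indicator {\<alpha>..\<beta>} t * q t)"
  proof -
    have "continuous_on {\<alpha>..\<beta>} q"
      unfolding q_def using den by (intro continuous_intros) (auto dest!: spec simp: less_imp_neq[THEN not_sym] simp del: sum_power2_eq_zero_iff)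
    from borel_integrable_atLeastAtMost'[OF this] show ?thesis by (simp add: set_integrable_def)
  qed
  have qm [measurable]: "q \<in> borel_measurable borel" unfolding q_def by measurable
  have Jm [measurable]: "J n \<in> sets borel" for n using Jc by auto
  have "(\<lambda>n. \<integral>t. indicator (J n) t * q t \<partial>lborel) \<longlonglongrightarrow> (\<integral>t. indicator {\<alpha>..\<beta>} t * q t \<partial>lborel)"
  proof (rule integral_dominated_convergence[OF _ _ iq])
    show "AE t in lborel. (\<lambda>n. indicator (J n) t * q t) \<longlonglongrightarrow> indicator {\<alpha>..\<beta>} t * q t"
    proof (rule AE_I2)
      fix t
      show "(\<lambda>n. indicator (J n) t * q t) \<longlonglongrightarrow> indicator {\<alpha>..\<beta>} t * q t"
      proof (cases "t \<in> {\<alpha>..\<beta>}")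
        case True
        then obtain h where h: "0 < h" "h < Im z" "Complex t h \<notin> U" using dips y by blast
        obtain N where N: "1 / real (Suc N) < h" using nat_approx_posE[OF h(1)] by blast
        have "indicator (J n) t * q t = indicator {\<alpha>..\<beta>} t * q t" if "N \<le> n" for n
        proof -
          have "1 / real (Suc n) \<le> 1 / real (Suc N)" using that by (simp add: field_simps)
          then have "t \<in> J n" using True h N by (auto simp: J_def intro!: bexI[of _ h])
          then show ?thesis using True by simp
        qed
        then have "\<forall>\<^sub>F n in sequentially. indicator (J n) t * q t = indicator {\<alpha>..\<beta>} t * q t"
          using eventually_sequentially by blast
        then show ?thesis by (rule tendsto_eventually)
      next
        case False
        then have "t \<notin> J n" for n by (auto simp: J_def)
        then show ?thesis using False by simp
      qed
    qed
    show "AE t in lborel. norm (indicator (J n) t * q t) \<le> indicator {\<alpha>..\<beta>} t * q t" for n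
      using q0 by (intro AE_I2) (auto simp: indicator_def J_def)
  qed auto
  moreover have "(\<integral>t. indicator {\<alpha>..\<beta>} t * q t \<partial>lborel) =
      arctan ((\<beta> - Re z) / (2 * Im z)) - arctan ((\<alpha> - Re z) / (2 * Im z))"
  proof -
    have "(\<integral>t. q t * indicator {\<alpha>..\<beta>} t \<partial>lborel) =
      arctan ((\<beta> - Re z) / (2 * Im z)) - arctan ((\<alpha> - Re z) / (2 * Im z))"
    proof (rule integral_FTC_Icc_real[OF ab])
      fix t
      show "((\<lambda>t. arctan ((t - Re z) / (2 * Im z))) has_real_derivative q t) (at t)"
      proof -
        have "((\<lambda>t. arctan ((t - Re z) / (2 * Im z))) has_real_derivative
          inverse (1 + ((t - Re z) / (2 * Im z))\<^sup>2) * (1 / (2 * Im z))) (at t)"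
          using y by (auto intro!: derivative_eq_intros simp: field_simps)
        moreover have "1 + ((t - Re z) / (2 * Im z))\<^sup>2 = ((Re z - t)\<^sup>2 + 4 * (Im z)\<^sup>2) / (4 * (Im z)\<^sup>2)"
          using y by (simp add: field_simps power2_eq_square)
        moreover have f: "inverse (D / (4 * v\<^sup>2)) * (1 / (2 * v)) = 2 * v / D" if "0 < D" "0 < v" for D v :: real
          using that by (simp add: field_simps power2_eq_square)
        ultimately show ?thesis using f[OF den[of t] y] by (simp only: q_def)
      qed
      show "isCont q t" unfolding q_def using den[of t] by (intro continuous_intros) simp
    qed
    then show ?thesis by (simp add: mult.commute)
  qed
  ultimately have "\<forall>\<^sub>F n in sequentially. arctan ((\<beta> - Re z) / (2 * Im z)) - arctan ((\<alpha> - Re z) / (2 * Im z)) - e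
      < (\<integral>t. indicator (J n) t * q t \<partial>lborel)"
    using e by (intro order_tendstoD(1)) auto
  then obtain n where n: "arctan ((\<beta> - Re z) / (2 * Im z)) - arctan ((\<alpha> - Re z) / (2 * Im z)) - e
      < (\<integral>t. indicator (J n) t * q t \<partial>lborel)"
    using eventually_happens'[OF sequentially_bot] by blast
  have "\<exists>\<eta>. \<eta> \<in> borel_measurable borel \<and> (\<forall>t\<in>J n. \<eta> t \<in> {1 / real (Suc n)..Im z} \<and> Complex t (\<eta> t) \<in> - U)"
    unfolding J_def by (rule selection_measurable(1)) (use U(1) in auto)
  then obtain \<eta> where \<eta>: "\<eta> \<in> borel_measurable borel"
    "\<And>t. t \<in> J n \<Longrightarrow> \<eta> t \<in> {1 / real (Suc n)..Im z}" "\<And>t. t \<in> J n \<Longrightarrow> Complex t (\<eta> t) \<notin> U"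
    by auto
  interpret dip_selection U \<alpha> \<beta> "1 / real (Suc n)" "Im z" "J n" \<eta>
    by unfold_locales (use U ab Jc \<eta> in \<open>auto simp: J_def\<close>)
  show thesis
  proof (rule that[of dip_potential])
    show "0 \<le> dip_potential w" if "w \<in> U" for w using that U by (intro dip_potential_nonneg) auto
    show "arctan ((\<beta> - Re z) / (2 * Im z)) - arctan ((\<alpha> - Re z) / (2 * Im z)) - e \<le> dip_potential z"
      using dip_potential_lower[OF z] n unfolding q_def by simp
  qed (fact harmonic_on_dip_potential dip_potential_le_hall_const dip_potential_boundary_infinity dip_potential_boundary_real)+
qed

text \<open>Adding \<open>M / hall_const\<close> times the potential leaves the boundary bound \<open>M\<close> intact: on the real line
  and at infinity the potential vanishes, and elsewhere it contributes at most \<open>M\<close> while \<open>s\<close> has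
  boundary limits at most \<open>0\<close>.\<close>
lemma subharmonic_dip_bound:
  assumes U: "open U" "U \<subseteq> {z. 0 < Im z}" and ab: "\<alpha> \<le> \<beta>"
    and dips: "\<And>t e. t \<in> {\<alpha>..\<beta>} \<Longrightarrow> 0 < e \<Longrightarrow> \<exists>h. 0 < h \<and> h < e \<and> Complex t h \<notin> U"
    and s: "subharmonic_on s U" "\<And>z. z \<in> U \<Longrightarrow> s z \<le> M" and M: "0 \<le> M"
    and bd: "\<And>c. Some c \<in> sphere_boundary U \<Longrightarrow> Im c \<noteq> 0 \<Longrightarrow> limsup_le s U (Some c) 0"
    and z: "z \<in> U"
  shows "s z \<le> M * (1 - (arctan ((\<beta> - Re z) / (2 * Im z)) - arctan ((\<alpha> - Re z) / (2 * Im z))) / hall_const)"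
proof -
  let ?A = "arctan ((\<beta> - Re z) / (2 * Im z)) - arctan ((\<alpha> - Re z) / (2 * Im z))"
  have C: "0 < hall_const" by (rule hall_const_pos)
  have *: "s z \<le> M * (1 - (?A - e) / hall_const)" if e: "0 < e" for e
  proof -
    obtain P where P: "harmonic_on P U" "\<And>z. z \<in> U \<Longrightarrow> 0 \<le> P z" "\<And>z. z \<in> U \<Longrightarrow> P z \<le> hall_const"
      "limsup_le P U None 0" "\<And>\<zeta>. Im \<zeta> = 0 \<Longrightarrow> limsup_le P U (Some \<zeta>) 0" "P z \<ge> ?A - e"
      using hall_potential[OF U ab dips z e] by blast
    have k: "0 \<le> M / hall_const" using M C by simp
    have sM: "limsup_le s U \<zeta> M" for \<zeta>
      by (rule limsup_le_bounded[OF s(2)])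
    have scale: "limsup_le (\<lambda>z. M / hall_const * P z) U \<zeta> 0" if "limsup_le P U \<zeta> 0" for \<zeta>
      unfolding limsup_le_def
    proof safe
      fix y :: real assume y: "0 < y"
      have "0 < y / (M / hall_const + 1)" using y k by simp
      with that have "\<forall>\<^sub>F p in atin_within riemann_sphere \<zeta> (Some ` U). P (the p) < y / (M / hall_const + 1)"
        unfolding limsup_le_def by simp
      then show "\<forall>\<^sub>F p in atin_within riemann_sphere \<zeta> (Some ` U). M / hall_const * P (the p) < y"
      proof eventually_elim
        case (elim p)
        have "M / hall_const * P (the p) \<le> M / hall_const * (y / (M / hall_const + 1))"
          using elim k by (intro mult_left_mono) auto
        also have "\<dots> < y"
        proof -
          have "k * (y / (k + 1)) < y" if "0 \<le> k" for k :: real using that y by (simp add: field_simps)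
          from this[OF k] show ?thesis .
        qed
        finally show ?case .
      qed
    qed
    have "s z + M / hall_const * P z \<le> M"
    proof (rule maximum_principle[OF U(1) _ _ z])
      show "subharmonic_on (\<lambda>z. s z + M / hall_const * P z) U"
        by (intro subharmonic_on_add[OF s(1)] harmonic_on_imp_subharmonic_on harmonic_on_cmult P(1))
      fix \<zeta> assume \<zeta>: "\<zeta> \<in> sphere_boundary U"
      show "limsup_le (\<lambda>z. s z + M / hall_const * P z) U \<zeta> M"
      proof (cases "\<exists>c. \<zeta> = Some c \<and> Im c \<noteq> 0")
        case True
        then have "limsup_le s U \<zeta> 0" using bd \<zeta> by auto
        moreover have "limsup_le (\<lambda>z. M / hall_const * P z) U \<zeta> M"
        proof -
          have "M / hall_const * P w \<le> M" if "w \<in> U" for w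
            using mult_left_mono[OF P(3)[OF that] k] C by simp
          then show ?thesis by (rule limsup_le_bounded)
        qed
        ultimately show ?thesis using limsup_le_add[of s U \<zeta> 0 _ M] by simp
      next
        case False
        then have "limsup_le P U \<zeta> 0" using P(4,5) by (cases \<zeta>) auto
        from limsup_le_add[OF sM scale[OF this]] show ?thesis by simp
      qed
    qed
    moreover have "M / hall_const * (?A - e) \<le> M / hall_const * P z"
      using P(6) k by (intro mult_left_mono)
    ultimately have "s z + M / hall_const * (?A - e) \<le> M" by linarith
    moreover have "M * (1 - X / hall_const) = M - M / hall_const * X" for X
      by (simp add: right_diff_distrib)
    ultimately show ?thesis by (smt (verit))
  qed
  show ?thesis
  proof (rule field_le_epsilon)
    fix e :: real assume e: "0 < e"
    define e' where "e' = e * hall_const / (M + 1)"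
    have "M * e' / hall_const = e * (M / (M + 1))" using C by (simp add: e'_def)
    moreover have "e * (M / (M + 1)) \<le> e * 1" using e M by (intro mult_left_mono) auto
    moreover have "0 < e'" using e M C by (auto simp: e'_def)
    from *[OF this] have "s z \<le> M * (1 - (?A - e') / hall_const)" .
    moreover have "M * (1 - (X - e') / hall_const) = M * (1 - X / hall_const) + M * e' / hall_const" for X
      by (simp add: diff_divide_distrib right_diff_distrib)
    ultimately show "s z \<le> M * (1 - ?A / hall_const) + e" by (smt (verit))
  qed
qed

text \<open>Let \<open>M\<close> be the supremum of \<open>s\<close>.  Close to a point of \<open>X\<close> the difference of arctangents in
  \<open>subharmonic_dip_bound\<close> is at least \<open>\<pi>/2\<close>, which improves the bound \<open>M\<close> to a fixed fraction of it
  there.  If \<open>M\<close> were positive, the maximum principle would make it smaller than itself.\<close>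
lemma subharmonic_nonpos_of_dips:
  assumes U: "open U" "U \<subseteq> {z. 0 < Im z}"
    and dips: "\<And>x. x \<in> X \<Longrightarrow> \<exists>\<alpha> \<beta>. \<alpha> < x \<and> x < \<beta> \<and>
        (\<forall>t\<in>{\<alpha>..\<beta>}. \<forall>e>0. \<exists>h. 0 < h \<and> h < e \<and> Complex t h \<notin> U)"
    and s: "subharmonic_on s U" "\<And>z. z \<in> U \<Longrightarrow> s z \<le> M0"
    and bd: "\<And>\<zeta>. \<zeta> \<in> sphere_boundary U \<Longrightarrow> \<zeta> \<notin> Some ` of_real ` X \<Longrightarrow> limsup_le s U \<zeta> 0"
    and z: "z \<in> U"
  shows "s z \<le> 0"
proof (rule ccontr)
  assume "\<not> s z \<le> 0"
  define M where "M = Sup (s ` U)"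
  have bdd: "bdd_above (s ` U)" by (rule bdd_aboveI2[OF s(2)])
  have sM: "s w \<le> M" if "w \<in> U" for w unfolding M_def using that bdd by (intro cSup_upper) auto
  have M: "0 < M" using sM[OF z] \<open>\<not> s z \<le> 0\<close> by linarith
  have C: "0 < hall_const" by (rule hall_const_pos)
  define m where "m = max 0 (M * (1 - (pi/2) / hall_const))"
  have "w \<in> U \<Longrightarrow> s w \<le> m" for w
  proof (rule maximum_principle[OF U(1) s(1)])
    fix \<zeta> assume \<zeta>: "\<zeta> \<in> sphere_boundary U"
    show "limsup_le s U \<zeta> m"
    proof (cases "\<zeta> \<in> Some ` of_real ` X")
      case False
      from limsup_le_mono[OF bd[OF \<zeta> False], of s m] show ?thesis by (simp add: m_def)
    next
      case True
      then obtain x where x: "x \<in> X" "\<zeta> = Some (of_real x)" by auto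
      from dips[OF x(1)] obtain \<alpha> \<beta> where ab: "\<alpha> < x" "x < \<beta>"
        "\<forall>t\<in>{\<alpha>..\<beta>}. \<forall>e>0. \<exists>h. 0 < h \<and> h < e \<and> Complex t h \<notin> U" by (elim exE conjE)
      define \<rho> where "\<rho> = min (\<beta> - x) (x - \<alpha>) / 3"
      have \<rho>: "0 < \<rho>" "3 * \<rho> \<le> \<beta> - x" "3 * \<rho> \<le> x - \<alpha>" using ab by (auto simp: \<rho>_def)
      have small: "s w \<le> m" if w: "w \<in> U" "dist w (of_real x) < \<rho>" for w
      proof -
        have y: "0 < Im w" using U(2) w by auto
        have "Im w < \<rho>" "\<bar>Re w - x\<bar> < \<rho>"
          using w(2) abs_Im_le_cmod[of "w - of_real x"] abs_Re_le_cmod[of "w - of_real x"]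
          by (auto simp: dist_norm)
        then have "1 \<le> (\<beta> - Re w) / (2 * Im w)" "(\<alpha> - Re w) / (2 * Im w) \<le> -1"
          using \<rho> y by (auto simp: field_simps)
        then have "pi / 4 \<le> arctan ((\<beta> - Re w) / (2 * Im w))" "arctan ((\<alpha> - Re w) / (2 * Im w)) \<le> - (pi / 4)"
          using arctan_le_iff[of 1 "(\<beta> - Re w) / (2 * Im w)"] arctan_le_iff[of "(\<alpha> - Re w) / (2 * Im w)" "-1"]
            arctan_one arctan_minus[of 1] by simp_all
        then have A: "pi / 2 \<le> arctan ((\<beta> - Re w) / (2 * Im w)) - arctan ((\<alpha> - Re w) / (2 * Im w))" by simp
        have "s w \<le> M * (1 - (arctan ((\<beta> - Re w) / (2 * Im w)) - arctan ((\<alpha> - Re w) / (2 * Im w))) / hall_const)"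
        proof (rule subharmonic_dip_bound[OF U _ _ s(1) sM _ _ w(1)])
          show "\<exists>h>0. h < e \<and> Complex t h \<notin> U" if "t \<in> {\<alpha>..\<beta>}" "0 < e" for t e
            using ab(3) that by auto
          show "limsup_le s U (Some c) 0" if "Some c \<in> sphere_boundary U" "Im c \<noteq> 0" for c
            using that by (intro bd) auto
        qed (use ab M in auto)
        also have "\<dots> \<le> M * (1 - (pi / 2) / hall_const)"
          using A M C by (intro mult_left_mono diff_left_mono divide_right_mono) auto
        also have "\<dots> \<le> m" by (simp add: m_def)
        finally show ?thesis .
      qed
      show ?thesis
        unfolding x(2) limsup_le_Some
      proof safe
        fix y assume y: "m < y"
        then have "\<forall>w\<in>U. w \<noteq> of_real x \<and> dist w (of_real x) < \<rho> \<longrightarrow> s w < y"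
          using small by force
        then show "\<forall>\<^sub>F w in at (of_real x) within U. s w < y"
          unfolding eventually_at using \<rho>(1) by blast
      qed
    qed
  qed
  then have "M \<le> m" unfolding M_def using z by (intro cSup_least) auto
  moreover have "m < M"
  proof -
    have "M * (1 - (pi/2) / hall_const) < M * 1" using M C by (intro mult_strict_left_mono) auto
    then show ?thesis using M by (simp add: m_def)
  qed
  ultimately show False by linarith
qed

section \<open>Identification of the harmonic measure\<close>

text \<open>Each summand is the logarithm of \<open>2 \<bar>z + i\<bar> / \<bar>z - q\<bar>\<close>: infinite at \<open>q\<close>, and nonnegative on the whole
  upper half-plane, also near infinity, because \<open>-i\<close> lies below the half-plane.\<close>
definition log_barrier :: "real set \<Rightarrow> complex \<Rightarrow> real"
  where "log_barrier Q z = (\<Sum>q\<in>Q. ln 2 + ln (norm (z - (- \<i>))) + - ln (norm (z - of_real q)))"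

lemma harmonic_on_log_barrier:
  assumes "finite Q" "U \<subseteq> {z. 0 < Im z}"
  shows "harmonic_on (log_barrier Q) U"
  unfolding log_barrier_def
proof (rule harmonic_on_sum[OF assms(1)])
  fix q
  have "- \<i> \<notin> U" "of_real q \<notin> U" using assms by auto
  then show "harmonic_on (\<lambda>z. ln 2 + ln (norm (z - (- \<i>))) + - ln (norm (z - of_real q))) U"
    by (intro harmonic_on_add harmonic_on_const harmonic_on_uminus harmonic_on_ln_norm)
qed

lemma log_barrier_term:
  assumes "0 < Im z" "q \<in> {-1..1}"
  shows "0 \<le> ln 2 + ln (norm (z - (- \<i>))) + - ln (norm (z - of_real q))"
    and "1 \<le> norm (z - (- \<i>))"
proof -
  have "1 \<le> \<bar>Im (z - (- \<i>))\<bar>" using assms by simp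
  also have "\<dots> \<le> norm (z - (- \<i>))" by (rule abs_Im_le_cmod)
  finally show i: "1 \<le> norm (z - (- \<i>))" .
  have n: "norm z \<le> norm (z - (- \<i>))"
  proof -
    have "(Im z)\<^sup>2 \<le> (Im z + 1)\<^sup>2" using assms by (intro power_mono) auto
    then show ?thesis by (simp add: cmod_def)
  qed
  have "norm (z - of_real q) \<le> norm z + norm (of_real q :: complex)" by (rule norm_triangle_ineq4)
  also have "\<dots> \<le> norm z + 1" using assms by auto
  also have "\<dots> \<le> 2 * norm (z - (- \<i>))" using n i by linarith
  finally have "norm (z - of_real q) \<le> 2 * norm (z - (- \<i>))" .
  moreover have "0 < norm (z - of_real q)" using assms by auto
  ultimately have "ln (norm (z - of_real q)) \<le> ln (2 * norm (z - (- \<i>)))"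
    using i by (intro iffD2[OF ln_le_cancel_iff]) linarith+
  also have "\<dots> = ln 2 + ln (norm (z - (- \<i>)))" using i by (intro ln_mult_pos) auto
  finally show "0 \<le> ln 2 + ln (norm (z - (- \<i>))) + - ln (norm (z - of_real q))" by simp
qed

lemma log_barrier_nonneg: "0 < Im z \<Longrightarrow> Q \<subseteq> {-1..1} \<Longrightarrow> 0 \<le> log_barrier Q z"
  unfolding log_barrier_def by (intro sum_nonneg log_barrier_term(1)) auto

lemma log_barrier_large:
  assumes "0 < Im z" "Q \<subseteq> {-1..1}" "finite Q" "q \<in> Q" "norm (z - of_real q) \<le> exp (- K)"
  shows "K \<le> log_barrier Q z"
proof -
  have q: "q \<in> {-1..1}" using assms by auto
  have "0 < norm (z - of_real q)" using assms(1) by auto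
  then have "ln (norm (z - of_real q)) \<le> ln (exp (- K))"
    using assms(5) by (intro iffD2[OF ln_le_cancel_iff]) auto
  then have "ln (norm (z - of_real q)) \<le> - K" by simp
  moreover have "0 \<le> ln (norm (z - (- \<i>)))" using log_barrier_term(2)[OF assms(1) q] by simp
  ultimately have "K \<le> ln 2 + ln (norm (z - (- \<i>))) + - ln (norm (z - of_real q))"
    using ln_ge_zero[of "2::real"] by linarith
  also have "\<dots> \<le> log_barrier Q z"
    unfolding log_barrier_def using assms by (intro member_le_sum log_barrier_term(1)) auto
  finally show ?thesis .
qed

lemma limsup_le_log_barrier:
  assumes "U \<subseteq> {z. 0 < Im z}" "Q \<subseteq> {-1..1}" "finite Q" "q \<in> Q" "0 < e" "\<And>z. z \<in> U \<Longrightarrow> w z \<le> M"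
  shows "limsup_le (\<lambda>z. w z + - e * log_barrier Q z) U (Some (of_real q)) m"
  unfolding limsup_le_Some
proof safe
  fix y assume y: "m < y"
  define K where "K = (M - m) / e"
  have "w z + - e * log_barrier Q z < y" if z: "z \<in> U" "dist z (of_real q) < exp (- K)" for z
  proof -
    have "K \<le> log_barrier Q z" using assms z by (intro log_barrier_large[where q = q]) (auto simp: dist_norm)
    then have "e * K \<le> e * log_barrier Q z" using assms(5) by (intro mult_left_mono) auto
    moreover have "e * K = M - m" using assms(5) by (simp add: K_def)
    ultimately show ?thesis using assms(6)[OF z(1)] y by simp
  qed
  then show "\<forall>\<^sub>F z in at (of_real q) within U. w z + - e * log_barrier Q z < y"
    unfolding eventually_at by (intro exI[of _ "exp (- K)"]) auto
qed

lemma in_open_interval: "Some (of_real x) \<in> open_interval \<longleftrightarrow> x \<in> {-1<..<1}"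
  by (auto simp: open_interval_def)

lemma in_closed_interval: "Some (of_real x) \<in> closed_interval \<longleftrightarrow> x \<in> {-1..1}"
  by (auto simp: closed_interval_def)

lemma open_subset_closed_interval: "open_interval \<subseteq> closed_interval"
  by (force simp: open_interval_def closed_interval_def)

text \<open>The behaviour of \<open>h\<close> at the four points \<open>-1\<close>, \<open>a\<close>, \<open>b\<close>, \<open>1\<close> is unknown.  A small multiple of the
  logarithmic barrier makes up for this: it is subtracted from \<open>h\<close> to obtain a member of the Perron family, and
  from \<open>u - h\<close> to bound the members \<open>u\<close> from above.  Over \<open>(-1, 1) - [a, b]\<close> nothing
  bounds \<open>h\<close> from below except \<open>0\<close>, and the upper estimate rests on the dips.\<close>
lemma harmonic_measure_eqI:
  assumes U: "open U" "U \<subseteq> {z. 0 < Im z}" and ab: "-1 \<le> a" "a \<le> b" "b \<le> 1"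
    and h: "harmonic_on h U" "\<And>z. z \<in> U \<Longrightarrow> 0 \<le> h z" "\<And>z. z \<in> U \<Longrightarrow> h z \<le> 1"
    and one: "\<And>x. a < x \<Longrightarrow> x < b \<Longrightarrow> limsup_le (\<lambda>z. - h z) U (Some (of_real x)) (-1)"
    and dips: "\<And>x e. x \<in> {-1<..<1} - {a..b} \<Longrightarrow> 0 < e \<Longrightarrow> \<exists>t. 0 < t \<and> t < e \<and> Complex x t \<notin> U"
    and zero: "\<And>\<zeta>. \<zeta> \<in> sphere_boundary U \<Longrightarrow> \<zeta> \<notin> closed_interval \<Longrightarrow> limsup_le h U \<zeta> 0"
    and z: "z \<in> U"
  shows "harmonic_measure z open_interval U = h z"
proof -
  define Q where "Q = {-1, a, b, 1}"
  have Q: "finite Q" "Q \<subseteq> {-1..1}" using ab by (auto simp: Q_def)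
  let ?p = "log_barrier Q"
  have p: "harmonic_on ?p U" by (rule harmonic_on_log_barrier[OF Q(1) U(2)])
  have p0: "0 \<le> ?p z" if "z \<in> U" for z using that U(2) Q by (intro log_barrier_nonneg) auto
  define \<F> where "\<F> = perron_family U (indicator open_interval)"
  have F: "u \<in> \<F> \<longleftrightarrow> subharmonic_on u U \<and>
      (\<forall>\<zeta>\<in>sphere_boundary U. limsup_le u U \<zeta> (indicator open_interval \<zeta>))" for u
    by (simp add: \<F>_def perron_family_def limsup_le_iff_Limsup)
  have upper: "u w \<le> h w" if u: "u \<in> \<F>" and w: "w \<in> U" for u w
  proof -
    have us: "subharmonic_on u U" and ub: "\<And>\<zeta>. \<zeta> \<in> sphere_boundary U \<Longrightarrow> limsup_le u U \<zeta> (indicator open_interval \<zeta>)"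
      using u F by auto
    have u1: "u v \<le> 1" if "v \<in> U" for v
    proof (rule maximum_principle[OF U(1) us _ that])
      fix \<zeta> assume "\<zeta> \<in> sphere_boundary U"
      from limsup_le_mono[OF ub[OF this], of u 1] show "limsup_le u U \<zeta> 1" by (simp add: indicator_def)
    qed
    have uh: "u w \<le> h w + e * ?p w" if e: "0 < e" for e
    proof -
      define s where "s = (\<lambda>z. (u z + - h z) + - e * ?p z)"
      have ss: "subharmonic_on s U"
        unfolding s_def
        by (intro subharmonic_on_add us harmonic_on_imp_subharmonic_on harmonic_on_uminus h(1) harmonic_on_cmult p)
      have su: "s v \<le> u v" if "v \<in> U" for v
        using h(2)[OF that] mult_nonneg_nonneg[OF less_imp_le[OF e] p0[OF that]] by (simp add: s_def)
      have suh: "s v \<le> u v + - h v" if "v \<in> U" for v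
        using p0[OF that] e by (simp add: s_def)
      have uh1: "u v + - h v \<le> 1" if "v \<in> U" for v using u1[OF that] h(2)[OF that] by simp
      have "s w \<le> 0"
      proof (rule subharmonic_nonpos_of_dips[OF U _ ss _ _ w, where X = "{-1<..<1} - {a..b}" and ?M0.0 = 1])
        show "s v \<le> 1" if "v \<in> U" for v using suh[OF that] uh1[OF that] by simp
        show "\<exists>\<alpha> \<beta>. \<alpha> < x \<and> x < \<beta> \<and> (\<forall>t\<in>{\<alpha>..\<beta>}. \<forall>e>0. \<exists>h>0. h < e \<and> Complex t h \<notin> U)"
          if x: "x \<in> {-1<..<1} - {a..b}" for x
        proof (cases "x < a")
          case True
          then have "{(x - 1) / 2..(x + a) / 2} \<subseteq> {-1<..<1} - {a..b}" using x ab by auto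
          then show ?thesis using dips x True
            by (intro exI[of _ "(x - 1) / 2"] exI[of _ "(x + a) / 2"]) auto
        next
          case False
          then have "{(x + b) / 2..(x + 1) / 2} \<subseteq> {-1<..<1} - {a..b}" using x ab by auto
          then show ?thesis using dips x False
            by (intro exI[of _ "(x + b) / 2"] exI[of _ "(x + 1) / 2"]) auto
        qed
        fix \<zeta> assume \<zeta>: "\<zeta> \<in> sphere_boundary U" "\<zeta> \<notin> Some ` of_real ` ({-1<..<1} - {a..b})"
        show "limsup_le s U \<zeta> 0"
        proof (cases "\<zeta> \<in> closed_interval")
          case False
          then have "\<zeta> \<notin> open_interval" using open_subset_closed_interval by auto
          then have "limsup_le u U \<zeta> 0" using ub[OF \<zeta>(1)] by simp
          then show ?thesis by (rule limsup_le_mono) (use su in auto)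
        next
          case True
          then obtain x where x: "\<zeta> = Some (of_real x)" "x \<in> {-1..1}" by (auto simp: closed_interval_def)
          have "x \<notin> {-1<..<1} - {a..b}" using \<zeta>(2) x(1) by auto
          then consider "x \<in> Q" | "a < x" "x < b" using x(2) ab by (force simp: Q_def)
          then show ?thesis
          proof cases
            case 1
            show ?thesis unfolding x(1) s_def
              by (rule limsup_le_log_barrier[OF U(2) Q(2,1) 1 e uh1])
          next
            case 2
            have "limsup_le (\<lambda>z. u z + - h z) U \<zeta> (1 + - 1)"
              using limsup_le_add[OF limsup_le_bounded[of U u 1 \<zeta>, OF u1] one[OF 2, folded x(1)]] by simp
            then show ?thesis by (rule limsup_le_mono) (use suh in auto)
          qed
        qed
      qed
      then show ?thesis by (simp add: s_def)
    qed
    show ?thesis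
    proof (rule field_le_epsilon)
      fix e :: real assume e: "0 < e"
      have "0 < e / (?p w + 1)" using e p0[OF w] by simp
      from uh[OF this] have "u w \<le> h w + e * (?p w / (?p w + 1))" by simp
      also have "\<dots> \<le> h w + e * 1" using e p0[OF w] by (intro add_left_mono mult_left_mono) auto
      finally show "u w \<le> h w + e" by simp
    qed
  qed
  have lower: "(\<lambda>z. h z + - e * ?p z) \<in> \<F>" if e: "0 < e" for e
    unfolding F
  proof (intro conjI ballI)
    show "subharmonic_on (\<lambda>z. h z + - e * ?p z) U"
      by (intro subharmonic_on_add harmonic_on_imp_subharmonic_on h(1) harmonic_on_cmult p)
    have le: "h v + - e * ?p v \<le> h v" if "v \<in> U" for v using p0[OF that] e by simp
    fix \<zeta> assume \<zeta>: "\<zeta> \<in> sphere_boundary U"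
    show "limsup_le (\<lambda>z. h z + - e * ?p z) U \<zeta> (indicator open_interval \<zeta>)"
    proof (cases "\<zeta> \<in> open_interval")
      case True
      have "h v + - e * ?p v \<le> 1" if "v \<in> U" for v using le[OF that] h(3)[OF that] by linarith
      then show ?thesis using limsup_le_bounded[of U _ 1 \<zeta>] True by simp
    next
      case False
      show ?thesis
      proof (cases "\<zeta> \<in> closed_interval")
        case True
        then obtain x where x: "\<zeta> = Some (of_real x)" "x \<in> {-1..1}" by (auto simp: closed_interval_def)
        then have "x \<in> Q" using False by (auto simp: in_open_interval Q_def)
        then show ?thesis unfolding x(1)
          by (intro limsup_le_log_barrier[OF U(2) Q(2,1) _ e h(3)])
      next
        case F: False
        from limsup_le_mono[OF zero[OF \<zeta> F], of "\<lambda>z. h z + - e * ?p z" 0] le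
        show ?thesis using False by simp
      qed
    qed
  qed
  have "(SUP u\<in>\<F>. u z) = h z"
  proof (rule antisym)
    show "(SUP u\<in>\<F>. u z) \<le> h z"
      using lower[of 1] upper[OF _ z] by (intro cSUP_least) auto
    show "h z \<le> (SUP u\<in>\<F>. u z)"
    proof (rule field_le_epsilon)
      fix e :: real assume e: "0 < e"
      define d where "d = e / (?p z + 1)"
      have d: "0 < d" using e p0[OF z] by (simp add: d_def)
      have "bdd_above ((\<lambda>u. u z) ` \<F>)" using upper[OF _ z] by (intro bdd_aboveI2)
      then have "h z + - d * ?p z \<le> (SUP u\<in>\<F>. u z)"
        using cSUP_upper[OF lower[OF d], of "\<lambda>u. u z"] by simp
      moreover have "d * ?p z \<le> e"
      proof -
        have "d * ?p z = e * (?p z / (?p z + 1))" by (simp add: d_def)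
        also have "\<dots> \<le> e * 1" using e p0[OF z] by (intro mult_left_mono) auto
        finally show ?thesis by simp
      qed
      ultimately show "h z \<le> (SUP u\<in>\<F>. u z) + e" by simp
    qed
  qed
  then show ?thesis by (simp add: harmonic_measure_def \<F>_def)
qed

section \<open>Vertically accessible boundary points\<close>

text \<open>For \<open>Im z \<ge> 0\<close> the number \<open>-i (z - p)\<close> has nonnegative real part, so that its principal logarithm is
  a primitive up to the real line.\<close>
lemma contour_integral_inverse_upper:
  assumes g: "valid_path g" "path_image g \<subseteq> {z. 0 \<le> Im z} - {of_real p}"
    and s: "pathstart g = of_real s" "pathfinish g = of_real f"
  shows "((\<lambda>w. 1 / (w - of_real p)) has_contour_integral
      (Ln (- \<i> * (of_real f - of_real p)) - Ln (- \<i> * (of_real s - of_real p)))) g"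
proof -
  have "((\<lambda>w. Ln (- \<i> * (w - of_real p))) has_field_derivative 1 / (w - of_real p))
      (at w within {z. 0 \<le> Im z} - {of_real p})" if w: "w \<in> {z. 0 \<le> Im z} - {of_real p}" for w
  proof -
    have "- \<i> * (w - of_real p) \<notin> \<real>\<^sub>\<le>\<^sub>0"
      using w by (auto simp: complex_nonpos_Reals_iff complex_eq_iff)
    then show ?thesis using w by (auto intro!: derivative_eq_intros simp: field_simps)
  qed
  from contour_integral_primitive[OF this g] show ?thesis by (simp add: s)
qed

lemma contour_integral_inverse_lower:
  assumes g: "valid_path g" "path_image g \<subseteq> {z. Im z \<le> 0} - {of_real p}"
    and s: "pathstart g = of_real s" "pathfinish g = of_real f"
  shows "((\<lambda>w. 1 / (w - of_real p)) has_contour_integral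
      (Ln (\<i> * (of_real f - of_real p)) - Ln (\<i> * (of_real s - of_real p)))) g"
proof -
  have "((\<lambda>w. Ln (\<i> * (w - of_real p))) has_field_derivative 1 / (w - of_real p))
      (at w within {z. Im z \<le> 0} - {of_real p})" if w: "w \<in> {z. Im z \<le> 0} - {of_real p}" for w
  proof -
    have "\<i> * (w - of_real p) \<notin> \<real>\<^sub>\<le>\<^sub>0"
      using w by (auto simp: complex_nonpos_Reals_iff complex_eq_iff)
    then show ?thesis using w by (auto intro!: derivative_eq_intros simp: field_simps)
  qed
  from contour_integral_primitive[OF this g] show ?thesis by (simp add: s)
qed

lemma Ln_i_times_real:
  fixes r :: real
  shows "0 < r \<Longrightarrow> Ln (\<i> * of_real r) = of_real (ln \<bar>r\<bar>) + \<i> * of_real pi / 2"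
    and "r < 0 \<Longrightarrow> Ln (\<i> * of_real r) = of_real (ln \<bar>r\<bar>) - \<i> * of_real pi / 2"
    and "0 < r \<Longrightarrow> Ln (- \<i> * of_real r) = of_real (ln \<bar>r\<bar>) - \<i> * of_real pi / 2"
    and "r < 0 \<Longrightarrow> Ln (- \<i> * of_real r) = of_real (ln \<bar>r\<bar>) + \<i> * of_real pi / 2"
  using Ln_times_of_real[of r \<i>] Ln_times_of_real[of "- r" "- \<i>"]
    Ln_times_of_real[of r "- \<i>"] Ln_times_of_real[of "- r" \<i>]
    Ln_of_real[of r] Ln_of_real[of "- r"]
  by (simp_all add: mult.commute)

text \<open>From a real point between the ends each half of the loop is seen under the angle \<open>-\<pi>\<close>; from any
  other real point the two halves cancel.\<close>
lemma winding_number_upper_lower: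
  fixes s f p :: real
  assumes g: "valid_path g" "path_image g \<subseteq> {z. 0 \<le> Im z} - {of_real p}"
      "pathstart g = of_real s" "pathfinish g = of_real f"
    and h: "valid_path h" "path_image h \<subseteq> {z. Im z \<le> 0} - {of_real p}"
      "pathstart h = of_real f" "pathfinish h = of_real s"
    and sf: "s < f" "p \<noteq> s" "p \<noteq> f"
  shows "winding_number (g +++ h) (of_real p) = (if s < p \<and> p < f then -1 else 0)"
proof -
  have v: "valid_path (g +++ h)" using g h by (intro valid_path_join) auto
  have np: "of_real p \<notin> path_image (g +++ h)" using g h by (auto simp: path_image_join)
  have "winding_number (g +++ h) (of_real p)
      = 1 / (2 * of_real pi * \<i>) * contour_integral (g +++ h) (\<lambda>w. 1 / (w - of_real p))"
    using winding_number_valid_path[OF v np] by simp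
  also have "contour_integral (g +++ h) (\<lambda>w. 1 / (w - of_real p)) =
      (Ln (- \<i> * (of_real f - of_real p)) - Ln (- \<i> * (of_real s - of_real p)))
      + (Ln (\<i> * (of_real s - of_real p)) - Ln (\<i> * (of_real f - of_real p)))"
    by (intro contour_integral_unique has_contour_integral_join contour_integral_inverse_upper[OF g]
        contour_integral_inverse_lower[OF h] g(1) h(1))
  also have "\<dots> = (if s < p \<and> p < f then - 2 * of_real pi * \<i> else 0)"
    unfolding of_real_diff[symmetric]
  proof -
    consider "0 < s - p" "0 < f - p" | "s - p < 0" "0 < f - p" | "s - p < 0" "f - p < 0"
      using sf by linarith
    then show "Ln (- \<i> * complex_of_real (f - p)) - Ln (- \<i> * complex_of_real (s - p)) +
      (Ln (\<i> * complex_of_real (s - p)) - Ln (\<i> * complex_of_real (f - p))) =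
      (if s < p \<and> p < f then - 2 * complex_of_real pi * \<i> else 0)"
    proof cases
      case 1
      then show ?thesis
        by (simp only: Ln_i_times_real(1)[OF 1(1)] Ln_i_times_real(1)[OF 1(2)]
            Ln_i_times_real(3)[OF 1(1)] Ln_i_times_real(3)[OF 1(2)]) simp
    next
      case 2
      then show ?thesis
        by (simp only: Ln_i_times_real(2)[OF 2(1)] Ln_i_times_real(1)[OF 2(2)]
            Ln_i_times_real(4)[OF 2(1)] Ln_i_times_real(3)[OF 2(2)]) simp
    next
      case 3
      then show ?thesis
        by (simp only: Ln_i_times_real(2)[OF 3(1)] Ln_i_times_real(2)[OF 3(2)]
            Ln_i_times_real(4)[OF 3(1)] Ln_i_times_real(4)[OF 3(2)]) simp
    qed
  qed
  finally show ?thesis by simp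
qed

text \<open>Join the two vertical segments inside \<open>U\<close> and close the path in the lower half-plane.  The loop
  misses the part \<open>K\<close> of the boundary outside \<open>(-1, 1)\<close>, and winds once around \<open>y\<close> but not around \<open>1\<close>.
  As \<open>K\<close> is connected and contains \<open>1\<close>, it does not come near \<open>y\<close>.  A small half disc at \<open>y\<close> meets
  \<open>U\<close>, since \<open>y\<close> is a boundary point, and without points of \<open>K\<close> it must lie in \<open>U\<close>.\<close>
lemma half_disc_between_accessible:
  assumes U: "open U" "connected U" "U \<subseteq> {z. 0 < Im z}"
    and cl: "closed_interval \<subseteq> sphere_boundary U"
    and con: "connectedin riemann_sphere (sphere_boundary U - open_interval)"
    and x: "-1 < x" "x < y" "y < x'" "x' < 1"
    and acc: "0 < d" "\<And>t. 0 < t \<Longrightarrow> t \<le> d \<Longrightarrow> Complex x t \<in> U"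
    and acc': "0 < d'" "\<And>t. 0 < t \<Longrightarrow> t \<le> d' \<Longrightarrow> Complex x' t \<in> U"
  shows "\<exists>r>0. ball (of_real y) r \<inter> {z. 0 < Im z} \<subseteq> U"
proof (rule ccontr)
  assume neg: "\<not> ?thesis"
  have "Complex x d \<in> U" "Complex x' d' \<in> U" using acc acc' by auto
  then obtain g0 where g0: "polynomial_function g0" "path_image g0 \<subseteq> U"
      "pathstart g0 = Complex x d" "pathfinish g0 = Complex x' d'"
    using connected_open_polynomial_connected[OF U(1,2)] by blast
  define g where "g = linepath (of_real x) (Complex x d) +++ (g0 +++ linepath (Complex x' d') (of_real x'))"
  define h where "h = linepath (of_real x') (- \<i>) +++ linepath (- \<i>) (of_real x)"
  have seg: "closed_segment (of_real t) (Complex t e) \<subseteq> insert (of_real t) ((\<lambda>s. Complex t s) ` {0<..e})"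
    if "0 < e" for t e
  proof
    fix w assume "w \<in> closed_segment (of_real t) (Complex t e)"
    then obtain u where u: "0 \<le> u" "u \<le> 1" "w = (1 - u) *\<^sub>R of_real t + u *\<^sub>R Complex t e"
      by (auto simp: closed_segment_def)
    have "w = Complex t (u * e)" using u(3) by (simp add: complex_eq_iff algebra_simps)
    moreover have "u * e \<le> e" using u that by (simp add: mult_left_le_one_le)
    moreover have "u = 0 \<or> 0 < u * e" using u(1) that by (auto simp: zero_less_mult_iff)
    ultimately show "w \<in> insert (of_real t) ((\<lambda>s. Complex t s) ` {0<..e})"
      by (cases "u = 0") (auto simp: complex_of_real_def)
  qed
  have gim: "path_image g \<subseteq> U \<union> {of_real x, of_real x'}"
  proof -
    have "path_image g = closed_segment (of_real x) (Complex x d) \<union> path_image g0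
        \<union> closed_segment (of_real x') (Complex x' d')"
      unfolding g_def using g0 by (simp add: path_image_join closed_segment_commute Un_assoc)
    moreover have "closed_segment (of_real x) (Complex x d) \<subseteq> U \<union> {of_real x, of_real x'}"
      by (rule order_trans[OF seg[OF acc(1)]]) (use acc(2) in auto)
    moreover have "closed_segment (of_real x') (Complex x' d') \<subseteq> U \<union> {of_real x, of_real x'}"
      by (rule order_trans[OF seg[OF acc'(1)]]) (use acc'(2) in auto)
    ultimately show ?thesis using g0(2) by (simp only: Un_subset_iff le_supI1 simp_thms)
  qed
  have gv: "valid_path g"
    unfolding g_def using g0 by (intro valid_path_join valid_path_linepath valid_path_polynomial_function) auto
  have ge: "pathstart g = of_real x" "pathfinish g = of_real x'" by (auto simp: g_def)
  have hv: "valid_path h" unfolding h_def by (intro valid_path_join valid_path_linepath) auto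
  have he: "pathstart h = of_real x'" "pathfinish h = of_real x" by (auto simp: h_def)
  have him: "path_image h \<subseteq> {z. Im z < 0} \<union> {of_real x, of_real x'}"
  proof -
    have "closed_segment (of_real t) (- \<i>) \<subseteq> {z. Im z < 0} \<union> {of_real t}" for t
    proof
      fix w assume "w \<in> closed_segment (of_real t) (- \<i>)"
      then obtain u where u: "0 \<le> u" "u \<le> 1" "w = (1 - u) *\<^sub>R of_real t + u *\<^sub>R (- \<i>)"
        by (auto simp: closed_segment_def)
      then show "w \<in> {z. Im z < 0} \<union> {of_real t}" by (cases "u = 0") auto
    qed
    from this[of x] this[of x'] show ?thesis
      unfolding h_def by (auto simp: path_image_join closed_segment_commute)
  qed
  have wn: "winding_number (g +++ h) (of_real p) = (if x < p \<and> p < x' then -1 else 0)"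
    if "p \<noteq> x" "p \<noteq> x'" for p
  proof (rule winding_number_upper_lower[OF gv _ ge hv _ he])
    show "path_image g \<subseteq> {z. 0 \<le> Im z} - {of_real p}" using gim U(3) that by fastforce
    show "path_image h \<subseteq> {z. Im z \<le> 0} - {of_real p}" using him that by fastforce
  qed (use x that in auto)
  define L where "L = g +++ h"
  have Lv: "valid_path L" unfolding L_def using gv hv ge he by (intro valid_path_join) auto
  have Lp: "path L" "pathfinish L = pathstart L" using Lv valid_path_imp_path ge he by (auto simp: L_def)
  have Lim: "path_image L \<subseteq> U \<union> {z. Im z < 0} \<union> {of_real x, of_real x'}"
    unfolding L_def using path_image_join_subset[of g h] gim him by blast
  define A where "A = (\<lambda>k. {z. z \<notin> path_image L \<and> winding_number L z = k})"
  have Ao: "open (A k)" for k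
    unfolding A_def by (rule open_winding_number_levelsets[OF Lp])
  obtain B where B: "\<And>z. B \<le> norm z \<Longrightarrow> winding_number L z = 0"
    using winding_number_zero_at_infinity[OF Lp] by blast
  obtain B' where B': "path_image L \<subseteq> ball 0 B'"
    using bounded_subset_ballD[OF bounded_path_image[OF Lp(1)]] by blast
  (* E1 is the set where the winding number vanishes, completed at infinity; E2 is the set where it does not. *)
  define E1 where "E1 = Some ` A 0 \<union> insert None (Some ` (- cball 0 (max B B')))"
  define E2 where "E2 = Some ` (\<Union>k\<in>-{0}. A k)"
  have o1: "openin riemann_sphere E1"
    unfolding E1_def using Ao
    by (intro openin_Un openin_riemann_sphere_minus_compact) (auto simp: openin_riemann_sphere_Some)
  have o2: "openin riemann_sphere E2"
    unfolding E2_def using Ao by (auto simp: openin_riemann_sphere_Some)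
  have E1S: "Some z \<in> E1 \<longleftrightarrow> z \<in> A 0" for z
  proof
    assume "Some z \<in> E1"
    then consider "z \<in> A 0" | "B < norm z" "B' < norm z" by (auto simp: E1_def not_le)
    then show "z \<in> A 0"
    proof cases
      case 2
      then have "z \<notin> path_image L" using B' by (auto dest!: subsetD)
      then show ?thesis using B[of z] 2 by (auto simp: A_def)
    qed
  qed (auto simp: E1_def)
  define K where "K = sphere_boundary U - open_interval"
  have KL: "z \<notin> path_image L" if "Some z \<in> K" for z
  proof
    assume z: "z \<in> path_image L"
    have zf: "z \<in> frontier U" using that U(1) by (auto simp: K_def sphere_boundary_eq split: if_splits)
    then have "z \<notin> U" using U(1) by (simp add: frontier_def interior_open)
    moreover have "0 \<le> Im z"
    proof -
      have "closure U \<subseteq> {z. 0 \<le> Im z}"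
        using U(3) by (intro closure_minimal) (auto simp: closed_halfspace_Im_ge)
      then show ?thesis using zf by (auto simp: frontier_def)
    qed
    moreover have "z \<noteq> of_real x" "z \<noteq> of_real x'"
      using that x by (auto simp: K_def open_interval_def)
    ultimately show False using z Lim by auto
  qed
  have "K \<subseteq> E1 \<union> E2"
  proof
    fix \<zeta> assume \<zeta>: "\<zeta> \<in> K"
    show "\<zeta> \<in> E1 \<union> E2"
    proof (cases \<zeta>)
      case None then show ?thesis by (simp add: E1_def)
    next
      case (Some z)
      then show ?thesis using KL[of z] \<zeta> by (auto simp: E1S E2_def A_def)
    qed
  qed
  moreover have "E1 \<inter> E2 \<inter> K = {}"
    using E1S by (auto simp: E2_def A_def)
  moreover have "E1 \<inter> K \<noteq> {}"
  proof -
    have k1: "Some (of_real 1) \<in> K"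
      using cl by (force simp: K_def closed_interval_def open_interval_def)
    have "of_real 1 \<in> A 0" using KL[OF k1] wn[of 1] x by (auto simp: A_def L_def)
    then show ?thesis using k1 E1S[of "of_real 1"] by auto
  qed
  moreover have "E2 \<inter> K \<noteq> {}"
  proof -
    have ym: "of_real y \<notin> path_image L"
    proof
      assume "of_real y \<in> path_image L"
      then have "of_real y \<in> U \<union> {z. Im z < 0} \<union> {of_real x, of_real x'}" using Lim by (rule subsetD[rotated])
      moreover have "of_real y \<notin> U" using U(3) by auto
      ultimately show False using x by auto
    qed
    then have "of_real y \<in> A (-1)" using wn[of y] x by (auto simp: A_def L_def)
    then obtain r where r: "0 < r" "ball (of_real y) r \<subseteq> A (-1)"
      using Ao open_contains_ball by blast
    define S where "S = ball (complex_of_real y) r \<inter> {z. 0 < Im z}"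
    have "\<not> S \<subseteq> U" using neg r(1) by (auto simp: S_def)
    moreover have "S \<inter> U \<noteq> {}"
    proof -
      have "Some (of_real y) \<in> sphere_boundary U" using cl x by (auto simp: closed_interval_def subset_iff)
      then have "of_real y \<in> closure U" using U(1) by (auto simp: sphere_boundary_eq frontier_def split: if_splits)
      then obtain w where "w \<in> U" "dist w (of_real y) < r" using r(1) closure_approachable by blast
      then show ?thesis using U(3) by (auto simp: S_def dist_commute)
    qed
    moreover have "connected S"
      unfolding S_def by (intro convex_connected convex_Int convex_ball convex_halfspace_Im_gt)
    ultimately have "S \<inter> frontier U \<noteq> {}" using connected_Int_frontier[of S U] by blast
    then obtain k where k: "k \<in> S" "k \<in> frontier U" by blast
    have "Some k \<in> K" using k U(1) by (auto simp: K_def S_def sphere_boundary_eq open_interval_def)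
    moreover have "k \<in> A (-1)" using k(1) r(2) by (auto simp: S_def)
    then have "Some k \<in> E2" unfolding E2_def by (intro imageI UN_I[of "-1"]) auto
    ultimately show ?thesis by blast
  qed
  ultimately show False
    using con o1 o2 unfolding connectedin K_def by blast
qed

section \<open>The reflected domain is simply connected\<close>

lemma connected_of_connectedin_Some:
  assumes "connectedin riemann_sphere (Some ` L)"
  shows "connected L"
  unfolding connected_def
proof (intro notI, elim exE conjE)
  fix A B assume AB: "open A" "open B" "L \<subseteq> A \<union> B" "A \<inter> B \<inter> L = {}" "A \<inter> L \<noteq> {}" "B \<inter> L \<noteq> {}"
  have "openin riemann_sphere (Some ` A)" "openin riemann_sphere (Some ` B)"
    using AB by (auto simp: openin_riemann_sphere_Some)
  moreover have "Some ` L \<subseteq> Some ` A \<union> Some ` B" "Some ` A \<inter> Some ` B \<inter> Some ` L = {}"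
    "Some ` A \<inter> Some ` L \<noteq> {}" "Some ` B \<inter> Some ` L \<noteq> {}"
    using AB by auto
  ultimately show False using assms unfolding connectedin by blast
qed

text \<open>A bounded component would be compact, and a theorem of Sura-Bura would give it a compact relatively
  open neighbourhood in \<open>L\<close>, which splits the connected set on the sphere.\<close>
lemma unbounded_component_of_connectedin:
  assumes "closed L" "connectedin riemann_sphere (insert None (Some ` L))" "p \<in> L"
  shows "\<not> bounded (connected_component_set L p)"
proof
  assume bd: "bounded (connected_component_set L p)"
  define C where "C = connected_component_set L p"
  have "C \<in> components L" using assms(3) by (auto simp: C_def components_def)
  moreover have "compact C"
    unfolding C_def compact_eq_bounded_closed using bd closed_connected_component[OF assms(1)] by auto
  moreover have "locally compact L" using assms(1) by (rule closed_imp_locally_compact)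
  ultimately obtain K where K: "openin (top_of_set L) K" "compact K" "C \<subseteq> K"
    using Sura_Bura_clopen_subset[of L C UNIV] by auto
  obtain E where E: "open E" "K = L \<inter> E" using K(1) by (auto simp: openin_open)
  have "openin riemann_sphere (Some ` E)" using E by (simp add: openin_riemann_sphere_Some)
  moreover have "openin riemann_sphere (insert None (Some ` (- K)))"
    using K(2) by (rule openin_riemann_sphere_minus_compact)
  moreover have "insert None (Some ` L) \<subseteq> Some ` E \<union> insert None (Some ` (- K))" using E by auto
  moreover have "Some ` E \<inter> insert None (Some ` (- K)) \<inter> insert None (Some ` L) = {}" using E by auto
  moreover have "Some ` E \<inter> insert None (Some ` L) \<noteq> {}"
  proof -
    have "p \<in> C" using assms(3) by (simp add: C_def)
    then have "p \<in> E" using K(3) E by auto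
    then show ?thesis using assms(3) by auto
  qed
  moreover have "insert None (Some ` (- K)) \<inter> insert None (Some ` L) \<noteq> {}" by auto
  ultimately show False using assms(2) unfolding connectedin by blast
qed

definition reflected_domain :: "complex set \<Rightarrow> real \<Rightarrow> real \<Rightarrow> complex set"
  where "reflected_domain U a b = U \<union> cnj ` U \<union> of_real ` {a<..<b}"

lemma cnj_image_eq_vimage: "cnj ` S = cnj -` S"
proof (intro set_eqI)
  fix z
  show "z \<in> cnj ` S \<longleftrightarrow> z \<in> cnj -` S" by (auto intro!: image_eqI[of z cnj "cnj z"])
qed

lemma cnj_closure: "cnj p \<in> closure (cnj ` S) \<longleftrightarrow> p \<in> closure S"
proof -
  have "dist (cnj x) (cnj y) = dist x y" for x y
    by (metis complex_cnj_diff complex_mod_cnj dist_norm)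
  then show ?thesis by (auto simp: closure_approachable)
qed

text \<open>The frontier of the reflected domain consists of \<open>L\<close>, the frontier of \<open>U\<close> without \<open>(a, b)\<close>, and of
  the mirror image of \<open>L\<close>.  On the sphere \<open>L\<close> is connected (up to the point at infinity), because the
  segments \<open>[-1, a]\<close> and \<open>[b, 1]\<close> are attached to the connected part of the boundary at \<open>-1\<close> and \<open>1\<close>.
  So either every component of the frontier is unbounded, or the frontier is bounded and its two
  halves are joined at \<open>1\<close>.\<close>
lemma
  assumes U: "open U" "connected U" "U \<subseteq> {z. 0 < Im z}"
    and cl: "closed_interval \<subseteq> sphere_boundary U"
    and con: "connectedin riemann_sphere (sphere_boundary U - open_interval)"
    and ab: "-1 \<le> a" "a < b" "b \<le> 1"
    and half: "\<And>y. a < y \<Longrightarrow> y < b \<Longrightarrow> \<exists>r>0. ball (of_real y) r \<inter> {z. 0 < Im z} \<subseteq> U"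
  shows open_reflected_domain: "open (reflected_domain U a b)"
    and simply_connected_reflected_domain: "simply_connected (reflected_domain U a b)"
proof -
  define V where "V = reflected_domain U a b"
  define I where "I = complex_of_real ` {a<..<b}"
  have V: "V = U \<union> cnj ` U \<union> I" by (simp add: V_def I_def reflected_domain_def)
  have cV: "cnj z \<in> V \<longleftrightarrow> z \<in> V" for z
  proof -
    have "cnj z \<in> V" if "z \<in> V" for z using that by (auto simp: V I_def)
    from this[of z] this[of "cnj z"] show ?thesis by auto
  qed
  show oV: "open (reflected_domain U a b)"
    unfolding V_def[symmetric] open_contains_ball
  proof
    fix z assume z: "z \<in> V"
    show "\<exists>e>0. ball z e \<subseteq> V"
    proof (cases "z \<in> I")
      case True
      then obtain y where y: "z = of_real y" "a < y" "y < b" by (auto simp: I_def)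
      obtain r where r: "0 < r" "ball z r \<inter> {z. 0 < Im z} \<subseteq> U" using half[OF y(2,3)] y(1) by auto
      define e where "e = min r (min (y - a) (b - y))"
      have "ball z e \<subseteq> V"
      proof
        fix w assume w: "w \<in> ball z e"
        consider "0 < Im w" | "Im w < 0" | "Im w = 0" by linarith
        then show "w \<in> V"
        proof cases
          case 1
          then have "w \<in> U" using w r(2) by (auto simp: e_def)
          then show ?thesis by (simp add: V)
        next
          case 2
          have "dist z (cnj w) = dist z w"
            using y(1) by (metis complex_cnj_complex_of_real complex_cnj_diff complex_mod_cnj dist_norm)
          then have "cnj w \<in> U" using w r(2) 2 by (auto simp: e_def)
          then have "cnj w \<in> V" by (simp add: V)
          then show ?thesis by (simp add: cV)
        next
          case 3
          then have we: "w = of_real (Re w)" by (simp add: complex_eq_iff)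
          have "\<bar>y - Re w\<bar> < e" using w y(1) abs_Re_le_cmod[of "z - w"] by (simp add: dist_norm)
          then have "w \<in> I" unfolding I_def by (subst we) (auto simp: e_def abs_less_iff intro!: imageI)
          then show ?thesis by (simp add: V)
        qed
      qed
      moreover have "0 < e" using r y by (simp add: e_def)
      ultimately show ?thesis by blast
    next
      case False
      have "open (cnj ` U)"
      proof -
        show ?thesis
          unfolding cnj_image_eq_vimage using U(1) by (auto intro!: open_vimage continuous_intros)
      qed
      then have "open (U \<union> cnj ` U)" using U(1) by auto
      moreover have "z \<in> U \<union> cnj ` U" using z False by (auto simp: V)
      ultimately obtain e where "0 < e" "ball z e \<subseteq> U \<union> cnj ` U" using open_contains_ball by blast
      then show ?thesis by (auto simp: V)
    qed
  qed
  then have oV': "open V" by (simp add: V_def)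
  have real_bd: "of_real x \<in> frontier U" if "x \<in> {-1..1}" for x
    using cl that U(1) by (auto simp: sphere_boundary_eq closed_interval_def image_subset_iff split: if_splits)
  have Icl: "I \<subseteq> closure U" using real_bd ab by (auto simp: I_def frontier_def)
  have clU: "closure U \<subseteq> {z. 0 \<le> Im z}"
    using U(3) by (intro closure_minimal) (auto simp: closed_halfspace_Im_ge)
  have dis: "z \<notin> cnj ` U" if z: "z \<in> closure U" for z
  proof
    assume "z \<in> cnj ` U"
    then obtain w where "w \<in> U" "z = cnj w" by blast
    then have "Im z < 0" using U(3) by auto
    then show False using z clU by auto
  qed
  define L where "L = frontier U - I"
  have LV: "L = frontier U - V"
    using dis interior_open[OF U(1)] by (auto simp only: L_def V frontier_def)
  then have Lc: "closed L" using oV' by (auto simp: closed_Diff)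
  have Lf: "L \<subseteq> frontier V"
  proof
    fix p assume p: "p \<in> L"
    then have "p \<in> closure U" "p \<notin> V" using LV by (auto simp: L_def frontier_def)
    moreover have "closure U \<subseteq> closure V" by (intro closure_mono) (auto simp: V)
    ultimately show "p \<in> frontier V" using oV' by (auto simp: frontier_def interior_open)
  qed
  have VV: "cnj ` V = V"
  proof -
    have "z \<in> cnj ` V" if "z \<in> V" for z
      using that cV[of z] by (intro image_eqI[of _ _ "cnj z"]) auto
    then show ?thesis using cV by auto
  qed
  have fs: "cnj p \<in> frontier V" if "p \<in> frontier V" for p
    using that cV[of p] cnj_closure[of p V] VV oV' by (auto simp: frontier_def interior_open)
  have fV: "p \<in> L \<or> cnj p \<in> L" if p: "p \<in> frontier V" for p
  proof -
    have pV: "p \<in> closure V" "p \<notin> V" using p oV' by (auto simp: frontier_def interior_open)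
    have "closure I \<subseteq> closure U" using Icl by (intro closure_minimal) auto
    then consider "p \<in> closure U" | "p \<in> closure (cnj ` U)"
      using pV(1) by (auto simp: V closure_Un)
    then show ?thesis
    proof cases
      case 1
      then have "p \<in> L" using pV(2) U(1) by (auto simp: L_def V frontier_def interior_open)
      then show ?thesis ..
    next
      case 2
      then have "cnj p \<in> closure U" using cnj_closure[of "cnj p" U] by simp
      moreover have "cnj p \<notin> V" using pV(2) cV by simp
      ultimately have "cnj p \<in> L" using U(1) by (auto simp: L_def V frontier_def interior_open)
      then show ?thesis ..
    qed
  qed
  have conL: "connectedin riemann_sphere (sphere_boundary U - Some ` I)"
  proof -
    define K where "K = sphere_boundary U - open_interval"
    have seg: "connectedin riemann_sphere (Some ` of_real ` {s..t})" for s t :: real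
    proof -
      have "connected (complex_of_real ` {s..t})"
        by (intro connected_continuous_image continuous_intros) auto
      then have "connectedin euclidean (complex_of_real ` {s..t})"
        by (simp only: connectedin_iff_connected)
      then show ?thesis
        unfolding riemann_sphere_def by (rule connectedin_continuous_map_image[OF continuous_map_Some])
    qed
    have K1: "Some (complex_of_real x) \<in> K" if "x = -1 \<or> x = 1" for x
    proof -
      have "Some (complex_of_real x) \<in> closed_interval"
        unfolding closed_interval_def by (intro imageI) (use that in auto)
      moreover have "Some (complex_of_real x) \<notin> open_interval"
      proof
        assume "Some (complex_of_real x) \<in> open_interval"
        then obtain t where "complex_of_real x = of_real t" "t \<in> {-1<..<1}"
          unfolding open_interval_def by auto
        then have "x = t" by (simp only: of_real_eq_iff)
        then show False using that \<open>t \<in> _\<close> by auto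
      qed
      ultimately show ?thesis using cl by (auto simp: K_def)
    qed
    have 1: "connectedin riemann_sphere (K \<union> Some ` of_real ` {-1..a})"
    proof (rule connectedin_Un[OF con[folded K_def] seg])
      have "Some (of_real (-1)) \<in> K \<inter> Some ` of_real ` {-1..a}"
        using ab by (intro IntI imageI K1) auto
      then show "K \<inter> Some ` of_real ` {-1..a} \<noteq> {}" by (metis empty_iff)
    qed
    have 2: "connectedin riemann_sphere (K \<union> Some ` of_real ` {-1..a} \<union> Some ` of_real ` {b..1})"
    proof (rule connectedin_Un[OF 1 seg])
      have "Some (of_real 1) \<in> (K \<union> Some ` of_real ` {-1..a}) \<inter> Some ` of_real ` {b..1}"
        using ab by (intro IntI UnI1 imageI K1) auto
      then show "(K \<union> Some ` of_real ` {-1..a}) \<inter> Some ` of_real ` {b..1} \<noteq> {}" by (metis empty_iff)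
    qed
    have "Some ` complex_of_real ` {-1..a} \<union> Some ` of_real ` {b..1} \<subseteq> sphere_boundary U - Some ` I"
    proof
      fix \<zeta> assume "\<zeta> \<in> Some ` complex_of_real ` {-1..a} \<union> Some ` of_real ` {b..1}"
      then obtain x where x: "\<zeta> = Some (of_real x)" "x \<in> {-1..1}" "x \<le> a \<or> b \<le> x" using ab by auto
      then have "\<zeta> \<in> closed_interval" by (auto simp: closed_interval_def)
      then show "\<zeta> \<in> sphere_boundary U - Some ` I" using cl x by (auto simp: I_def)
    qed
    moreover have "K \<subseteq> sphere_boundary U - Some ` I" using ab by (auto simp: K_def I_def open_interval_def)
    moreover have "sphere_boundary U - Some ` I \<subseteq> K \<union> Some ` of_real ` {-1..a} \<union> Some ` of_real ` {b..1}"
    proof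
      fix \<zeta> assume z: "\<zeta> \<in> sphere_boundary U - Some ` I"
      show "\<zeta> \<in> K \<union> Some ` of_real ` {-1..a} \<union> Some ` of_real ` {b..1}"
      proof (cases "\<zeta> \<in> open_interval")
        case True
        then obtain x where "\<zeta> = Some (of_real x)" "x \<in> {-1<..<1}" by (auto simp: open_interval_def)
        moreover from this have "\<not> (a < x \<and> x < b)" using z by (auto simp: I_def)
        ultimately show ?thesis by auto
      qed (use z in \<open>simp add: K_def\<close>)
    qed
    ultimately have "sphere_boundary U - Some ` I = K \<union> Some ` of_real ` {-1..a} \<union> Some ` of_real ` {b..1}"
      by (intro equalityI Un_least) (auto simp only: Un_subset_iff)
    then show ?thesis using 2 by simp
  qed
  have one: "1 \<in> L" using real_bd[of 1] ab by (auto simp: L_def I_def)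
  have conV: "connected V"
  proof -
    have "connected (U \<union> I)"
      by (rule connected_intermediate_closure[OF U(2)]) (use Icl closure_subset in auto)
    moreover from this have "connected (cnj ` (U \<union> I))"
      by (intro connected_continuous_image continuous_intros)
    moreover have "of_real ((a + b) / 2) \<in> (U \<union> I) \<inter> cnj ` (U \<union> I)"
    proof -
      have "of_real ((a + b) / 2) \<in> I" using ab unfolding I_def by (intro imageI) auto
      then show ?thesis by (auto intro!: image_eqI[of _ cnj "of_real ((a + b) / 2)"])
    qed
    then have "(U \<union> I) \<inter> cnj ` (U \<union> I) \<noteq> {}" by (metis empty_iff)
    ultimately have "connected ((U \<union> I) \<union> cnj ` (U \<union> I))" by (rule connected_Un)
    moreover have "cnj ` I = I" by (force simp: I_def)
    ultimately show ?thesis by (simp add: V image_Un Un_ac)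
  qed
  have comp: "\<not> bounded C" if nb: "\<not> bounded V" and C: "C \<in> components (frontier V)" for C
  proof
    assume bC: "bounded C"
    have nU: "\<not> bounded U"
    proof
      assume "bounded U"
      then have "bounded (cnj ` U)" by (auto simp: bounded_iff)
      moreover have "bounded I" unfolding I_def by (rule bounded_subset[of "cball 0 1"]) (use ab in auto)
      ultimately show False using nb \<open>bounded U\<close> by (simp add: V)
    qed
    then have "sphere_boundary U - Some ` I = insert None (Some ` L)"
      using U(1) by (auto simp: sphere_boundary_eq L_def)
    with conL have unb: "\<not> bounded (connected_component_set L p)" if "p \<in> L" for p
      using unbounded_component_of_connectedin[OF Lc] that by simp
    obtain p where p: "p \<in> frontier V" "C = connected_component_set (frontier V) p"
      using C by (auto simp: components_def)
    from fV[OF p(1)] show False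
    proof
      assume "p \<in> L"
      moreover have "connected_component_set L p \<subseteq> C" unfolding p(2) by (rule connected_component_mono[OF Lf])
      ultimately show False using unb bC bounded_subset by blast
    next
      assume q: "cnj p \<in> L"
      define T where "T = cnj ` connected_component_set L (cnj p)"
      have "connected T" unfolding T_def by (intro connected_continuous_image continuous_intros) auto
      moreover have "p \<in> T" unfolding T_def using q by (intro image_eqI[of _ _ "cnj p"]) auto
      moreover have "T \<subseteq> frontier V"
        unfolding T_def using fs Lf connected_component_subset[of L "cnj p"] by blast
      ultimately have "T \<subseteq> C" unfolding p(2) by (intro connected_component_maximal)
      then have "bounded T" using bC bounded_subset by blast
      then have "bounded (cnj ` T)" by (auto simp: bounded_iff)
      moreover have "cnj ` T = connected_component_set L (cnj p)" by (auto simp: T_def image_image)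
      ultimately show False using unb[OF q] by simp
    qed
  qed
  have conf: "connected (frontier V)" if b: "bounded V"
  proof -
    have "bounded U" using b by (rule bounded_subset) (auto simp: V)
    then have "sphere_boundary U - Some ` I = Some ` L"
      using U(1) by (auto simp: sphere_boundary_eq L_def)
    with conL have "connected L" using connected_of_connectedin_Some by simp
    moreover from this have "connected (cnj ` L)" by (intro connected_continuous_image continuous_intros)
    moreover have "L \<inter> cnj ` L \<noteq> {}" using one by (auto intro!: image_eqI[of _ cnj 1])
    ultimately have "connected (L \<union> cnj ` L)" by (rule connected_Un)
    moreover have "frontier V = L \<union> cnj ` L"
    proof
      show "frontier V \<subseteq> L \<union> cnj ` L" using fV by (auto simp: cnj_image_eq_vimage)
      show "L \<union> cnj ` L \<subseteq> frontier V" using Lf fs by auto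
    qed
    ultimately show ?thesis by simp
  qed
  have "simply_connected V"
    unfolding simply_connected_eq_frontier_properties[OF oV'] using conV comp conf by simp
  then show "simply_connected (reflected_domain U a b)" by (simp add: V_def)
qed

section \<open>Symmetric conformal maps of the strip\<close>

definition strip :: "complex set"
  where "strip = {s. \<bar>Im s\<bar> < pi / 2}"

definition disc_of_strip :: "complex \<Rightarrow> complex"
  where "disc_of_strip s = (exp s - 1) / (exp s + 1)"

text \<open>With \<open>disc_of_strip\<close> as inverse, the conformal map of the unit disc onto the strip that fixes \<open>0\<close>
  and preserves the real axis.\<close>
definition strip_of_disc :: "complex \<Rightarrow> complex"
  where "strip_of_disc z = Ln ((1 + z) / (1 - z))"

lemma open_strip: "open strip"
proof -
  have eq: "strip = {s. Im s < pi / 2} \<inter> {s. - (pi / 2) < Im s}" by (auto simp: strip_def)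
  then show ?thesis unfolding eq by (intro open_Int open_halfspace_Im_lt open_halfspace_Im_gt)
qed

lemma convex_strip: "convex strip"
proof -
  have eq: "strip = {s. Im s < pi / 2} \<inter> {s. - (pi / 2) < Im s}" by (auto simp: strip_def)
  then show ?thesis unfolding eq by (intro convex_Int convex_halfspace_Im_lt convex_halfspace_Im_gt)
qed

lemma Re_exp_strip: "s \<in> strip \<Longrightarrow> 0 < Re (exp s)"
  by (auto simp: strip_def Re_exp intro!: mult_pos_pos cos_gt_zero_pi)

lemma norm_cayley_less:
  assumes "0 < Re w"
  shows "norm ((w - 1) / (w + 1)) < 1"
proof -
  have "w + 1 \<noteq> 0" using assms by (auto simp: complex_eq_iff)
  moreover have "norm (w - 1) < norm (w + 1)"
  proof -
    have "(Re w - 1)\<^sup>2 + (Im w)\<^sup>2 < (Re w + 1)\<^sup>2 + (Im w)\<^sup>2" using assms by (simp add: power2_eq_square algebra_simps)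
    then show ?thesis by (simp add: cmod_def)
  qed
  ultimately show ?thesis by (simp add: norm_divide)
qed

lemma Re_inverse_cayley_pos:
  assumes "norm z < 1"
  shows "0 < Re ((1 + z) / (1 - z))"
proof -
  have z: "z \<noteq> 1" using assms by auto
  have "(norm z)\<^sup>2 < 1" using assms by (simp add: power_less_one_iff)
  then have "(Re z)\<^sup>2 + (Im z)\<^sup>2 < 1" by (simp only: cmod_power2)
  then have "0 < (1 + Re z) * (1 - Re z) - Im z * Im z" by (simp add: power2_eq_square algebra_simps)
  moreover have "0 < (1 - Re z)\<^sup>2 + (Im z)\<^sup>2" using z by (auto simp: sum_power2_gt_zero_iff complex_eq_iff)
  ultimately show ?thesis by (simp add: Re_divide divide_pos_pos)
qed

lemma disc_of_strip_in_ball: "s \<in> strip \<Longrightarrow> disc_of_strip s \<in> ball 0 1"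
  using norm_cayley_less[OF Re_exp_strip] by (simp add: disc_of_strip_def)

lemma strip_of_disc_in_strip:
  assumes "z \<in> ball 0 1"
  shows "strip_of_disc z \<in> strip"
proof -
  have "0 < Re ((1 + z) / (1 - z))" using assms by (intro Re_inverse_cayley_pos) auto
  from Re_Ln_pos_lt_imp[OF this] show ?thesis
    unfolding strip_of_disc_def strip_def by (simp only: mem_Collect_eq)
qed

lemma strip_of_disc_of_strip:
  assumes "s \<in> strip"
  shows "strip_of_disc (disc_of_strip s) = s"
proof -
  have "exp s + 1 \<noteq> 0" using Re_exp_strip[OF assms] by (auto simp: complex_eq_iff)
  then have "1 + disc_of_strip s = 2 * exp s / (exp s + 1)" "1 - disc_of_strip s = 2 / (exp s + 1)"
    by (simp_all add: disc_of_strip_def field_simps)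
  then have "(1 + disc_of_strip s) / (1 - disc_of_strip s) = exp s"
    using \<open>exp s + 1 \<noteq> 0\<close> by simp
  then show ?thesis using assms pi_gt_zero by (simp add: strip_of_disc_def strip_def Ln_exp abs_less_iff)
qed

lemma disc_of_strip_of_disc:
  assumes "z \<in> ball 0 1"
  shows "disc_of_strip (strip_of_disc z) = z"
proof -
  have "0 < Re ((1 + z) / (1 - z))" using assms by (intro Re_inverse_cayley_pos) auto
  then have "(1 + z) / (1 - z) \<noteq> 0" by (metis less_irrefl zero_complex.sel(1))
  then have e: "exp (strip_of_disc z) = (1 + z) / (1 - z)" by (simp add: strip_of_disc_def)
  have z: "z \<noteq> 1" using assms by auto
  show ?thesis unfolding disc_of_strip_def e using z by (simp add: field_simps)
qed

lemma holomorphic_disc_of_strip: "disc_of_strip holomorphic_on strip"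
proof -
  have "exp s + 1 \<noteq> 0" if "s \<in> strip" for s
    using Re_exp_strip[OF that] by (auto simp: complex_eq_iff)
  then show ?thesis unfolding disc_of_strip_def by (intro holomorphic_intros) auto
qed

lemma holomorphic_strip_of_disc: "strip_of_disc holomorphic_on ball 0 1"
proof -
  have "(1 + z) / (1 - z) \<notin> \<real>\<^sub>\<le>\<^sub>0" if "z \<in> ball 0 1" for z :: complex
    using Re_inverse_cayley_pos[of z] that by (auto simp: complex_nonpos_Reals_iff)
  then show ?thesis unfolding strip_of_disc_def by (intro holomorphic_intros) auto
qed

lemma strip_of_disc_derivative_0: "(strip_of_disc has_field_derivative 2) (at 0)"
  unfolding strip_of_disc_def by (auto intro!: derivative_eq_intros)

lemma disc_of_strip_derivative_0: "(disc_of_strip has_field_derivative 1/2) (at 0)"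
  unfolding disc_of_strip_def by (auto intro!: derivative_eq_intros)

lemma strip_of_disc_0 [simp]: "strip_of_disc 0 = 0" "disc_of_strip 0 = 0"
  by (simp_all add: strip_of_disc_def disc_of_strip_def)

lemma disc_of_strip_cnj: "disc_of_strip (cnj s) = cnj (disc_of_strip s)"
  by (simp add: disc_of_strip_def exp_cnj)

text \<open>Normalise a Riemann map at a real point to have a positive derivative.  Conjugation on both sides
  produces a second map with the same normalisation, which agrees with the first by the Schwarz
  lemma.\<close>
lemma symmetric_disc_map:
  assumes V: "open V" "simply_connected V" "V \<noteq> UNIV" "of_real c \<in> V"
    and sym: "\<And>z. z \<in> V \<Longrightarrow> cnj z \<in> V"
  obtains F G where "F holomorphic_on V" "G holomorphic_on ball 0 1"
    "\<And>z. z \<in> V \<Longrightarrow> F z \<in> ball 0 1 \<and> G (F z) = z"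
    "\<And>z. z \<in> ball 0 1 \<Longrightarrow> G z \<in> V \<and> F (G z) = z"
    "\<And>z. z \<in> ball 0 1 \<Longrightarrow> G (cnj z) = cnj (G z)"
    "\<exists>k>0. (G has_field_derivative of_real k) (at 0)"
proof -
  let ?D = "ball (0 :: complex) 1"
  from iffD1[OF Riemann_mapping_theorem conjI[OF V(1,2)]] V(3,4)
  have "\<exists>f g. f holomorphic_on V \<and> g holomorphic_on ?D \<and>
      (\<forall>z\<in>V. f z \<in> ?D \<and> g (f z) = z) \<and> (\<forall>z\<in>?D. g z \<in> V \<and> f (g z) = z)"
    by (elim disjE) simp_all
  then obtain f0 g0 where f0: "f0 holomorphic_on V" "g0 holomorphic_on ?D"
    and f0': "\<forall>z\<in>V. f0 z \<in> ?D \<and> g0 (f0 z) = z" "\<forall>z\<in>?D. g0 z \<in> V \<and> f0 (g0 z) = z"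
    by (elim exE conjE)
  note f0 = f0 f0'[rule_format]
  obtain m n where m: "m (f0 (of_real c)) = 0" "m holomorphic_on ?D" "m ` ?D \<subseteq> ?D"
    "n holomorphic_on ?D" "n ` ?D \<subseteq> ?D"
    "\<And>z. z \<in> ?D \<Longrightarrow> m (n z) = z" "\<And>z. z \<in> ?D \<Longrightarrow> n (m z) = z"
    using ball_biholomorphism_exists[of "f0 (of_real c)"] f0(3)[OF V(4)] by metis
  have mD: "m w \<in> ?D" if "w \<in> ?D" for w by (rule subsetD[OF m(3) imageI[OF that]])
  have nD: "n w \<in> ?D" if "w \<in> ?D" for w by (rule subsetD[OF m(5) imageI[OF that]])
  define \<kappa> where "\<kappa> = deriv (g0 \<circ> n) 0"
  have hol1: "(g0 \<circ> n) holomorphic_on ?D"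
    by (rule holomorphic_on_compose_gen[OF m(4) f0(2) m(5)])
  have inj1: "inj_on (g0 \<circ> n) ?D"
  proof (rule inj_on_inverseI[where g = "m \<circ> f0"])
    show "(m \<circ> f0) ((g0 \<circ> n) z) = z" if "z \<in> ?D" for z
      using that m(5,6) f0(4)[of "n z"] by (auto simp: image_subset_iff)
  qed
  have \<kappa>: "\<kappa> \<noteq> 0" unfolding \<kappa>_def
    by (rule holomorphic_injective_imp_regular[OF hol1 open_ball inj1]) auto
  (* A rotation of the disc makes the derivative positive. *)
  define u where "u = cnj \<kappa> / of_real (norm \<kappa>)"
  have u: "norm u = 1" "\<kappa> * u = of_real (norm \<kappa>)"
  proof -
    show "norm u = 1" using \<kappa> by (simp add: u_def norm_divide)
    have "\<kappa> * cnj \<kappa> = of_real (norm \<kappa>) * of_real (norm \<kappa>)"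
      by (simp add: complex_norm_square[symmetric] power2_eq_square)
    then show "\<kappa> * u = of_real (norm \<kappa>)" using \<kappa> by (simp add: u_def)
  qed
  then have u0: "u \<noteq> 0" by auto
  define G where "G = (\<lambda>z. g0 (n (u * z)))"
  define F where "F = (\<lambda>z. m (f0 z) / u)"
  have rot: "u * z \<in> ?D" "z / u \<in> ?D" if "z \<in> ?D" for z
    using that u by (auto simp: norm_mult norm_divide)
  have F: "F z \<in> ?D \<and> G (F z) = z" if "z \<in> V" for z
  proof -
    have "m (f0 z) \<in> ?D" by (rule mD) (use f0(3)[OF that] in simp)
    then show ?thesis using rot(2) u0 m(7)[of "f0 z"] f0(3)[OF that] by (auto simp: F_def G_def)
  qed
  have G: "G z \<in> V \<and> F (G z) = z" if "z \<in> ?D" for z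
  proof -
    have "n (u * z) \<in> ?D" by (rule nD[OF rot(1)[OF that]])
    then show ?thesis using f0(4)[of "n (u * z)"] m(6)[OF rot(1)[OF that]] u0 by (auto simp: F_def G_def)
  qed
  have rot_hol: "(\<lambda>z. u * z) holomorphic_on ?D" by (intro holomorphic_intros)
  have rot_im: "(\<lambda>z. u * z) ` ?D \<subseteq> ?D" using rot(1) by (rule image_subsetI)
  from holomorphic_on_compose_gen[OF rot_hol hol1 rot_im]
  have holG: "G holomorphic_on ?D" by (simp add: o_def G_def)
  have "(m \<circ> f0) holomorphic_on V" using f0 m by (intro holomorphic_on_compose_gen[where t = ?D]) auto
  then have holF: "F holomorphic_on V" unfolding F_def using u0 by (intro holomorphic_intros) (auto simp: o_def)
  have dG: "(G has_field_derivative of_real (norm \<kappa>)) (at 0)"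
  proof -
    have "((g0 \<circ> n) has_field_derivative \<kappa>) (at (u * 0))"
      unfolding \<kappa>_def using holomorphic_derivI[OF hol1, of 0] by simp
    moreover have "((\<lambda>z. u * z) has_field_derivative u) (at 0)" by (auto intro!: derivative_eq_intros)
    ultimately show ?thesis
      using DERIV_chain'[of "\<lambda>z. u * z" u 0 UNIV "g0 \<circ> n" \<kappa>] u(2) by (simp add: G_def o_def mult.commute)
  qed
  define G' where "G' = cnj \<circ> G \<circ> cnj"
  define F' where "F' = cnj \<circ> F \<circ> cnj"
  have cD: "cnj ` ?D = ?D"
  proof (intro set_eqI)
    fix z
    show "z \<in> cnj ` ?D \<longleftrightarrow> z \<in> ?D" by (auto intro!: image_eqI[of z cnj "cnj z"])
  qed
  have holG': "G' holomorphic_on ?D"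
    unfolding G'_def by (rule holomorphic_on_compose_cnj_cnj) (use holG cD in auto)
  have G'V: "G' z \<in> V" if "z \<in> ?D" for z
    using G[of "cnj z"] that sym by (simp add: G'_def)
  have dG': "(G' has_field_derivative of_real (norm \<kappa>)) (at 0)"
    unfolding G'_def using has_field_derivative_cnj_cnj[of G "of_real (norm \<kappa>)" 0] dG by simp
  define \<Phi> where "\<Phi> = F \<circ> G'"
  have hol\<Phi>: "\<Phi> holomorphic_on ?D"
    unfolding \<Phi>_def using holG' holF G'V by (intro holomorphic_on_compose_gen[where t = V]) auto
  have Fc: "F (of_real c) = 0" by (simp add: F_def m(1))
  have G0: "G 0 = of_real c" using F[OF V(4)] Fc by simp
  have \<Phi>0: "\<Phi> 0 = 0" by (simp add: \<Phi>_def G'_def G0 Fc)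
  have \<Phi>D: "norm (\<Phi> z) < 1" if "norm z < 1" for z
    using F[OF G'V[of z]] that by (simp add: \<Phi>_def)
  have GP: "G (\<Phi> z) = G' z" if "norm z < 1" for z
    using F[OF G'V[of z]] that by (simp add: \<Phi>_def)
  have dP: "deriv \<Phi> 0 = 1"
  proof -
    have "(\<Phi> has_field_derivative deriv \<Phi> 0) (at 0)" using holomorphic_derivI[OF hol\<Phi>, of 0] by simp
    from DERIV_chain'[OF this, of G "of_real (norm \<kappa>)"] dG \<Phi>0
    have "((\<lambda>z. G (\<Phi> z)) has_field_derivative of_real (norm \<kappa>) * deriv \<Phi> 0) (at 0)" by (simp add: mult.commute)
    then have "(G' has_field_derivative of_real (norm \<kappa>) * deriv \<Phi> 0) (at 0)"
      by (rule has_field_derivative_transform_within_open[where S = ?D]) (use GP in auto)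
    from DERIV_unique[OF this dG'] show ?thesis using \<kappa> by simp
  qed
  obtain \<alpha> where \<alpha>: "\<And>z. norm z < 1 \<Longrightarrow> \<Phi> z = \<alpha> * z"
    using Schwarz_Lemma(3)[OF hol\<Phi> \<Phi>0 \<Phi>D, of 0] dP by auto
  have "\<alpha> = 1"
  proof -
    have "((\<lambda>z. \<alpha> * z) has_field_derivative \<alpha>) (at 0)" by (auto intro!: derivative_eq_intros)
    then have "(\<Phi> has_field_derivative \<alpha>) (at 0)"
      by (rule has_field_derivative_transform_within_open[where S = ?D]) (use \<alpha> in auto)
    then show ?thesis using dP DERIV_imp_deriv by metis
  qed
  have symG: "G (cnj z) = cnj (G z)" if "z \<in> ?D" for z
  proof -
    have "G' z = G z" using GP[of z] \<alpha>[of z] \<open>\<alpha> = 1\<close> that by simp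
    then have "cnj (G (cnj z)) = G z" by (simp add: G'_def)
    then show ?thesis by (metis complex_cnj_cnj)
  qed
  show thesis
    by (rule that[OF holF holG F G symG]) (use dG \<kappa> in \<open>auto intro: exI[of _ "norm \<kappa>"]\<close>)
qed

lemma symmetric_strip_map:
  assumes V: "open V" "simply_connected V" "V \<noteq> UNIV" "of_real c \<in> V"
    and sym: "\<And>z. z \<in> V \<Longrightarrow> cnj z \<in> V"
  obtains g S where "S holomorphic_on V" "g holomorphic_on strip"
    "\<And>z. z \<in> V \<Longrightarrow> S z \<in> strip \<and> g (S z) = z"
    "\<And>s. s \<in> strip \<Longrightarrow> g s \<in> V \<and> S (g s) = s"
    "\<And>s. s \<in> strip \<Longrightarrow> g (cnj s) = cnj (g s)"
    "\<exists>k>0. (g has_field_derivative of_real k) (at 0)"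
proof -
  obtain F G where FG: "F holomorphic_on V" "G holomorphic_on ball 0 1"
    "\<And>z. z \<in> V \<Longrightarrow> F z \<in> ball 0 1 \<and> G (F z) = z"
    "\<And>z. z \<in> ball 0 1 \<Longrightarrow> G z \<in> V \<and> F (G z) = z"
    "\<And>z. z \<in> ball 0 1 \<Longrightarrow> G (cnj z) = cnj (G z)"
    "\<exists>k>0. (G has_field_derivative of_real k) (at 0)"
    using symmetric_disc_map[OF assms] by metis
  define g where "g = G \<circ> disc_of_strip"
  define S where "S = strip_of_disc \<circ> F"
  show thesis
  proof (rule that[of S g])
    show "S holomorphic_on V" unfolding S_def
      using FG(1,3) holomorphic_strip_of_disc by (intro holomorphic_on_compose_gen[where t = "ball 0 1"]) auto
    show "g holomorphic_on strip" unfolding g_def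
      using FG(2) holomorphic_disc_of_strip disc_of_strip_in_ball
      by (intro holomorphic_on_compose_gen[where t = "ball 0 1"]) auto
    show "S z \<in> strip \<and> g (S z) = z" if "z \<in> V" for z
      using FG(3)[OF that] strip_of_disc_in_strip disc_of_strip_of_disc by (simp add: S_def g_def)
    show "g s \<in> V \<and> S (g s) = s" if "s \<in> strip" for s
      using FG(4)[OF disc_of_strip_in_ball[OF that]] strip_of_disc_of_strip[OF that] by (simp add: S_def g_def)
    show "g (cnj s) = cnj (g s)" if "s \<in> strip" for s
      using FG(5)[OF disc_of_strip_in_ball[OF that]] by (simp add: g_def disc_of_strip_cnj)
    obtain k where k: "0 < k" "(G has_field_derivative of_real k) (at 0)" using FG(6) by blast
    have "(g has_field_derivative 1/2 * of_real k) (at 0)"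
      using DERIV_chain'[OF disc_of_strip_derivative_0, of G "of_real k"] k(2) by (simp add: g_def o_def mult.commute)
    then show "\<exists>k>0. (g has_field_derivative of_real k) (at 0)"
      using k(1) by (intro exI[of _ "k / 2"]) auto
  qed
qed

section \<open>Growth of the strip map along the strip\<close>

lemma Re_csqrt_pos: "z \<notin> \<real>\<^sub>\<le>\<^sub>0 \<Longrightarrow> 0 < Re (csqrt z)"
proof -
  assume z: "z \<notin> \<real>\<^sub>\<le>\<^sub>0"
  have "Re (csqrt z) \<noteq> 0"
  proof
    assume r: "Re (csqrt z) = 0"
    define w where "w = csqrt z"
    have "z = w * w" "Re w = 0" using r by (simp_all add: w_def flip: power2_eq_square)
    then have "Re z \<le> 0" "Im z = 0" by simp_all
    then show False using z by (simp add: complex_nonpos_Reals_iff)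
  qed
  then show ?thesis using Re_csqrt[of z] by simp
qed

text \<open>Harnack's inequality for maps of the disc into the right half-plane, from the Schwarz lemma applied
  to a Cayley transform of \<open>Q\<close>.\<close>
lemma half_plane_schwarz:
  assumes Q: "Q holomorphic_on ball 0 1" "\<And>z. z \<in> ball 0 1 \<Longrightarrow> 0 < Re (Q z)"
    and q: "Q 0 = of_real q" and z: "z \<in> ball 0 1"
  shows "q * (1 - norm z) \<le> norm (Q z) * (1 + norm z)"
proof -
  have q0: "0 < q" using Q(2)[of 0] q by simp
  define T where "T = (\<lambda>z. (Q z - of_real q) / (Q z + of_real q))"
  have nz: "Q w + of_real q \<noteq> 0" if "w \<in> ball 0 1" for w
    using Q(2)[OF that] q0 by (auto simp: complex_eq_iff)
  have T1: "norm (T w) < 1" if "norm w < 1" for w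
  proof -
    have w: "w \<in> ball 0 1" using that by simp
    have "0 < Re (Q w / of_real q)" using Q(2)[OF w] q0 by simp
    from norm_cayley_less[OF this]
    have "norm ((Q w / of_real q - 1) / (Q w / of_real q + 1)) < 1" .
    moreover have "(Q w / of_real q - 1) / (Q w / of_real q + 1) = T w"
    proof -
      have "Q w / of_real q - 1 = (Q w - of_real q) / of_real q" "Q w / of_real q + 1 = (Q w + of_real q) / of_real q"
        using q0 by (simp_all add: field_simps)
      then show ?thesis using q0 by (simp add: T_def)
    qed
    ultimately show ?thesis by simp
  qed
  have "T holomorphic_on ball 0 1" unfolding T_def using Q(1) nz by (intro holomorphic_intros) auto
  moreover have "T 0 = 0" by (simp add: T_def q)
  ultimately have "norm (T z) \<le> norm z" using Schwarz_Lemma(1)[of T z] T1 z by simp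
  then have le: "norm (Q z - of_real q) \<le> norm z * norm (Q z + of_real q)"
    using nz[OF z] by (simp add: T_def norm_divide divide_le_eq)
  have "q - norm (Q z) \<le> norm (Q z - of_real q)"
    using norm_triangle_ineq2[of "of_real q" "Q z"] q0 by (simp add: norm_minus_commute)
  also note le
  also have "norm z * norm (Q z + of_real q) \<le> norm z * (norm (Q z) + q)"
    using norm_triangle_ineq[of "Q z" "of_real q"] q0 by (intro mult_left_mono) auto
  finally show ?thesis by (simp add: algebra_simps)
qed

lemma norm_disc_of_strip_bound:
  assumes "0 < \<delta>" "\<delta> \<le> pi / 2"
  obtains \<rho> where "0 \<le> \<rho>" "\<rho> < 1" "\<And>y. \<bar>y\<bar> \<le> pi / 2 - \<delta> \<Longrightarrow> norm (disc_of_strip (\<i> * of_real y)) \<le> \<rho>"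
proof -
  let ?K = "{- (pi / 2 - \<delta>)..pi / 2 - \<delta>}"
  have st: "\<i> * of_real y \<in> strip" if "y \<in> ?K" for y using that assms by (auto simp: strip_def abs_less_iff)
  have "continuous_on ?K (\<lambda>y. norm (disc_of_strip (\<i> * of_real y)))"
    by (intro continuous_intros continuous_on_compose2[OF holomorphic_on_imp_continuous_on[OF holomorphic_disc_of_strip]])
       (use st in auto)
  moreover have "compact ?K" "?K \<noteq> {}" using assms by auto
  ultimately obtain y0 where y0: "y0 \<in> ?K"
      "\<forall>y\<in>?K. norm (disc_of_strip (\<i> * of_real y)) \<le> norm (disc_of_strip (\<i> * of_real y0))"
    using continuous_attains_sup[of ?K "\<lambda>y. norm (disc_of_strip (\<i> * of_real y))"] by auto
  show thesis
  proof (rule that[of "norm (disc_of_strip (\<i> * of_real y0))"])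
    show "norm (disc_of_strip (\<i> * of_real y0)) < 1" using disc_of_strip_in_ball[OF st[OF y0(1)]] by simp
    show "norm (disc_of_strip (\<i> * of_real y)) \<le> norm (disc_of_strip (\<i> * of_real y0))"
      if "\<bar>y\<bar> \<le> pi / 2 - \<delta>" for y using y0(2) that by (auto simp: abs_le_iff)
  qed auto
qed

text \<open>The square root of \<open>(g - a) / (b - g)\<close> maps the strip into the right half-plane, and on the real axis
  it is positive and tends to infinity.  Harnack's inequality carries this growth over to the points
  of the smaller strip, whose distance from the axis is bounded in the disc model.\<close>
lemma strip_limit_right:
  assumes g: "g holomorphic_on strip" and ab: "a < b"
    and re: "\<And>s. s \<in> strip \<Longrightarrow> Im (g s) = 0 \<Longrightarrow> a < Re (g s) \<and> Re (g s) < b"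
    and real: "\<And>x. Im (g (of_real x)) = 0"
    and lim: "\<And>y. y < b \<Longrightarrow> \<exists>X. \<forall>x\<ge>X. y < Re (g (of_real x))"
    and \<delta>: "0 < \<delta>" "\<delta> \<le> pi / 2" and e: "0 < e"
  shows "\<exists>X. \<forall>s. \<bar>Im s\<bar> \<le> pi / 2 - \<delta> \<longrightarrow> X \<le> Re s \<longrightarrow> dist (g s) (of_real b) < e"
proof -
  define R where "R = (\<lambda>s. (g s - of_real a) / (of_real b - g s))"
  have nb: "of_real b - g s \<noteq> 0" if "s \<in> strip" for s using re[OF that] by (auto simp: complex_eq_iff)
  have Rn: "R s \<notin> \<real>\<^sub>\<le>\<^sub>0" if s: "s \<in> strip" for s
  proof
    assume "R s \<in> \<real>\<^sub>\<le>\<^sub>0"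
    then obtain t where t: "R s = of_real t" "t \<le> 0"
      by (metis complex_nonpos_Reals_iff complex_is_Real_iff of_real_Re)
    then have eq: "g s - of_real a = of_real t * (of_real b - g s)"
      using nb[OF s] by (simp add: R_def field_simps)
    from arg_cong[OF eq, of Im] have im: "Im (g s) * (1 + t) = 0" by (simp add: algebra_simps)
    from arg_cong[OF eq, of Re] have r: "Re (g s) - a = t * (b - Re (g s))" by simp
    show False
    proof (cases "Im (g s) = 0")
      case True
      from re[OF s True] have "0 < Re (g s) - a" "0 < b - Re (g s)" by auto
      moreover have "t * (b - Re (g s)) \<le> 0" using t(2) \<open>0 < b - Re (g s)\<close> by (simp add: mult_le_0_iff)
      ultimately show False using r by linarith
    next
      case False
      then have "t = -1" using im by simp
      then show False using r ab by simp
    qed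
  qed
  have Rh: "R holomorphic_on strip" unfolding R_def using g nb by (intro holomorphic_intros) auto
  have ph: "(\<lambda>s. csqrt (R s)) holomorphic_on strip" using Rh Rn by (rule holomorphic_on_csqrt')
  have ppos: "0 < Re (csqrt (R s))" if "s \<in> strip" for s using Re_csqrt_pos[OF Rn[OF that]] .
  obtain \<rho> where \<rho>: "0 \<le> \<rho>" "\<rho> < 1" "\<And>y. \<bar>y\<bar> \<le> pi / 2 - \<delta> \<Longrightarrow> norm (disc_of_strip (\<i> * of_real y)) \<le> \<rho>"
    using norm_disc_of_strip_bound[OF \<delta>] by blast
  have Rx: "R (of_real x) = of_real ((Re (g (of_real x)) - a) / (b - Re (g (of_real x))))" for x
    using real[of x] by (simp add: R_def complex_eq_iff Re_divide Im_divide power2_eq_square)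
  have key: "sqrt ((Re (g (of_real (Re s))) - a) / (b - Re (g (of_real (Re s))))) * (1 - \<rho>) \<le> norm (csqrt (R s)) * 2"
    if s: "\<bar>Im s\<bar> \<le> pi / 2 - \<delta>" for s
  proof -
    define x where "x = Re s"
    define q where "q = sqrt ((Re (g (of_real x)) - a) / (b - Re (g (of_real x))))"
    define z where "z = disc_of_strip (\<i> * of_real (Im s))"
    have ist: "\<i> * of_real (Im s) \<in> strip" using s \<delta> by (auto simp: strip_def)
    have z: "z \<in> ball 0 1" "norm z \<le> \<rho>" using \<rho>(3)[OF s] disc_of_strip_in_ball[OF ist] by (auto simp: z_def)
    have xs: "of_real x + strip_of_disc w \<in> strip" if "w \<in> ball 0 1" for w
      using strip_of_disc_in_strip[OF that] by (simp add: strip_def)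
    define Q where "Q = (\<lambda>w. csqrt (R (of_real x + strip_of_disc w)))"
    have xstrip: "complex_of_real x \<in> strip" by (simp add: strip_def)
    have "q * (1 - norm z) \<le> norm (Q z) * (1 + norm z)"
    proof (rule half_plane_schwarz[OF _ _ _ z(1)])
      have "(\<lambda>w. of_real x + strip_of_disc w) holomorphic_on ball 0 1"
        using holomorphic_strip_of_disc by (intro holomorphic_intros)
      from holomorphic_on_compose_gen[OF this ph image_subsetI[OF xs]]
      show "Q holomorphic_on ball 0 1" by (simp add: Q_def o_def)
      show "0 < Re (Q w)" if "w \<in> ball 0 1" for w using ppos[OF xs[OF that]] by (simp add: Q_def)
      have csr: "csqrt (of_real v) = of_real (sqrt v)" if "0 \<le> v" for v
        using csqrt_of_real_nonneg[of "of_real v"] that by (simp del: csqrt.simps)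
      have "0 \<le> (Re (g (of_real x)) - a) / (b - Re (g (of_real x)))"
        using re[OF xstrip real] by auto
      then show "Q 0 = of_real q" by (simp only: Q_def strip_of_disc_0 add_0_right Rx q_def csr)
    qed
    moreover have Qz: "Q z = csqrt (R s)"
    proof -
      have "of_real x + strip_of_disc z = s"
        using strip_of_disc_of_strip[OF ist] by (simp add: z_def x_def complex_eq_iff)
      then show ?thesis by (simp add: Q_def)
    qed
    moreover have "0 \<le> q" using re[OF xstrip real] by (auto simp: q_def)
    then have "q * (1 - \<rho>) \<le> q * (1 - norm z)" using z(2) by (intro mult_left_mono) auto
    moreover have "norm (Q z) * (1 + norm z) \<le> norm (Q z) * 2"
      using z(1) by (intro mult_left_mono) auto
    ultimately have "q * (1 - \<rho>) \<le> norm (Q z) * 2" by linarith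
    then show ?thesis by (simp only: Qz q_def x_def)
  qed
  (* A quotient R of modulus above M puts g within e of b; N is the size of R on the real axis that Harnack turns into M, and y is the place in (a, b) where it is reached. *)
  define M where "M = (b - a) / e + 1"
  have M: "0 < M" using ab e by (simp add: M_def add_pos_pos)
  define N where "N = M * 4 / (1 - \<rho>)\<^sup>2 + 1"
  have N: "0 < N" using M \<rho> by (simp add: N_def add_nonneg_pos)
  define y where "y = b - (b - a) / (N + 1)"
  have y: "y < b" using ab N by (simp add: y_def)
  obtain X where X: "\<And>x. x \<ge> X \<Longrightarrow> y < Re (g (of_real x))" using lim[OF y] by blast
  have "dist (g s) (of_real b) < e" if s: "\<bar>Im s\<bar> \<le> pi / 2 - \<delta>" "X \<le> Re s" for s
  proof -
    have sst: "s \<in> strip" using s \<delta> by (auto simp: strip_def)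
    define t where "t = Re (g (of_real (Re s)))"
    have ty: "y < t" using X s by (simp add: t_def)
    have "complex_of_real (Re s) \<in> strip" by (simp add: strip_def)
    from re[OF this real] have tb: "t < b" "a < t" by (auto simp: t_def)
    have "N \<le> (t - a) / (b - t)"
    proof -
      have "b - t < (b - a) / (N + 1)" using ty by (simp add: y_def)
      then have "(b - t) * (N + 1) < b - a" using N by (simp add: field_simps)
      then have "N * (b - t) \<le> t - a" by (simp add: algebra_simps)
      then show ?thesis using tb by (simp add: le_divide_eq)
    qed
    then have "sqrt N * (1 - \<rho>) \<le> sqrt ((t - a) / (b - t)) * (1 - \<rho>)"
      using \<rho> by (intro mult_right_mono) auto
    also have "\<dots> \<le> norm (csqrt (R s)) * 2" using key[OF s(1)] by (simp add: t_def)
    finally have "(sqrt N * (1 - \<rho>))\<^sup>2 \<le> (norm (csqrt (R s)) * 2)\<^sup>2"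
      using \<rho> N by (intro power_mono) auto
    moreover have "(norm (csqrt (R s)))\<^sup>2 = norm (R s)" by (simp flip: norm_power)
    ultimately have "N * (1 - \<rho>)\<^sup>2 \<le> norm (R s) * 4" using N by (simp add: power_mult_distrib)
    moreover have "M * 4 < N * (1 - \<rho>)\<^sup>2"
    proof -
      have "0 < (1 - \<rho>)\<^sup>2" using \<rho> by simp
      then show ?thesis by (simp add: N_def distrib_right)
    qed
    ultimately have RM: "M < norm (R s)" by linarith
    have "of_real b - g s = of_real (b - a) / (R s + 1)"
    proof -
      have "R s + 1 = of_real (b - a) / (of_real b - g s)"
        using nb[OF sst] by (simp add: R_def field_simps)
      then show ?thesis using ab by simp
    qed
    then have "dist (g s) (of_real b) = (b - a) / norm (R s + 1)"
      using ab by (simp add: dist_norm norm_minus_commute norm_divide del: of_real_diff)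
    also have "\<dots> < (b - a) / ((b - a) / e)"
    proof (rule divide_strict_left_mono)
      have "norm (R s) - 1 \<le> norm (R s + 1)" using norm_triangle_ineq2[of "R s" "-1"] by simp
      then show lt: "(b - a) / e < norm (R s + 1)" using RM by (simp add: M_def)
      have "0 < (b - a) / e" using ab e by simp
      with lt show "0 < norm (R s + 1) * ((b - a) / e)" by (intro mult_pos_pos) linarith+
    qed (use ab in auto)
    also have "\<dots> = e" using ab by simp
    finally show ?thesis .
  qed
  then show ?thesis by blast
qed

section \<open>Harmonic measure in the strip coordinate\<close>

text \<open>The positive derivative at \<open>0\<close> fixes the orientation: the upper half of the strip is mapped to \<open>U\<close>.\<close>
locale strip_map =
  fixes U :: "complex set" and a b :: real and g S :: "complex \<Rightarrow> complex"
  assumes openU: "open U" and upper: "U \<subseteq> {z. 0 < Im z}" and ab: "-1 \<le> a" "a < b" "b \<le> 1"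
    and openV: "open (reflected_domain U a b)"
    and holS: "S holomorphic_on reflected_domain U a b" and holg: "g holomorphic_on strip"
    and gS: "\<And>z. z \<in> reflected_domain U a b \<Longrightarrow> S z \<in> strip \<and> g (S z) = z"
    and Sg: "\<And>s. s \<in> strip \<Longrightarrow> g s \<in> reflected_domain U a b \<and> S (g s) = s"
    and sym: "\<And>s. s \<in> strip \<Longrightarrow> g (cnj s) = cnj (g s)"
    and deriv0: "\<exists>k>0. (g has_field_derivative of_real k) (at 0)"
begin

abbreviation "V \<equiv> reflected_domain U a b"

lemma in_V_cases: "z \<in> V \<longleftrightarrow> z \<in> U \<or> cnj z \<in> U \<or> (Im z = 0 \<and> a < Re z \<and> Re z < b)"
proof -
  have "z \<in> complex_of_real ` {a<..<b} \<longleftrightarrow> Im z = 0 \<and> a < Re z \<and> Re z < b"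
    by (auto simp: complex_eq_iff intro!: image_eqI[of z _ "Re z"])
  then show ?thesis by (auto simp: reflected_domain_def cnj_image_eq_vimage)
qed

lemma V_real: "z \<in> V \<Longrightarrow> Im z = 0 \<Longrightarrow> a < Re z \<and> Re z < b"
  using upper by (auto simp: in_V_cases subset_iff)

lemma V_upper: "z \<in> V \<Longrightarrow> 0 < Im z \<Longrightarrow> z \<in> U"
  using upper by (auto simp: in_V_cases dest!: subsetD)

lemma U_V: "z \<in> U \<Longrightarrow> z \<in> V"
  by (simp add: in_V_cases)

lemma real_strip [simp]: "complex_of_real x \<in> strip"
  by (simp add: strip_def)

lemma Im_g_eq_0_iff:
  assumes "s \<in> strip"
  shows "Im (g s) = 0 \<longleftrightarrow> Im s = 0"
proof
  assume "Im s = 0"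
  then have "cnj s = s" by (simp add: complex_eq_iff)
  then have "g s = cnj (g s)" using sym[OF assms] by simp
  from arg_cong[OF this, of Im] show "Im (g s) = 0" by simp
next
  assume "Im (g s) = 0"
  then have "g (cnj s) = g s" using sym[OF assms] by (simp add: complex_eq_iff)
  moreover have "cnj s \<in> strip" using assms by (simp add: strip_def)
  ultimately have "cnj s = s" using Sg[of "cnj s"] Sg[OF assms] by simp
  then show "Im s = 0" by (simp add: complex_eq_iff)
qed

text \<open>\<open>g\<close> on the real axis, as an increasing bijection onto \<open>(a, b)\<close>.\<close>
definition r :: "real \<Rightarrow> real"
  where "r x = Re (g (of_real x))"

lemma g_real: "g (of_real x) = of_real (r x)"
  using Im_g_eq_0_iff[of "of_real x"] by (simp add: r_def complex_eq_iff)

lemma r_surj: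
  assumes "a < t" "t < b"
  obtains x where "r x = t" "S (of_real t) = of_real x"
proof -
  have t: "of_real t \<in> V" using assms by (simp add: in_V_cases)
  from gS[OF t] have s: "S (of_real t) \<in> strip" "g (S (of_real t)) = of_real t" by auto
  then have "Im (S (of_real t)) = 0" using Im_g_eq_0_iff[OF s(1)] by simp
  then have e: "S (of_real t) = of_real (Re (S (of_real t)))" by (simp add: complex_eq_iff)
  have "r (Re (S (of_real t))) = t" using s(2) e unfolding r_def by (metis Re_complex_of_real)
  then show thesis using that e by blast
qed

lemma continuous_on_g: "continuous_on strip g"
  using holg by (rule holomorphic_on_imp_continuous_on)

lemma strict_mono_r: "strict_mono r"
proof -
  have "continuous_on UNIV r"
    unfolding r_def by (intro continuous_intros continuous_on_compose2[OF continuous_on_g]) auto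
  moreover have "inj r"
  proof (rule injI)
    fix x y assume "r x = r y"
    then have "g (of_real x) = g (of_real y)" by (simp add: g_real)
    then have "S (g (of_real x)) = S (g (of_real y))" by simp
    then show "x = y" using Sg[of "of_real x"] Sg[of "of_real y"] by simp
  qed
  ultimately have "strict_mono_on UNIV r \<or> strict_antimono_on UNIV r"
    using injective_eq_monotone_map[of UNIV r] by (simp add: is_interval_univ)
  moreover have "\<not> strict_antimono_on UNIV r"
  proof
    assume anti: "strict_antimono_on UNIV r"
    obtain k where k: "0 < k" "(g has_field_derivative of_real k) (at 0)" using deriv0 by blast
    have "((\<lambda>x. g (of_real x)) has_vector_derivative of_real k) (at 0)"
      using has_vector_derivative_real_field[of g "of_real k" 0] k(2) by simp
    then have "((\<lambda>x. Re (g (of_real x))) has_vector_derivative Re (of_real k)) (at 0)"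
      by (rule bounded_linear.has_vector_derivative[OF bounded_linear_Re])
    then have "(r has_real_derivative k) (at 0)"
      unfolding r_def has_real_derivative_iff_has_vector_derivative by simp
    from DERIV_pos_inc_right[OF this k(1)] obtain d where d: "d > 0" "\<forall>h>0. h < d \<longrightarrow> r 0 < r (0 + h)"
      by auto
    then have "r 0 < r (d / 2)" by auto
    moreover have "r (d / 2) < r 0" using monotone_onD[OF anti, of 0 "d / 2"] d(1) by simp
    ultimately show False by simp
  qed
  ultimately show ?thesis by simp
qed

text \<open>On the upper half of the strip \<open>Im g\<close> has no zeros, hence constant sign, and close to \<open>0\<close> it is
  positive because \<open>g\<close> has a positive derivative there.\<close>
lemma Im_g_pos_iff:
  assumes "s \<in> strip"
  shows "0 < Im (g s) \<longleftrightarrow> 0 < Im s"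
proof -
  obtain k where k: "0 < k" "(g has_field_derivative of_real k) (at 0)" using deriv0 by blast
  have "\<exists>t>0. t < pi / 2 \<and> 0 < Im (g (\<i> * of_real t))"
  proof -
    have "((\<lambda>t. \<i> * complex_of_real t) has_vector_derivative \<i>) (at 0)"
      by (auto intro!: derivative_eq_intros)
    moreover have "(g has_field_derivative of_real k) (at (\<i> * complex_of_real 0))" using k(2) by simp
    ultimately have "(g \<circ> (\<lambda>t. \<i> * complex_of_real t) has_vector_derivative \<i> * of_real k) (at 0)"
      by (rule field_vector_diff_chain_at)
    then have "((\<lambda>t. Im ((g \<circ> (\<lambda>t. \<i> * complex_of_real t)) t)) has_vector_derivative Im (\<i> * of_real k)) (at 0)"
      by (rule bounded_linear.has_vector_derivative[OF bounded_linear_Im])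
    then have "((\<lambda>t. Im (g (\<i> * of_real t))) has_real_derivative k) (at 0)"
      unfolding has_real_derivative_iff_has_vector_derivative by (simp add: o_def)
    from DERIV_pos_inc_right[OF this k(1)] obtain d where
      d: "d > 0" "\<forall>h>0. h < d \<longrightarrow> Im (g (\<i> * of_real 0)) < Im (g (\<i> * of_real (0 + h)))" by auto
    have "Im (g (\<i> * of_real 0)) = 0" using Im_g_eq_0_iff[of 0] by (simp add: strip_def)
    then have "0 < Im (g (\<i> * of_real (min (d/2) (pi/4))))" using d by (auto simp: min_def)
    moreover have "min (d/2) (pi/4) < pi / 2"
      using min.cobounded2[of "d/2" "pi/4"] pi_gt_zero by linarith
    ultimately show ?thesis using d(1) by (intro exI[of _ "min (d/2) (pi/4)"]) simp
  qed
  then obtain t where t: "0 < t" "t < pi / 2" "0 < Im (g (\<i> * of_real t))" by auto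
  have main: "0 < Im (g s)" if s: "s \<in> strip" "0 < Im s" for s
  proof (rule ccontr)
    assume "\<not> 0 < Im (g s)"
    define P where "P = strip \<inter> {s. 0 < Im s}"
    have "convex P" unfolding P_def by (intro convex_Int convex_strip convex_halfspace_Im_gt)
    then have cP: "connected P" by (rule convex_connected)
    have "continuous_on P (\<lambda>s. Im (g s))"
      using continuous_on_subset[OF continuous_on_g, of P] by (intro continuous_intros) (auto simp: P_def)
    from connected_continuous_image[OF this cP] have c: "connected ((\<lambda>s. Im (g s)) ` P)" .
    have i: "Im (g s) \<in> (\<lambda>s. Im (g s)) ` P" using s by (simp add: P_def)
    have "\<i> * of_real t \<in> P" using t by (simp add: P_def strip_def)
    then have j: "Im (g (\<i> * of_real t)) \<in> (\<lambda>s. Im (g s)) ` P" by (rule imageI)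
    have "0 \<in> (\<lambda>s. Im (g s)) ` P"
      using connectedD_interval[OF c i j, of 0] \<open>\<not> 0 < Im (g s)\<close> t(3) by simp
    then obtain p where "p \<in> strip" "0 < Im p" "Im (g p) = 0" by (auto simp: P_def)
    then show False using Im_g_eq_0_iff[of p] by simp
  qed
  show ?thesis
  proof
    assume p: "0 < Im (g s)"
    show "0 < Im s"
    proof (rule ccontr)
      assume n: "\<not> 0 < Im s"
      then have "Im s \<noteq> 0" using p Im_g_eq_0_iff[OF assms] by auto
      then have "0 < Im (cnj s)" "cnj s \<in> strip" using n assms by (auto simp: strip_def)
      from main[OF this(2,1)] show False using sym[OF assms] p by simp
    qed
  qed (rule main[OF assms])
qed

lemma g_in_U: "s \<in> strip \<Longrightarrow> 0 < Im s \<Longrightarrow> g s \<in> U"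
  using Im_g_pos_iff[of s] Sg[of s] V_upper by blast

lemma S_U: "z \<in> U \<Longrightarrow> S z \<in> strip \<and> 0 < Im (S z) \<and> g (S z) = z"
  using gS[OF U_V, of z] Im_g_pos_iff[of "S z"] upper by auto

lemma r_near_b: "y < b \<Longrightarrow> \<exists>X. \<forall>x\<ge>X. y < r x"
proof -
  assume y: "y < b"
  define t where "t = max ((y + b) / 2) ((a + b) / 2)"
  have t: "a < t" "t < b" "y < t" using y ab by (auto simp: t_def less_max_iff_disj)
  obtain x where x: "r x = t" using r_surj[OF t(1,2)] by blast
  then show ?thesis using t(3) strict_mono_less_eq[OF strict_mono_r, of x]
    by (intro exI[of _ x]) (auto intro: less_le_trans)
qed

lemma r_near_a: "a < y \<Longrightarrow> \<exists>X. \<forall>x\<le>X. r x < y"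
proof -
  assume y: "a < y"
  define t where "t = min ((y + a) / 2) ((a + b) / 2)"
  have t: "a < t" "t < b" "t < y" using y ab by (auto simp: t_def min_less_iff_disj)
  obtain x where x: "r x = t" using r_surj[OF t(1,2)] by blast
  then show ?thesis using t(3) strict_mono_less_eq[OF strict_mono_r, of _ x]
    by (intro exI[of _ x]) (auto intro: le_less_trans)
qed

lemma g_limit_right:
  assumes "0 < \<delta>" "\<delta> \<le> pi / 2" "0 < e"
  shows "\<exists>X. \<forall>s. \<bar>Im s\<bar> \<le> pi / 2 - \<delta> \<longrightarrow> X \<le> Re s \<longrightarrow> dist (g s) (of_real b) < e"
proof (rule strip_limit_right[OF holg ab(2) _ _ _ assms])
  show "a < Re (g s) \<and> Re (g s) < b" if "s \<in> strip" "Im (g s) = 0" for s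
    using V_real that Sg by blast
  show "\<exists>X. \<forall>x\<ge>X. y < Re (g (of_real x))" if "y < b" for y
    using r_near_b[OF that] by (simp add: g_real)
qed (simp add: g_real)

lemma g_limit_left:
  assumes "0 < \<delta>" "\<delta> \<le> pi / 2" "0 < e"
  shows "\<exists>X. \<forall>s. \<bar>Im s\<bar> \<le> pi / 2 - \<delta> \<longrightarrow> Re s \<le> X \<longrightarrow> dist (g s) (of_real a) < e"
proof -
  define G where "G = (\<lambda>s. - g (- s))"
  have ms: "- s \<in> strip" if "s \<in> strip" for s using that by (simp add: strip_def)
  have mr: "complex_of_real (- x) = - of_real x" for x by simp
  have "\<exists>X. \<forall>s. \<bar>Im s\<bar> \<le> pi / 2 - \<delta> \<longrightarrow> X \<le> Re s \<longrightarrow> dist (G s) (of_real (- a)) < e"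
  proof (rule strip_limit_right[OF _ _ _ _ _ assms])
    have "(\<lambda>s. - s) holomorphic_on strip" by (intro holomorphic_intros)
    from holomorphic_on_compose_gen[OF this holg image_subsetI[OF ms]]
    show "G holomorphic_on strip" unfolding G_def by (intro holomorphic_intros) (simp add: o_def)
    show "- b < - a" using ab by simp
    show "- b < Re (G s) \<and> Re (G s) < - a" if "s \<in> strip" "Im (G s) = 0" for s
      using V_real[of "g (- s)"] Sg[OF ms[OF that(1)]] that(2) by (simp add: G_def)
    show "Im (G (of_real x)) = 0" for x
      using g_real[of "- x"] by (simp add: G_def)
    show "\<exists>X. \<forall>x\<ge>X. y < Re (G (of_real x))" if "y < - a" for y
    proof -
      have "a < - y" using that by simp
      from r_near_a[OF this] obtain X where X: "\<forall>x\<le>X. r x < - y" ..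
      have "y < Re (G (of_real x))" if "- X \<le> x" for x
        using X[rule_format, of "- x"] that g_real[of "- x"] by (simp add: G_def)
      then show ?thesis by blast
    qed
  qed
  then obtain X where X: "\<And>s. \<bar>Im s\<bar> \<le> pi / 2 - \<delta> \<Longrightarrow> X \<le> Re s \<Longrightarrow> dist (G s) (of_real (- a)) < e" by blast
  have "dist (g s) (of_real a) < e" if "\<bar>Im s\<bar> \<le> pi / 2 - \<delta>" "Re s \<le> - X" for s
    using X[of "- s"] that by (simp add: G_def dist_norm norm_minus_commute)
  then show ?thesis by blast
qed

text \<open>The harmonic measure of \<open>(a, b)\<close> in \<open>U\<close>, which is a linear function in the strip.\<close>
definition omega :: "complex \<Rightarrow> real"
  where "omega z = 1 - 2 / pi * Im (S z)"

lemma harmonic_on_omega: "harmonic_on omega U"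
proof -
  have "S holomorphic_on U" using holS by (rule holomorphic_on_subset) (auto intro: U_V)
  then have "harmonic_on (\<lambda>z. 1 + (- (2 / pi)) * Im (S z)) U"
    by (intro harmonic_on_add harmonic_on_const harmonic_on_cmult harmonic_on_Im)
  then show ?thesis by (simp add: omega_def[abs_def])
qed

lemma omega_bounds:
  assumes "z \<in> U"
  shows "0 \<le> omega z" "omega z \<le> 1"
  using S_U[OF assms] by (auto simp: omega_def strip_def field_simps)

lemma omega_near_interval:
  assumes "a < x" "x < b"
  shows "limsup_le (\<lambda>z. - omega z) U (Some (of_real x)) (-1)"
proof -
  have x: "of_real x \<in> V" using assms by (simp add: in_V_cases)
  have "isCont S (of_real x)"
    using holomorphic_on_imp_continuous_on[OF holS] openV x continuous_on_eq_continuous_at by blast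
  then have "((\<lambda>z. - omega z) \<longlongrightarrow> - (1 - 2 / pi * Im (S (of_real x)))) (at (of_real x) within U)"
    unfolding omega_def isCont_def
    by (intro tendsto_intros) (auto intro: tendsto_within_subset)
  moreover obtain y where "S (of_real x) = of_real y" by (rule r_surj[OF assms])
  ultimately have t: "((\<lambda>z. - omega z) \<longlongrightarrow> -1) (at (of_real x) within U)" by simp
  show ?thesis unfolding limsup_le_Some using order_tendstoD(2)[OF t] by blast
qed

text \<open>These points come from the part of the strip below a line \<open>Im s = \<pi>/2 - \<delta>\<close>.  Far out in that part
  \<open>g\<close> is close to \<open>a\<close> or \<open>b\<close>, and the rest is a compact rectangle.\<close>
lemma omega_superlevel:
  assumes "0 < d" "0 < e"
  obtains K where "compact K" "K \<subseteq> V"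
    "\<And>z. z \<in> U \<Longrightarrow> d \<le> omega z \<Longrightarrow> z \<in> K \<or> dist z (of_real a) < e \<or> dist z (of_real b) < e"
proof -
  define \<delta> where "\<delta> = min (pi / 2) (pi / 2 * d)"
  have \<delta>: "0 < \<delta>" "\<delta> \<le> pi / 2" using assms by (auto simp: \<delta>_def)
  obtain X where X: "\<And>s. \<bar>Im s\<bar> \<le> pi / 2 - \<delta> \<Longrightarrow> X \<le> Re s \<Longrightarrow> dist (g s) (of_real b) < e"
    using g_limit_right[OF \<delta> assms(2)] by blast
  obtain Y where Y: "\<And>s. \<bar>Im s\<bar> \<le> pi / 2 - \<delta> \<Longrightarrow> Re s \<le> Y \<Longrightarrow> dist (g s) (of_real a) < e"
    using g_limit_left[OF \<delta> assms(2)] by blast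
  define C where "C = cbox (Complex Y 0) (Complex X (pi / 2 - \<delta>))"
  have C: "C \<subseteq> strip" using \<delta> by (auto simp: C_def in_cbox_complex_iff strip_def)
  show thesis
  proof (rule that[of "g ` C"])
    show "compact (g ` C)"
      by (intro compact_continuous_image continuous_on_subset[OF continuous_on_g C]) (simp add: C_def)
    show "g ` C \<subseteq> V" using C Sg by blast
    fix z assume z: "z \<in> U" "d \<le> omega z"
    from S_U[OF z(1)] have s: "S z \<in> strip" "0 < Im (S z)" "g (S z) = z" by auto
    have "Im (S z) \<le> pi / 2 - pi / 2 * d"
    proof -
      have "2 / pi * Im (S z) \<le> 1 - d" using z(2) by (simp add: omega_def)
      then have "Im (S z) \<le> (1 - d) * (pi / 2)" by (simp add: field_simps)
      then show ?thesis by (simp add: algebra_simps)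
    qed
    moreover have "\<delta> = pi / 2 * d"
    proof -
      have "pi / 2 * d < pi / 2" using calculation s(2) by linarith
      then show ?thesis by (simp add: \<delta>_def)
    qed
    ultimately have i: "Im (S z) \<le> pi / 2 - \<delta>" by simp
    then have i': "\<bar>Im (S z)\<bar> \<le> pi / 2 - \<delta>" using s(2) by simp
    consider "X \<le> Re (S z)" | "Re (S z) \<le> Y" | "Y \<le> Re (S z)" "Re (S z) \<le> X" by linarith
    then show "z \<in> g ` C \<or> dist z (of_real a) < e \<or> dist z (of_real b) < e"
    proof cases
      case 1 then show ?thesis using X[OF i'] s(3) by simp
    next
      case 2 then show ?thesis using Y[OF i'] s(3) by simp
    next
      case 3
      then have "S z \<in> C" using i s(2) by (simp add: C_def in_cbox_complex_iff)
      then show ?thesis using s(3) by (metis imageI)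
    qed
  qed
qed

text \<open>A boundary point off \<open>[-1, 1]\<close> keeps a distance from \<open>a\<close>, from \<open>b\<close> and from every compact subset of
  the reflected domain; infinity is excluded by boundedness.\<close>
lemma omega_near_rest:
  assumes \<zeta>: "\<zeta> \<in> sphere_boundary U" "\<zeta> \<notin> closed_interval"
  shows "limsup_le omega U \<zeta> 0"
proof (cases \<zeta>)
  case None
  show ?thesis
    unfolding None limsup_le_None
  proof safe
    fix d :: real assume d: "0 < d"
    obtain K where K: "compact K" "K \<subseteq> V"
      "\<And>z. z \<in> U \<Longrightarrow> d \<le> omega z \<Longrightarrow> z \<in> K \<or> dist z (of_real a) < 1 \<or> dist z (of_real b) < 1"
      using omega_superlevel[OF d, of 1] by auto
    obtain B where B: "\<And>z. z \<in> K \<Longrightarrow> norm z \<le> B"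
      using compact_imp_bounded[OF K(1)] bounded_iff by metis
    have "omega z < d" if z: "z \<in> U" "max B 2 < norm z" for z
    proof (rule ccontr)
      assume "\<not> omega z < d"
      then consider "z \<in> K" | "dist z (of_real a) < 1" | "dist z (of_real b) < 1" using K(3)[OF z(1)] by force
      then show False
      proof cases
        case 1 then show False using B z(2) by force
      next
        case 2
        have "\<bar>a\<bar> \<le> 1" using ab by auto
        moreover have "norm z \<le> norm (z - of_real a) + norm (of_real a :: complex)" using norm_triangle_sub[of z "of_real a"] by simp
        ultimately show False using 2 z(2) by (simp add: dist_norm)
      next
        case 3
        have "\<bar>b\<bar> \<le> 1" using ab by auto
        moreover have "norm z \<le> norm (z - of_real b) + norm (of_real b :: complex)" using norm_triangle_sub[of z "of_real b"] by simp
        ultimately show False using 3 z(2) by (simp add: dist_norm)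
      qed
    qed
    then show "\<exists>B. \<forall>z\<in>U. B < norm z \<longrightarrow> omega z < d" by blast
  qed
next
  case (Some c)
  have c: "c \<in> frontier U" using \<zeta>(1) openU Some by (auto simp: sphere_boundary_eq split: if_splits)
  have cn: "c \<noteq> of_real x" if "x \<in> {-1..1}" for x using \<zeta>(2) that Some by (auto simp: in_closed_interval)
  have "c \<notin> V"
  proof
    assume "c \<in> V"
    moreover have "c \<notin> U" using c openU by (simp add: frontier_def interior_open)
    moreover have "0 \<le> Im c"
    proof -
      have "closure U \<subseteq> {z. 0 \<le> Im z}"
        using upper by (intro closure_minimal) (auto simp: closed_halfspace_Im_ge)
      then show ?thesis using c by (auto simp: frontier_def)
    qed
    ultimately have "Im c = 0 \<and> a < Re c \<and> Re c < b" using V_upper[of c] V_real[of c] by force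
    then show False using cn[of "Re c"] ab by (simp add: complex_eq_iff)
  qed
  define e where "e = min (dist c (of_real a)) (dist c (of_real b)) / 2"
  have "c \<noteq> of_real a" "c \<noteq> of_real b" using cn ab by auto
  then have e: "0 < e" by (simp add: e_def)
  show ?thesis
    unfolding Some limsup_le_Some
  proof safe
    fix d :: real assume d: "0 < d"
    obtain K where K: "compact K" "K \<subseteq> V"
      "\<And>z. z \<in> U \<Longrightarrow> d \<le> omega z \<Longrightarrow> z \<in> K \<or> dist z (of_real a) < e \<or> dist z (of_real b) < e"
      using omega_superlevel[OF d e] by blast
    have "open (- K)" "c \<in> - K" using K \<open>c \<notin> V\<close> compact_imp_closed by auto
    then obtain e2 where e2: "0 < e2" "ball c e2 \<subseteq> - K" using open_contains_ball by blast
    have "omega z < d" if z: "z \<in> U" "dist z c < min e e2" for z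
    proof (rule ccontr)
      assume "\<not> omega z < d"
      moreover have "z \<notin> K" using z(2) e2(2) by (auto simp: dist_commute)
      ultimately consider "dist z (of_real a) < e" | "dist z (of_real b) < e" using K(3)[OF z(1)] by force
      then show False
      proof cases
        case 1
        have "dist c (of_real a) \<le> dist z c + dist z (of_real a)" by (rule dist_triangle3)
        then show False using 1 z(2) by (auto simp: e_def)
      next
        case 2
        have "dist c (of_real b) \<le> dist z c + dist z (of_real b)" by (rule dist_triangle3)
        then show False using 2 z(2) by (auto simp: e_def)
      qed
    qed
    then show "\<forall>\<^sub>F z in at c within U. omega z < d"
      unfolding eventually_at using e e2(1) by (intro exI[of _ "min e e2"]) auto
  qed
qed

lemma harmonic_measure_eq_omega:
  assumes dips: "\<And>x e. x \<in> {-1<..<1} - {a..b} \<Longrightarrow> 0 < e \<Longrightarrow> \<exists>t. 0 < t \<and> t < e \<and> Complex x t \<notin> U"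
    and z: "z \<in> U"
  shows "harmonic_measure z open_interval U = omega z"
  by (rule harmonic_measure_eqI[OF openU upper ab(1) less_imp_le[OF ab(2)] ab(3) harmonic_on_omega
        omega_bounds omega_near_interval dips omega_near_rest z])

lemma level_set_eq:
  assumes dips: "\<And>x e. x \<in> {-1<..<1} - {a..b} \<Longrightarrow> 0 < e \<Longrightarrow> \<exists>t. 0 < t \<and> t < e \<and> Complex x t \<notin> U"
  shows "level_set U (1/2) = (\<lambda>x. g (Complex x (pi / 4))) ` UNIV"
proof -
  have "level_set U (1/2) = {z \<in> U. omega z = 1/2}"
    unfolding level_set_def using harmonic_measure_eq_omega[OF dips] by auto
  also have "\<dots> = {z \<in> U. Im (S z) = pi / 4}" by (auto simp: omega_def field_simps)
  also have "\<dots> = (\<lambda>x. g (Complex x (pi / 4))) ` UNIV"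
  proof (intro equalityI subsetI)
    fix z assume z: "z \<in> {z \<in> U. Im (S z) = pi / 4}"
    then have e: "Complex (Re (S z)) (pi / 4) = S z" by (simp add: complex_eq_iff)
    have "g (Complex (Re (S z)) (pi / 4)) = z" unfolding e using S_U[of z] z by simp
    from this[symmetric] show "z \<in> (\<lambda>x. g (Complex x (pi / 4))) ` UNIV" by blast
  next
    fix z assume "z \<in> (\<lambda>x. g (Complex x (pi / 4))) ` UNIV"
    then obtain x where x: "z = g (Complex x (pi / 4))" by blast
    have "Complex x (pi / 4) \<in> strip" by (simp add: strip_def)
    then show "z \<in> {z \<in> U. Im (S z) = pi / 4}"
      using g_in_U[of "Complex x (pi / 4)"] Sg[of "Complex x (pi / 4)"] x by simp
  qed
  finally show ?thesis .
qed

end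

section \<open>The Schwarz-Pick inequality and Hausdorff measure of curves\<close>

definition half_strip :: "complex set"
  where "half_strip = {s. 0 < Im s \<and> Im s < pi / 2}"

text \<open>The Schwarz lemma for the composition of \<open>F\<close> with conformal maps from the disc to the half strip and
  from the half-plane to the disc, which send \<open>0\<close> to \<open>s0\<close> and \<open>F s0\<close> to \<open>0\<close>.  In the middle of the half
  strip the first map has derivative \<open>1\<close> at \<open>0\<close>, and the second has a derivative of modulus
  \<open>1 / (2 Im (F s0))\<close>.  In the case of equality the composition is a rotation, and \<open>F\<close> is onto.\<close>
lemma
  assumes F: "F holomorphic_on half_strip" "\<And>s. s \<in> half_strip \<Longrightarrow> 0 < Im (F s)"
    and s0: "Im s0 = pi / 4"
  shows half_strip_schwarz_pick: "norm (deriv F s0) \<le> 2 * Im (F s0)"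
    and half_strip_schwarz_pick_eq:
      "norm (deriv F s0) = 2 * Im (F s0) \<Longrightarrow> {z. 0 < Im z} \<subseteq> F ` half_strip"
proof -
  let ?D = "ball (0 :: complex) 1"
  define w0 where "w0 = F s0"
  have s0h: "s0 \<in> half_strip"
    unfolding half_strip_def mem_Collect_eq s0 using pi_gt_zero by (intro conjI) linarith+
  have w0: "0 < Im w0" using F(2)[OF s0h] by (simp add: w0_def)
  define \<psi> where "\<psi> = (\<lambda>\<zeta>. s0 + strip_of_disc \<zeta> / 2)"
  have \<psi>h: "\<psi> \<zeta> \<in> half_strip" if "\<zeta> \<in> ?D" for \<zeta>
    using strip_of_disc_in_strip[OF that] s0 by (auto simp: \<psi>_def half_strip_def strip_def abs_less_iff)
  have \<psi>hol: "\<psi> holomorphic_on ?D"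
    unfolding \<psi>_def using holomorphic_strip_of_disc by (intro holomorphic_intros) auto
  have nz: "w - cnj w0 \<noteq> 0" if "0 < Im w" for w using that w0 by (auto simp: complex_eq_iff)
  define T where "T = (\<lambda>\<zeta>. (F (\<psi> \<zeta>) - w0) / (F (\<psi> \<zeta>) - cnj w0))"
  have less: "norm ((w - w0) / (w - cnj w0)) < 1" if "0 < Im w" for w
  proof -
    have "(Im w - Im w0)\<^sup>2 < (Im w + Im w0)\<^sup>2"
      using that w0 mult_pos_pos[OF that w0] by (simp add: power2_eq_square algebra_simps)
    then have "norm (w - w0) < norm (w - cnj w0)" by (simp add: cmod_def)
    then show ?thesis using nz[OF that] by (simp add: norm_divide)
  qed
  have FP: "(F \<circ> \<psi>) holomorphic_on ?D"
    by (rule holomorphic_on_compose_gen[OF \<psi>hol F(1) image_subsetI[OF \<psi>h]])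
  have Thol: "T holomorphic_on ?D"
    unfolding T_def using FP nz[OF F(2)[OF \<psi>h]] by (intro holomorphic_intros) (auto simp: o_def)
  have T0: "T 0 = 0" by (simp add: T_def \<psi>_def w0_def)
  have T1: "norm (T \<zeta>) < 1" if "norm \<zeta> < 1" for \<zeta>
    using less[OF F(2)[OF \<psi>h, of \<zeta>]] that by (simp add: T_def)
  have oh: "open half_strip"
  proof -
    have e: "half_strip = {s. 0 < Im s} \<inter> {s. Im s < pi / 2}" by (auto simp: half_strip_def)
    show ?thesis unfolding e by (intro open_Int open_halfspace_Im_lt open_halfspace_Im_gt)
  qed
  have dT: "deriv T 0 = deriv F s0 / (w0 - cnj w0)"
  proof (rule DERIV_imp_deriv)
    have d1: "(\<psi> has_field_derivative 1) (at 0)"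
      unfolding \<psi>_def using strip_of_disc_derivative_0 by (auto intro!: derivative_eq_intros)
    have "(F has_field_derivative deriv F s0) (at (\<psi> 0))"
      using holomorphic_derivI[OF F(1) oh s0h] by (simp add: \<psi>_def)
    from DERIV_chain'[OF d1 this] have d2: "((\<lambda>\<zeta>. F (\<psi> \<zeta>)) has_field_derivative deriv F s0) (at 0)" by simp
    have n0: "w0 - cnj w0 \<noteq> 0" by (rule nz[OF w0])
    have p0: "F (\<psi> 0) = w0" by (simp add: \<psi>_def w0_def)
    show "(T has_field_derivative deriv F s0 / (w0 - cnj w0)) (at 0)"
    proof -
      have "((\<lambda>\<zeta>. F (\<psi> \<zeta>) - c) has_field_derivative deriv F s0) (at 0)" for c
        using DERIV_diff[OF d2 DERIV_const[of c]] by simp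
      from DERIV_divide[OF this[of w0] this[of "cnj w0"]] p0 n0 show ?thesis
        unfolding T_def by simp
    qed
  qed
  have "w0 - cnj w0 = 2 * \<i> * of_real (Im w0)" by (simp add: complex_eq_iff)
  then have nT: "norm (deriv T 0) = norm (deriv F s0) / (2 * Im w0)"
    using w0 unfolding dT by (simp add: norm_divide norm_mult)
  have "norm (deriv T 0) \<le> 1" by (rule Schwarz_Lemma(2)[OF Thol T0 T1, of 0]) auto
  then show "norm (deriv F s0) \<le> 2 * Im (F s0)" using w0 nT by (simp add: w0_def divide_le_eq)
  assume "norm (deriv F s0) = 2 * Im (F s0)"
  then have "norm (deriv T 0) = 1" using nT w0 by (simp add: w0_def)
  then obtain \<alpha> where \<alpha>: "\<forall>z. norm z < 1 \<longrightarrow> T z = \<alpha> * z" "norm \<alpha> = 1"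
    using Schwarz_Lemma(3)[OF Thol T0 T1, of 0] by auto
  show "{z. 0 < Im z} \<subseteq> F ` half_strip"
  proof
    fix w assume "w \<in> {z. 0 < Im z}"
    then have w: "0 < Im w" by simp
    define t where "t = (w - w0) / (w - cnj w0)"
    have "norm t < 1" using less[OF w] by (simp only: t_def)
    then have t: "norm (t / \<alpha>) < 1" using \<alpha>(2) by (simp add: norm_divide)
    have "\<alpha> \<noteq> 0" using \<alpha>(2) by auto
    then have "T (t / \<alpha>) = t" using \<alpha>(1) t by simp
    define u where "u = F (\<psi> (t / \<alpha>))"
    have hs: "\<psi> (t / \<alpha>) \<in> half_strip" using \<psi>h t by simp
    have u: "0 < Im u" using F(2)[OF hs] by (simp add: u_def)
    have "(u - w0) / (u - cnj w0) = (w - w0) / (w - cnj w0)"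
      using \<open>T (t / \<alpha>) = t\<close> by (simp add: T_def u_def t_def)
    then have "(u - w0) * (w - cnj w0) = (w - w0) * (u - cnj w0)"
      using nz[OF u] nz[OF w] by (simp add: frac_eq_eq)
    then have "(u - w) * (w0 - cnj w0) = 0" by (simp add: algebra_simps)
    then have "u = w" using nz[OF w0] by simp
    then show "w \<in> F ` half_strip" using hs by (auto simp: u_def)
  qed
qed

text \<open>Cut the interval \<open>[A, B]\<close> into \<open>N\<close> equal pieces, and cover the curve by the \<open>N\<close> sets of points whose
  parameters have their value of \<open>\<Phi>\<close> in one of the pieces.\<close>
lemma hausdorff1_le_variation:
  fixes c :: "real \<Rightarrow> 'a::real_normed_vector" and \<Phi> :: "real \<Rightarrow> real"
  assumes d: "\<And>x y. x \<le> y \<Longrightarrow> dist (c x) (c y) \<le> \<Phi> y - \<Phi> x"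
    and b: "\<And>x. A \<le> \<Phi> x" "\<And>x. \<Phi> x \<le> B"
  shows "hausdorff1 (range c) \<le> ennreal (B - A)"
  unfolding hausdorff1_def
proof (rule SUP_least)
  fix \<delta> :: real assume "\<delta> \<in> {0<..}"
  then have \<delta>: "0 < \<delta>" by simp
  have AB: "A \<le> B" using b[of 0] by linarith
  obtain N :: nat where N: "(B - A) / \<delta> < real N" using reals_Archimedean2 by blast
  have N0: "0 < N" using N AB \<delta> by (metis divide_nonneg_pos diff_ge_0_iff_ge not_less of_nat_0 gr0I)
  define h where "h = (B - A) / real N"
  have h: "0 \<le> h" "h \<le> \<delta>" "real N * h = B - A" using AB N0 N \<delta> by (auto simp: h_def field_simps)
  define C where "C = (\<lambda>n. if n < N then c ` {x. A + real n * h \<le> \<Phi> x \<and> \<Phi> x \<le> A + real (Suc n) * h} else {})"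
  have cd: "dist p q \<le> h" if pq: "p \<in> C n" "q \<in> C n" for p q n
  proof -
    have "n < N" using pq by (auto simp: C_def split: if_splits)
    then obtain x y where xy: "p = c x" "q = c y" "A + real n * h \<le> \<Phi> x" "\<Phi> x \<le> A + real (Suc n) * h"
      "A + real n * h \<le> \<Phi> y" "\<Phi> y \<le> A + real (Suc n) * h" using pq by (auto simp: C_def)
    have "real (Suc n) * h = real n * h + h" by (simp add: algebra_simps)
    then show ?thesis using d[of x y] d[of y x] xy by (cases "x \<le> y") (auto simp: dist_commute)
  qed
  have diam: "diameter (C n) \<le> h" for n using cd h(1) by (intro diameter_le) (auto simp: dist_norm)
  have bd: "bounded (C n)" for n
    using cd unfolding bounded_two_points by blast
  have cover: "range c \<subseteq> (\<Union>n. C n)"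
  proof
    fix p assume "p \<in> range c"
    then obtain x where x: "p = c x" by blast
    have "\<exists>n<N. A + real n * h \<le> \<Phi> x \<and> \<Phi> x \<le> A + real (Suc n) * h"
    proof -
      have "\<Phi> x \<le> A + real (Suc (N - 1)) * h" using b(2)[of x] h(3) N0 by simp
      then have ex: "\<exists>n. \<Phi> x \<le> A + real (Suc n) * h" by blast
      (* The first piece that reaches up to the value of Phi also begins below it. *)
      define n where "n = (LEAST n. \<Phi> x \<le> A + real (Suc n) * h)"
      have n: "\<Phi> x \<le> A + real (Suc n) * h" unfolding n_def by (rule LeastI_ex[OF ex])
      have "n \<le> N - 1" unfolding n_def by (rule Least_le) fact
      moreover have "A + real n * h \<le> \<Phi> x"
      proof (cases n)
        case 0 then show ?thesis using b(1)[of x] by simp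
      next
        case (Suc k)
        then have "\<not> \<Phi> x \<le> A + real (Suc k) * h" using not_less_Least[of k "\<lambda>n. \<Phi> x \<le> A + real (Suc n) * h"] by (simp add: n_def)
        then show ?thesis using Suc by simp
      qed
      ultimately show ?thesis using n N0 by (intro exI[of _ n]) auto
    qed
    then show "p \<in> (\<Union>n. C n)" using x by (auto simp: C_def)
  qed
  have "hausdorff1_content \<delta> (range c) \<le> (\<Sum>n. ennreal (diameter (C n)))"
    unfolding hausdorff1_content_def
    using cover bd diam h(2) by (intro INF_lower) (auto intro: order_trans)
  also have "\<dots> = (\<Sum>n<N. ennreal (diameter (C n)))"
    by (intro suminf_finite) (auto simp: C_def)
  also have "\<dots> \<le> (\<Sum>n<N. ennreal h)" using diam by (intro sum_mono ennreal_leI) auto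
  also have "\<dots> = ennreal (B - A)" using h by (simp add: ennreal_of_nat_eq_real_of_nat flip: ennreal_mult)
  finally show "hausdorff1_content \<delta> (range c) \<le> ennreal (B - A)" .
qed

lemma hausdorff1_empty: "hausdorff1 {} = 0"
proof -
  have "hausdorff1_content \<delta> ({} :: 'a set) \<le> 0" if "0 < \<delta>" for \<delta>
    unfolding hausdorff1_content_def
    by (rule INF_lower2[of "\<lambda>_. {}"]) (use that in auto)
  then have "hausdorff1 ({} :: 'a set) \<le> 0" unfolding hausdorff1_def by (intro SUP_least) auto
  then show ?thesis by simp
qed

text \<open>The chord is \<open>2 sin t\<close> with \<open>t\<close> half the angle, and \<open>sin t \<ge> t cos (\<eta>/2)\<close> by the mean value theorem.\<close>
lemma arc_le_chord:
  assumes "0 < \<eta>" "\<eta> < pi" "\<theta> \<in> {0<..<pi}" "\<phi> \<in> {0<..<pi}" "dist (cis \<theta>) (cis \<phi>) \<le> 2 * sin (\<eta> / 2)"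
  shows "\<bar>\<theta> - \<phi>\<bar> * cos (\<eta> / 2) \<le> dist (cis \<theta>) (cis \<phi>)"
proof -
  define t where "t = \<bar>\<theta> - \<phi>\<bar> / 2"
  have t: "0 \<le> t" "t < pi / 2" using assms by (auto simp: t_def)
  have ch: "dist (cis \<theta>) (cis \<phi>) = 2 * sin t"
  proof -
    have "(dist (cis \<theta>) (cis \<phi>))\<^sup>2 = (cos \<theta> - cos \<phi>)\<^sup>2 + (sin \<theta> - sin \<phi>)\<^sup>2"
      by (simp add: dist_norm cmod_power2)
    also have "\<dots> = 2 - 2 * cos (\<theta> - \<phi>)"
      unfolding cos_diff power2_diff cos_squared_eq[of \<theta>] cos_squared_eq[of \<phi>]
      by (simp add: algebra_simps)
    also have "cos (\<theta> - \<phi>) = cos (2 * t)" by (simp add: t_def abs_if cos_diff mult.commute)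
    also have "2 - 2 * cos (2 * t) = (2 * sin t)\<^sup>2" by (simp add: cos_double_sin power_mult_distrib)
    finally show ?thesis by (rule power2_eq_imp_eq) (use t sin_ge_zero[of t] in auto)
  qed
  then have "sin t \<le> sin (\<eta> / 2)" using assms(5) by simp
  then have te: "t \<le> \<eta> / 2" using t assms by (subst (asm) sin_mono_le_eq) auto
  have "t * cos (\<eta> / 2) \<le> sin t"
  proof (cases "t = 0")
    case False
    then have "0 < t" using t by simp
    then obtain z where z: "0 < z" "z < t" "sin t - sin 0 = (t - 0) * cos z"
      using MVT2[of 0 t sin cos] by auto
    have "cos (\<eta> / 2) \<le> cos z" using z te assms by (intro cos_monotone_0_pi_le) auto
    then have "t * cos (\<eta> / 2) \<le> t * cos z" using t by (intro mult_left_mono) auto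
    then show ?thesis using z by simp
  qed simp
  then show ?thesis using ch by (simp add: t_def)
qed

text \<open>A cover of the semicircle by sets of small diameter gives a cover of \<open>(0, \<pi>)\<close> by intervals that are
  longer at most by the factor \<open>1 / cos (\<eta>/2)\<close>.  Lebesgue measure bounds the sum of their lengths
  from below.\<close>
lemma hausdorff1_semicircle_ge: "ennreal pi \<le> hausdorff1 (cis ` {0<..<pi})"
proof -
  have *: "ennreal (pi * cos (\<eta> / 2)) \<le> hausdorff1 (cis ` {0<..<pi})" if \<eta>: "0 < \<eta>" "\<eta> < pi" for \<eta>
  proof -
    define k where "k = cos (\<eta> / 2)"
    have k: "0 < k" using \<eta> by (auto simp: k_def intro!: cos_gt_zero)
    define \<delta> where "\<delta> = 2 * sin (\<eta> / 2)"
    have \<delta>: "0 < \<delta>" using \<eta> by (auto simp: \<delta>_def intro!: sin_gt_zero)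
    have "ennreal (pi * k) \<le> hausdorff1_content \<delta> (cis ` {0<..<pi})"
      unfolding hausdorff1_content_def
    proof (rule INF_greatest)
      fix C :: "nat \<Rightarrow> complex set"
      assume "C \<in> {C. cis ` {0<..<pi} \<subseteq> (\<Union>n. C n) \<and> (\<forall>n. bounded (C n) \<and> diameter (C n) \<le> \<delta>)}"
      then have C: "cis ` {0<..<pi} \<subseteq> (\<Union>n. C n)" "\<And>n. bounded (C n)" "\<And>n. diameter (C n) \<le> \<delta>" by auto
      define T where "T = (\<lambda>n. {\<theta> \<in> {0<..<pi}. cis \<theta> \<in> C n})"
      define E where "E = (\<lambda>n. {Inf (T n)..Inf (T n) + diameter (C n) / k})"
      have TE: "T n \<subseteq> E n" for n
      proof
        fix \<theta> assume \<theta>: "\<theta> \<in> T n"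
        have bdd: "bdd_below (T n)" by (rule bdd_belowI[of _ 0]) (auto simp: T_def)
        have "\<theta> - diameter (C n) / k \<le> Inf (T n)"
        proof (rule cInf_greatest)
          show "T n \<noteq> {}" using \<theta> by auto
          fix \<phi> assume \<phi>: "\<phi> \<in> T n"
          have dd: "dist (cis \<theta>) (cis \<phi>) \<le> diameter (C n)"
            using \<theta> \<phi> C(2) by (intro diameter_bounded_bound) (auto simp: T_def)
          have "\<bar>\<theta> - \<phi>\<bar> * k \<le> dist (cis \<theta>) (cis \<phi>)"
            unfolding k_def using \<theta> \<phi> \<eta> dd C(3)[of n] by (intro arc_le_chord) (auto simp: T_def \<delta>_def)
          then have "\<bar>\<theta> - \<phi>\<bar> \<le> diameter (C n) / k" using dd k by (simp add: le_divide_eq)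
          then show "\<theta> - diameter (C n) / k \<le> \<phi>" by linarith
        qed
        moreover have "Inf (T n) \<le> \<theta>" using \<theta> bdd by (rule cInf_lower)
        ultimately show "\<theta> \<in> E n" by (simp add: E_def)
      qed
      have "ennreal pi = emeasure lborel {0<..<pi}" by simp
      also have "\<dots> \<le> emeasure lborel (\<Union>n. E n)"
      proof (rule emeasure_mono)
        show "{0<..<pi} \<subseteq> (\<Union>n. E n)"
        proof
          fix \<theta> assume "\<theta> \<in> {0<..<pi}"
          moreover from this obtain n where "cis \<theta> \<in> C n" using C(1) by blast
          ultimately have "\<theta> \<in> T n" by (simp add: T_def)
          then show "\<theta> \<in> (\<Union>n. E n)" using TE by blast
        qed
      qed (auto simp: E_def)
      also have "\<dots> \<le> (\<Sum>n. emeasure lborel (E n))"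
        by (intro emeasure_subadditive_countably) (auto simp: E_def)
      also have "\<dots> = (\<Sum>n. ennreal (1 / k) * ennreal (diameter (C n)))"
      proof -
        have "emeasure lborel (E n) = ennreal (1 / k) * ennreal (diameter (C n))" for n
          using k diameter_ge_0[OF C(2)[of n]] by (simp add: E_def flip: ennreal_mult)
        then show ?thesis by simp
      qed
      also have "\<dots> = ennreal (1 / k) * (\<Sum>n. ennreal (diameter (C n)))" by simp
      finally have "ennreal k * ennreal pi \<le> ennreal k * (ennreal (1 / k) * (\<Sum>n. ennreal (diameter (C n))))"
        by (intro mult_left_mono) auto
      also have "\<dots> = (\<Sum>n. ennreal (diameter (C n)))"
        using k by (simp add: mult.assoc[symmetric] flip: ennreal_mult)
      also have "ennreal k * ennreal pi = ennreal (pi * k)" using k by (simp add: mult.commute flip: ennreal_mult)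
      finally show "ennreal (pi * k) \<le> (\<Sum>n. ennreal (diameter (C n)))" .
    qed
    also have "\<dots> \<le> hausdorff1 (cis ` {0<..<pi})"
      unfolding hausdorff1_def using \<delta> by (intro SUP_upper) auto
    finally show ?thesis by (simp add: k_def)
  qed
  have "((\<lambda>\<eta>. ennreal (pi * cos (\<eta> / 2))) \<longlongrightarrow> ennreal (pi * cos (0 / 2))) (at_right 0)"
    by (intro tendsto_intros) auto
  then have "((\<lambda>\<eta>. ennreal (pi * cos (\<eta> / 2))) \<longlongrightarrow> ennreal pi) (at_right 0)" by simp
  moreover have "\<forall>\<^sub>F \<eta> in at_right 0. ennreal (pi * cos (\<eta> / 2)) \<le> hausdorff1 (cis ` {0<..<pi})"
    using eventually_at_right_less[of "0::real"] eventually_at_right_real[OF pi_gt_zero]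
    by eventually_elim (use * in auto)
  ultimately show ?thesis using tendsto_upperbound by (metis trivial_limit_at_right_real)
qed

section \<open>Length of the level curve\<close>

context strip_map
begin

lemma half_strip_subset: "half_strip \<subseteq> strip"
  by (auto simp: half_strip_def strip_def)

lemma level_point_strip: "Complex x y \<in> strip \<longleftrightarrow> \<bar>y\<bar> < pi / 2"
  by (simp add: strip_def)

lemma quarter_strip: "0 \<le> y \<Longrightarrow> y \<le> pi / 4 \<Longrightarrow> Complex x y \<in> strip"
  unfolding level_point_strip using pi_gt_zero by linarith

lemma schwarz_pick: "norm (deriv g (Complex x (pi / 4))) \<le> 2 * Im (g (Complex x (pi / 4)))"
  and schwarz_pick_strict:
    "U \<noteq> {z. 0 < Im z} \<Longrightarrow> norm (deriv g (Complex x (pi / 4))) < 2 * Im (g (Complex x (pi / 4)))"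
proof -
  have h: "g holomorphic_on half_strip" using holg half_strip_subset by (rule holomorphic_on_subset)
  have gU: "g s \<in> U" if "s \<in> half_strip" for s
    using that half_strip_subset by (intro g_in_U) (auto simp: half_strip_def)
  then have p: "0 < Im (g s)" if "s \<in> half_strip" for s using that upper by blast
  show le: "norm (deriv g (Complex x (pi / 4))) \<le> 2 * Im (g (Complex x (pi / 4)))"
    by (rule half_strip_schwarz_pick[OF h p]) auto
  assume "U \<noteq> {z. 0 < Im z}"
  then have "\<not> {z. 0 < Im z} \<subseteq> g ` half_strip" using gU upper by blast
  then have "norm (deriv g (Complex x (pi / 4))) \<noteq> 2 * Im (g (Complex x (pi / 4)))"
    using half_strip_schwarz_pick_eq[OF h p, of "Complex x (pi / 4)"] by auto
  with le show "norm (deriv g (Complex x (pi / 4))) < 2 * Im (g (Complex x (pi / 4)))" by simp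
qed

text \<open>Only differences of values of \<open>Q\<close> are used, so that the choice of the primitive does not matter.\<close>
definition Q :: "complex \<Rightarrow> complex"
  where "Q = (SOME Q. \<forall>s\<in>strip. (Q has_field_derivative g s) (at s))"

lemma Q_deriv: "s \<in> strip \<Longrightarrow> (Q has_field_derivative g s) (at s)"
proof -
  obtain Q0 where "\<And>s. s \<in> strip \<Longrightarrow> (Q0 has_field_derivative g s) (at s within strip)"
    using holomorphic_convex_primitive'[OF convex_strip open_strip holg] by blast
  then have "\<forall>s\<in>strip. (Q0 has_field_derivative g s) (at s)"
    using at_within_open[OF _ open_strip] by simp
  then have "\<forall>s\<in>strip. (Q has_field_derivative g s) (at s)"
    unfolding Q_def by (rule someI[where P = "\<lambda>Q. \<forall>s\<in>strip. (Q has_field_derivative g s) (at s)"])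
  then show "s \<in> strip \<Longrightarrow> (Q has_field_derivative g s) (at s)" by blast
qed

text \<open>As \<open>g\<close> is real on the real axis, subtracting the value of \<open>Q\<close> there does not change the derivative
  \<open>2 Im g (x + i\<pi>/4)\<close>; it turns \<open>\<Phi>\<close> into a vertical increment of \<open>Q\<close>, whose limits for \<open>x \<rightarrow> \<plusminus>\<infinity>\<close> are
  known.\<close>
definition \<Phi> :: "real \<Rightarrow> real"
  where "\<Phi> x = 2 * (Im (Q (Complex x (pi / 4))) - Im (Q (Complex x 0)))"

lemma horizontal_derivative:
  assumes "\<bar>y\<bar> < pi / 2" "(f has_field_derivative D) (at (Complex x y))"
  shows "((\<lambda>x. f (Complex x y)) has_vector_derivative D) (at x)"
proof -
  have "((\<lambda>x. Complex x y) has_vector_derivative 1) (at x)"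
    unfolding Complex_eq by (auto intro!: derivative_eq_intros)
  from field_vector_diff_chain_at[OF this assms(2)] show ?thesis by (simp add: o_def)
qed

lemma \<Phi>_deriv: "(\<Phi> has_vector_derivative 2 * Im (g (Complex x (pi / 4)))) (at x)"
proof -
  have 1: "((\<lambda>x. Im (Q (Complex x y))) has_vector_derivative Im (g (Complex x y))) (at x)"
    if "\<bar>y\<bar> < pi / 2" for y
    by (rule bounded_linear.has_vector_derivative[OF bounded_linear_Im horizontal_derivative[OF that Q_deriv]])
       (use that in \<open>simp add: level_point_strip\<close>)
  have "Im (g (Complex x 0)) = 0" using Im_g_eq_0_iff[of "Complex x 0"] by (simp add: level_point_strip)
  moreover have "(\<Phi> has_vector_derivative 2 * (Im (g (Complex x (pi / 4))) - Im (g (Complex x 0)))) (at x)"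
    unfolding \<Phi>_def by (intro has_vector_derivative_mult_right has_vector_derivative_diff 1) auto
  ultimately show ?thesis by simp
qed

text \<open>The mean value theorem on the vertical segment, along which \<open>Im Q\<close> has the derivative \<open>Re g\<close>.\<close>
lemma \<Phi>_eq:
  obtains y where "0 < y" "y < pi / 4" "\<Phi> x = pi / 2 * Re (g (Complex x y))"
proof -
  have d: "((\<lambda>y. Im (Q (Complex x y))) has_real_derivative Re (g (Complex x y))) (at y)"
    if "0 \<le> y" "y \<le> pi / 4" for y
  proof -
    have "((\<lambda>y. Complex x y) has_vector_derivative \<i>) (at y)"
      unfolding Complex_eq by (auto intro!: derivative_eq_intros)
    from field_vector_diff_chain_at[OF this Q_deriv[OF quarter_strip[OF that]]]
    have "((\<lambda>y. Q (Complex x y)) has_vector_derivative \<i> * g (Complex x y)) (at y)" by (simp add: o_def)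
    from bounded_linear.has_vector_derivative[OF bounded_linear_Im this]
    show ?thesis by (simp add: has_real_derivative_iff_has_vector_derivative)
  qed
  obtain y where y: "0 < y" "y < pi / 4"
    "Im (Q (Complex x (pi / 4))) - Im (Q (Complex x 0)) = (pi / 4 - 0) * Re (g (Complex x y))"
    using MVT2[of 0 "pi / 4" "\<lambda>y. Im (Q (Complex x y))" "\<lambda>y. Re (g (Complex x y))"] d by auto
  show thesis by (rule that[OF y(1,2)]) (use y(3) in \<open>simp add: \<Phi>_def\<close>)
qed

text \<open>A positive margin \<open>k\<close> in the Schwarz-Pick inequality is a gain in length; the case \<open>k = 0\<close> is the plain
  estimate.\<close>
lemma curve_dist_le:
  assumes "x \<le> y" "\<And>t. x \<le> t \<Longrightarrow> t \<le> y \<Longrightarrow> norm (deriv g (Complex t (pi / 4))) \<le> 2 * Im (g (Complex t (pi / 4))) - k"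
  shows "dist (g (Complex x (pi / 4))) (g (Complex y (pi / 4))) \<le> (\<Phi> y - k * y) - (\<Phi> x - k * x)"
proof (cases "x = y")
  case False
  then have xy: "x < y" using assms by simp
  have dg: "((\<lambda>x. g (Complex x (pi / 4))) has_vector_derivative deriv g (Complex t (pi / 4))) (at t)" for t
    by (rule horizontal_derivative)
       (auto intro!: holomorphic_derivI[OF holg open_strip] simp: level_point_strip)
  have dP: "((\<lambda>x. \<Phi> x - k * x) has_vector_derivative 2 * Im (g (Complex t (pi / 4))) - k) (at t)" for t
  proof -
    have "((\<lambda>x. k * x) has_vector_derivative k) (at t)"
      using has_vector_derivative_mult_right[OF has_vector_derivative_id, of k "at t"] by simp
    from has_vector_derivative_diff[OF \<Phi>_deriv this] show ?thesis .
  qed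
  have "norm (g (Complex y (pi / 4)) - g (Complex x (pi / 4))) \<le> (\<Phi> y - k * y) - (\<Phi> x - k * x)"
  proof (rule differentiable_bound_general[OF xy _ _ dg dP])
    show "continuous_on {x..y} (\<lambda>x. g (Complex x (pi / 4)))"
      using has_vector_derivative_continuous[OF dg] by (intro continuous_at_imp_continuous_on ballI)
    show "continuous_on {x..y} (\<lambda>x. \<Phi> x - k * x)"
      using has_vector_derivative_continuous[OF dP] by (intro continuous_at_imp_continuous_on ballI)
    show "norm (deriv g (Complex t (pi / 4))) \<le> 2 * Im (g (Complex t (pi / 4))) - k" if "x < t" "t < y" for t
      using assms(2)[of t] that by simp
  qed
  then show ?thesis by (simp add: dist_norm norm_minus_commute)
qed simp

lemma \<Phi>_near_b: "0 < e \<Longrightarrow> \<exists>X. \<forall>x\<ge>X. \<Phi> x \<le> pi / 2 * b + e"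
proof -
  assume e: "0 < e"
  have p: "0 < pi / 4" "pi / 4 \<le> pi / 2" using pi_gt_zero by auto
  obtain X where X: "\<And>s. \<bar>Im s\<bar> \<le> pi / 2 - pi / 4 \<Longrightarrow> X \<le> Re s \<Longrightarrow> dist (g s) (of_real b) < e / 2"
    using g_limit_right[OF p, of "e / 2"] e by auto
  have "\<Phi> x \<le> pi / 2 * b + e" if x: "X \<le> x" for x
  proof -
    obtain y where y: "0 < y" "y < pi / 4" "\<Phi> x = pi / 2 * Re (g (Complex x y))" by (rule \<Phi>_eq)
    have "dist (g (Complex x y)) (of_real b) < e / 2" using X[of "Complex x y"] y x by simp
    then have "Re (g (Complex x y)) \<le> b + e / 2"
      using complex_Re_le_cmod[of "g (Complex x y) - of_real b"] by (simp add: dist_norm)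
    then have "\<Phi> x \<le> pi / 2 * (b + e / 2)" unfolding y(3) by (intro mult_left_mono) auto
    also have "\<dots> = pi / 2 * b + pi / 4 * e" by (simp add: algebra_simps)
    also have "pi / 4 * e \<le> 1 * e" using e pi_less_4 by (intro mult_right_mono) auto
    finally show ?thesis by simp
  qed
  then show "\<exists>X. \<forall>x\<ge>X. \<Phi> x \<le> pi / 2 * b + e" by blast
qed

lemma \<Phi>_near_a: "0 < e \<Longrightarrow> \<exists>X. \<forall>x\<le>X. pi / 2 * a - e \<le> \<Phi> x"
proof -
  assume e: "0 < e"
  have p: "0 < pi / 4" "pi / 4 \<le> pi / 2" using pi_gt_zero by auto
  obtain X where X: "\<And>s. \<bar>Im s\<bar> \<le> pi / 2 - pi / 4 \<Longrightarrow> Re s \<le> X \<Longrightarrow> dist (g s) (of_real a) < e / 2"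
    using g_limit_left[OF p, of "e / 2"] e by auto
  have "pi / 2 * a - e \<le> \<Phi> x" if x: "x \<le> X" for x
  proof -
    obtain y where y: "0 < y" "y < pi / 4" "\<Phi> x = pi / 2 * Re (g (Complex x y))" by (rule \<Phi>_eq)
    have "dist (g (Complex x y)) (of_real a) < e / 2" using X[of "Complex x y"] y x by simp
    then have "a - e / 2 \<le> Re (g (Complex x y))"
      using complex_Re_le_cmod[of "of_real a - g (Complex x y)"] by (simp add: dist_norm norm_minus_commute)
    then have "pi / 2 * (a - e / 2) \<le> \<Phi> x" unfolding y(3) by (intro mult_left_mono) auto
    moreover have "pi / 2 * (a - e / 2) = pi / 2 * a - pi / 4 * e" by (simp add: algebra_simps)
    moreover have "pi / 4 * e \<le> 1 * e" using e pi_less_4 by (intro mult_right_mono) auto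
    ultimately show ?thesis by linarith
  qed
  then show "\<exists>X. \<forall>x\<le>X. pi / 2 * a - e \<le> \<Phi> x" by blast
qed

text \<open>\<open>\<Phi>\<close> dominates the length of the curve and stays between its limits \<open>\<pi>/2 a\<close> and \<open>\<pi>/2 b\<close>.  If \<open>U\<close> is not
  the half-plane, compactness gives a uniform margin \<open>k > 0\<close> in the Schwarz-Pick inequality over the
  parameters in \<open>[0, 1]\<close>.  Then \<open>\<Phi>\<close> minus \<open>k\<close> times the truncation of \<open>x\<close> to \<open>[0, 1]\<close> still dominates the
  length, and its variation is smaller by \<open>k\<close>.\<close>
lemma hausdorff1_level_curve_le:
  "hausdorff1 (range (\<lambda>x. g (Complex x (pi / 4)))) \<le> ennreal (pi / 2 * (b - a))"
  and hausdorff1_level_curve_less: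
  "U \<noteq> {z. 0 < Im z} \<Longrightarrow> hausdorff1 (range (\<lambda>x. g (Complex x (pi / 4)))) < ennreal (pi / 2 * (b - a))"
proof -
  let ?c = "\<lambda>x. g (Complex x (pi / 4))"
  have dist_le: "dist (?c x) (?c y) \<le> \<Phi> y - \<Phi> x" if "x \<le> y" for x y
    using curve_dist_le[OF that, of 0] schwarz_pick by simp
  have lower: "pi / 2 * a \<le> \<Phi> x" for x
  proof (rule field_le_epsilon)
    fix e :: real assume "0 < e"
    then obtain X where "\<forall>x\<le>X. pi / 2 * a - e \<le> \<Phi> x" using \<Phi>_near_a by blast
    then have "pi / 2 * a - e \<le> \<Phi> (min X x)" by simp
    moreover have "0 \<le> \<Phi> x - \<Phi> (min X x)" by (rule order_trans[OF zero_le_dist dist_le]) simp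
    ultimately show "pi / 2 * a \<le> \<Phi> x + e" by simp
  qed
  have upper: "\<Phi> x \<le> pi / 2 * b" for x
  proof (rule field_le_epsilon)
    fix e :: real assume "0 < e"
    then obtain X where "\<forall>x\<ge>X. \<Phi> x \<le> pi / 2 * b + e" using \<Phi>_near_b by blast
    then have "\<Phi> (max X x) \<le> pi / 2 * b + e" by simp
    moreover have "0 \<le> \<Phi> (max X x) - \<Phi> x" by (rule order_trans[OF zero_le_dist dist_le]) simp
    ultimately show "\<Phi> x \<le> pi / 2 * b + e" by simp
  qed
  have "hausdorff1 (range ?c) \<le> ennreal (pi / 2 * b - pi / 2 * a)"
    by (rule hausdorff1_le_variation[OF dist_le lower upper])
  then show "hausdorff1 (range ?c) \<le> ennreal (pi / 2 * (b - a))" by (simp add: right_diff_distrib)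
  assume U: "U \<noteq> {z. 0 < Im z}"
  have "\<exists>k>0. \<forall>t\<in>{0..1}. norm (deriv g (Complex t (pi / 4))) \<le> 2 * Im (?c t) - k"
  proof -
    have st: "Complex t (pi / 4) \<in> strip" for t by (simp add: level_point_strip)
    have cC: "continuous_on {0..1} (\<lambda>t. Complex t (pi / 4))"
      unfolding Complex_eq by (intro continuous_intros)
    have "continuous_on strip (deriv g)"
      using holomorphic_deriv[OF holg open_strip] by (rule holomorphic_on_imp_continuous_on)
    from continuous_on_compose2[OF this cC] continuous_on_compose2[OF continuous_on_g cC]
    have "continuous_on {0..1} (\<lambda>t. 2 * Im (?c t) - norm (deriv g (Complex t (pi / 4))))"
      using st by (intro continuous_intros) auto
    then obtain t0 where t0: "t0 \<in> {0..1}"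
      "\<forall>t\<in>{0..1}. 2 * Im (?c t0) - norm (deriv g (Complex t0 (pi / 4))) \<le> 2 * Im (?c t) - norm (deriv g (Complex t (pi / 4)))"
      using continuous_attains_inf[of "{0..1::real}" "\<lambda>t. 2 * Im (?c t) - norm (deriv g (Complex t (pi / 4)))"] by auto
    have "0 < 2 * Im (?c t0) - norm (deriv g (Complex t0 (pi / 4)))" using schwarz_pick_strict[OF U] by simp
    moreover have "norm (deriv g (Complex t (pi / 4))) \<le> 2 * Im (?c t) - (2 * Im (?c t0) - norm (deriv g (Complex t0 (pi / 4))))"
      if "t \<in> {0..1}" for t using t0(2)[rule_format, OF that] by linarith
    ultimately show ?thesis by blast
  qed
  then obtain k where k: "0 < k" "\<And>t. t \<in> {0..1} \<Longrightarrow> norm (deriv g (Complex t (pi / 4))) \<le> 2 * Im (?c t) - k" by blast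
  (* Truncation to [0, 1], the set of parameters where the margin k is available. *)
  define clamp where "clamp = (\<lambda>x::real. max 0 (min 1 x))"
  define \<Psi> where "\<Psi> = (\<lambda>x. \<Phi> x - k * clamp x)"
  have dist_le': "dist (?c x) (?c y) \<le> \<Psi> y - \<Psi> x" if xy: "x \<le> y" for x y
  proof -
    define u v where "u = min y (max x 0)" and "v = min y (max x 1)"
    have uv: "x \<le> u" "u \<le> v" "v \<le> y" using xy by (auto simp: u_def v_def)
    have cl: "clamp y - clamp x = v - u" using xy by (auto simp: u_def v_def clamp_def max_def min_def)
    have "dist (?c u) (?c v) \<le> (\<Phi> v - k * v) - (\<Phi> u - k * u)"
    proof (cases "u = v")
      case False
      then have "0 \<le> u" "v \<le> 1" using xy by (auto simp: u_def v_def max_def min_def split: if_splits)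
      then show ?thesis using k(2) by (intro curve_dist_le[OF uv(2)]) auto
    qed simp
    moreover have "dist (?c x) (?c u) \<le> \<Phi> u - \<Phi> x" "dist (?c v) (?c y) \<le> \<Phi> y - \<Phi> v"
      using dist_le uv by auto
    moreover have "dist (?c x) (?c y) \<le> dist (?c x) (?c u) + dist (?c u) (?c v) + dist (?c v) (?c y)"
      using dist_triangle[of "?c x" "?c y" "?c u"] dist_triangle[of "?c u" "?c y" "?c v"] by linarith
    ultimately have "dist (?c x) (?c y) \<le> \<Phi> y - \<Phi> x - k * (v - u)" by (simp add: algebra_simps)
    then show ?thesis unfolding \<Psi>_def cl[symmetric] by (simp add: algebra_simps)
  qed
  have mono: "\<Psi> x \<le> \<Psi> y" if "x \<le> y" for x y
    using order_trans[OF zero_le_dist dist_le'[OF that]] by simp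
  have lower': "pi / 2 * a \<le> \<Psi> x" for x
    using mono[of "min 0 x" x] lower[of "min 0 x"] by (simp add: \<Psi>_def clamp_def)
  have upper': "\<Psi> x \<le> pi / 2 * b - k" for x
    using mono[of x "max 1 x"] upper[of "max 1 x"] by (simp add: \<Psi>_def clamp_def)
  have "hausdorff1 (range ?c) \<le> ennreal (pi / 2 * b - k - pi / 2 * a)"
    by (rule hausdorff1_le_variation[OF dist_le' lower' upper'])
  also have "\<dots> < ennreal (pi / 2 * (b - a))"
  proof (rule ennreal_lessI)
    show "0 < pi / 2 * (b - a)" using ab by simp
    show "pi / 2 * b - k - pi / 2 * a < pi / 2 * (b - a)" unfolding right_diff_distrib using k(1) by linarith
  qed
  finally show "hausdorff1 (range ?c) < ennreal (pi / 2 * (b - a))" .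
qed

end

section \<open>The half-plane and the general domain\<close>

text \<open>In the half-plane the harmonic measure is \<open>1/\<pi>\<close> times the argument of \<open>(z - 1) / (z + 1)\<close>.  The factor
  \<open>-i\<close> moves the branch cut of the logarithm away from the closed half-plane and accounts for the
  summand \<open>1/2\<close>.  The level \<open>1/2\<close> consists of the points where the quotient is purely imaginary.\<close>
lemma level_set_upper_half_plane:
  "level_set {z. 0 < Im z} (1/2) = cis ` {0<..<pi}"
proof -
  define H where "H = {z :: complex. 0 < Im z}"
  define L where "L = (\<lambda>z :: complex. Ln (- \<i> * ((z - 1) / (z + 1))))"
  define h where "h = (\<lambda>z. 1/2 + 1 / pi * Im (L z))"
  have oH: "open H" by (simp add: H_def open_halfspace_Im_gt)
  have nz: "z + 1 \<noteq> 0" if "z \<in> H" for z using that by (auto simp: H_def complex_eq_iff)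
  have quot: "(z - 1) / (z + 1) = Complex ((norm z)\<^sup>2 - 1) (2 * Im z) / of_real ((norm (z + 1))\<^sup>2)"
    if "z + 1 \<noteq> 0" for z :: complex
  proof -
    have "(z - 1) * cnj (z + 1) = Complex ((norm z)\<^sup>2 - 1) (2 * Im z)"
      unfolding cmod_power2 by (simp add: complex_eq_iff power2_eq_square algebra_simps)
    moreover have "cnj (z + 1) \<noteq> 0" using that by (simp only: complex_cnj_zero_iff not_False_eq_True)
    then have "(z - 1) / (z + 1) = (z - 1) * cnj (z + 1) / ((z + 1) * cnj (z + 1))"
      by (rule nonzero_mult_divide_mult_cancel_right[symmetric])
    ultimately show ?thesis by (simp only: complex_norm_square)
  qed
  have pos: "0 < Re (- \<i> * ((z - 1) / (z + 1)))" if "z \<in> H" for z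
  proof -
    have "0 < (norm (z + 1))\<^sup>2" using nz[OF that] by simp
    then show ?thesis unfolding quot[OF nz[OF that]] using that by (simp add: H_def)
  qed
  have holL: "L holomorphic_on H"
    unfolding L_def using nz pos by (intro holomorphic_intros) (auto simp: complex_nonpos_Reals_iff dest: pos)
  have harm: "harmonic_on h H"
    unfolding h_def by (intro harmonic_on_add harmonic_on_const harmonic_on_cmult harmonic_on_Im holL)
  have bounds: "0 \<le> h z" "h z \<le> 1" if "z \<in> H" for z
    using Re_Ln_pos_lt_imp[OF pos[OF that]] by (auto simp: h_def L_def field_simps abs_less_iff)
  have lim: "((\<lambda>z. h z) \<longlongrightarrow> (if \<bar>x\<bar> < 1 then 1 else 0)) (at (of_real x) within H)" if x: "\<bar>x\<bar> \<noteq> 1" for x :: real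
  proof -
    define r where "r = (x - 1) / (x + 1)"
    have x1: "x + 1 \<noteq> 0" "x - 1 \<noteq> 0" using x by auto
    then have r0: "r \<noteq> 0" by (simp add: r_def)
    have xr: "(complex_of_real x - 1) / (of_real x + 1) = of_real r" by (simp add: r_def)
    have x1': "complex_of_real x + 1 \<noteq> 0" using x1(1) by (metis of_real_1 of_real_add of_real_eq_0_iff)
    have "((\<lambda>z. - \<i> * ((z - 1) / (z + 1))) \<longlongrightarrow> - \<i> * ((of_real x - 1) / (of_real x + 1))) (at (of_real x) within H)"
      using x1' by (intro tendsto_intros)
    then have "(L \<longlongrightarrow> Ln (- \<i> * of_real r)) (at (of_real x) within H)"
      unfolding L_def xr using r0 by (intro tendsto_Ln) (auto simp: complex_nonpos_Reals_iff)
    then have "(h \<longlongrightarrow> 1/2 + 1 / pi * Im (Ln (- \<i> * of_real r))) (at (of_real x) within H)"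
      unfolding h_def by (intro tendsto_intros)
    moreover have "1/2 + 1 / pi * Im (Ln (- \<i> * of_real r)) = (if \<bar>x\<bar> < 1 then 1 else 0)"
    proof (cases "\<bar>x\<bar> < 1")
      case True
      then have "r < 0" by (auto simp: r_def divide_less_0_iff)
      from Ln_i_times_real(4)[OF this] show ?thesis using True by simp
    next
      case False
      then have "0 < r" using x by (auto simp: r_def zero_less_divide_iff)
      from Ln_i_times_real(3)[OF this] show ?thesis using False by simp
    qed
    ultimately show ?thesis by simp
  qed
  have "harmonic_measure z open_interval H = h z" if z: "z \<in> H" for z
  proof (rule harmonic_measure_eqI[OF oH _ _ _ _ harm bounds _ _ _ z, of "-1" 1])
    show "limsup_le (\<lambda>z. - h z) H (Some (complex_of_real x)) (- 1)" if "- 1 < x" "x < 1" for x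
    proof -
      have x: "\<bar>x\<bar> < 1" using that by (simp add: abs_less_iff)
      then have "((\<lambda>z. h z) \<longlongrightarrow> 1) (at (of_real x) within H)" using lim[of x] by simp
      then have "((\<lambda>z. - h z) \<longlongrightarrow> - 1) (at (of_real x) within H)" by (rule tendsto_minus)
      then show ?thesis unfolding limsup_le_Some using order_tendstoD(2) by blast
    qed
    show "limsup_le h H \<zeta> 0" if \<zeta>: "\<zeta> \<in> sphere_boundary H" "\<zeta> \<notin> closed_interval" for \<zeta>
    proof (cases \<zeta>)
      case (Some c)
      have "c \<in> frontier H" using \<zeta>(1) oH Some by (auto simp: sphere_boundary_eq split: if_splits)
      then have "c \<in> closure H" "c \<notin> H" using oH by (auto simp: frontier_def interior_open)
      moreover have "closure H \<subseteq> {z. 0 \<le> Im z}"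
        by (intro closure_minimal) (auto simp: H_def closed_halfspace_Im_ge)
      ultimately have "Im c = 0" by (force simp: H_def)
      then have c: "c = of_real (Re c)" by (simp add: complex_eq_iff)
      then have "Re c \<notin> {-1..1}" using \<zeta>(2) Some in_closed_interval[of "Re c"] by simp
      then have "(h \<longlongrightarrow> 0) (at c within H)" using lim[of "Re c"] c by (auto simp: abs_if split: if_splits)
      then show ?thesis unfolding Some limsup_le_Some using order_tendstoD(2) by blast
    next
      case None
      have "filterlim (\<lambda>z :: complex. z + 1) at_infinity at_infinity"
        by (rule tendsto_add_filterlim_at_infinity'[OF filterlim_ident tendsto_const])
      then have "((\<lambda>z :: complex. 2 / (z + 1)) \<longlongrightarrow> 0) at_infinity"
        by (rule tendsto_divide_0[OF tendsto_const])
      then have "((\<lambda>z :: complex. 1 - 2 / (z + 1)) \<longlongrightarrow> 1 - 0) at_infinity"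
        by (intro tendsto_diff tendsto_const)
      then have "((\<lambda>z :: complex. - \<i> * (1 - 2 / (z + 1))) \<longlongrightarrow> - \<i> * (1 - 0)) at_infinity"
        by (rule tendsto_mult[OF tendsto_const])
      then have "((\<lambda>z :: complex. Ln (- \<i> * (1 - 2 / (z + 1)))) \<longlongrightarrow> Ln (- \<i> * (1 - 0))) at_infinity"
        by (rule tendsto_Ln) (auto simp: complex_nonpos_Reals_iff)
      then have "((\<lambda>z :: complex. 1/2 + 1 / pi * Im (Ln (- \<i> * (1 - 2 / (z + 1))))) \<longlongrightarrow>
          1/2 + 1 / pi * Im (Ln (- \<i> * (1 - 0)))) at_infinity"
        by (rule tendsto_add[OF tendsto_const tendsto_mult[OF tendsto_const tendsto_Im]])
      then have t: "((\<lambda>z :: complex. 1/2 + 1 / pi * Im (Ln (- \<i> * (1 - 2 / (z + 1))))) \<longlongrightarrow> 0) at_infinity"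
        by simp
      have eq: "h z = 1/2 + 1 / pi * Im (Ln (- \<i> * (1 - 2 / (z + 1))))" if "z \<in> H" for z
      proof -
        have "(z - 1) / (z + 1) = 1 - 2 / (z + 1)" using nz[OF that] by (simp add: field_simps)
        then show ?thesis by (simp only: h_def L_def)
      qed
      show ?thesis unfolding None limsup_le_None
      proof safe
        fix y :: real assume "0 < y"
        from order_tendstoD(2)[OF t this] obtain B where
          B: "\<And>z. B \<le> norm z \<Longrightarrow> 1/2 + 1 / pi * Im (Ln (- \<i> * (1 - 2 / (z + 1)))) < y"
          unfolding eventually_at_infinity by blast
        have "\<forall>z\<in>H. B < norm z \<longrightarrow> h z < y" using B eq by simp
        then show "\<exists>B. \<forall>z\<in>H. B < norm z \<longrightarrow> h z < y" by blast
      qed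
    qed
  qed (auto simp: H_def)
  then have "level_set H (1/2) = {z \<in> H. h z = 1/2}" by (auto simp: level_set_def)
  also have "\<dots> = {z \<in> H. norm z = 1}"
  proof -
    have "h z = 1/2 \<longleftrightarrow> norm z = 1" if z: "z \<in> H" for z
    proof -
      define w where "w = - \<i> * ((z - 1) / (z + 1))"
      have w: "0 < Re w" using pos[OF z] by (simp add: w_def)
      have w0: "w \<noteq> 0" using w by (metis less_irrefl zero_complex.sel(1))
      have "h z = 1/2 \<longleftrightarrow> Im (Ln w) = 0" by (simp add: h_def L_def w_def)
      also have "\<dots> \<longleftrightarrow> Im w = 0" using w Im_Ln_eq_0[OF w0] by simp
      also have "Im w = - (((norm z)\<^sup>2 - 1) / (norm (z + 1))\<^sup>2)"
        unfolding w_def quot[OF nz[OF z]] by simp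
      also have "\<dots> = 0 \<longleftrightarrow> (norm z)\<^sup>2 = 1" using nz[OF z] by auto
      also have "\<dots> \<longleftrightarrow> norm z = 1" by (simp add: power2_eq_1_iff) (use norm_ge_zero[of z] in linarith)
      finally show ?thesis .
    qed
    then show ?thesis by auto
  qed
  also have "\<dots> = cis ` {0<..<pi}"
  proof (intro equalityI subsetI)
    fix z assume z: "z \<in> {z \<in> H. norm z = 1}"
    then have z0: "z \<noteq> 0" by auto
    have e: "z = cis (Arg z)" using cis_Arg[OF z0] z by (simp add: sgn_eq)
    have "0 < Arg z \<and> Arg z < pi" using z Arg_lt_pi[of z] by (auto simp: H_def)
    then show "z \<in> cis ` {0<..<pi}" by (subst e) (rule imageI, simp)
  next
    fix z assume "z \<in> cis ` {0<..<pi}"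
    then show "z \<in> {z \<in> H. norm z = 1}" by (auto simp: H_def sin_gt_zero)
  qed
  finally show ?thesis by (simp add: H_def)
qed

theorem proposition4:
  fixes U :: "complex set"
  assumes "open U" and "connected U" and "U \<noteq> {}"
    and "U \<subseteq> {z. Im z > 0}"
    and "closed_interval \<subseteq> sphere_boundary U"
    and "connectedin riemann_sphere (sphere_boundary U - open_interval)"
  shows "hausdorff1 (level_set U (1/2)) \<le> ennreal pi \<and>
    (hausdorff1 (level_set U (1/2)) = ennreal pi \<longleftrightarrow> U = {z. Im z > 0})"
proof -
  (* The points of (-1, 1) above which U contains a vertical segment. *)
  define A where "A = {x. -1 < x \<and> x < 1 \<and> (\<exists>d>0. \<forall>t. 0 < t \<longrightarrow> t \<le> d \<longrightarrow> Complex x t \<in> U)}"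
  have dips: "\<exists>t. 0 < t \<and> t < e \<and> Complex x t \<notin> U" if x: "-1 < x" "x < 1" "x \<notin> A" and e: "0 < e" for x e
  proof (rule ccontr)
    assume n: "\<not> ?thesis"
    have "\<forall>t. 0 < t \<longrightarrow> t \<le> e / 2 \<longrightarrow> Complex x t \<in> U"
    proof safe
      fix t :: real assume "0 < t" "t \<le> e / 2"
      then show "Complex x t \<in> U" using n e by force
    qed
    then have "x \<in> A" using x e unfolding A_def by (auto intro!: exI[of _ "e / 2"])
    then show False using x by simp
  qed
  show ?thesis
  proof (cases "\<exists>x\<in>A. \<exists>y\<in>A. x < y")
    case False
    (* With at most one such point the harmonic measure vanishes identically; a is this point, or an arbitrary one if there is none. *)
    define a where "a = (if A = {} then 0 else (SOME x. x \<in> A))"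
    have a: "-1 \<le> a" "a \<le> 1"
      using some_in_eq[of A] by (auto simp: a_def A_def)
    have Aa: "A \<subseteq> {a}"
      using False some_in_eq[of A] by (auto simp: a_def) (metis linorder_neqE)+
    have "harmonic_measure z open_interval U = 0" if z: "z \<in> U" for z
    proof (rule harmonic_measure_eqI[OF assms(1) assms(4) a(1) order_refl a(2) harmonic_on_const _ _ _ _ _ z])
      show "\<exists>t>0. t < e \<and> Complex x t \<notin> U" if "x \<in> {- 1<..<1} - {a..a}" "0 < e" for x e
        using that Aa by (intro dips) auto
      show "limsup_le (\<lambda>z. 0) U \<zeta> 0" for \<zeta> by (rule limsup_le_bounded) simp
    qed auto
    then have "level_set U (1/2) = {}" by (auto simp: level_set_def)
    then have h0: "hausdorff1 (level_set U (1/2)) = 0" by (simp add: hausdorff1_empty)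
    moreover have "U \<noteq> {z. Im z > 0}"
    proof
      assume "U = {z. Im z > 0}"
      then have "x \<in> A" if "-1 < x" "x < 1" for x using that by (auto simp: A_def intro: exI[of _ 1])
      from this[of 0] this[of "1/2"] show False using False by force
    qed
    ultimately show ?thesis by (simp add: not_le)
  next
    case True
    then obtain x y where xy: "x \<in> A" "y \<in> A" "x < y" by blast
    have bdd: "bdd_below A" "bdd_above A"
      by (auto simp: A_def intro!: bdd_belowI[of _ "-1"] bdd_aboveI[of _ 1])
    have ne: "A \<noteq> {}" using xy by auto
    define a b where "a = Inf A" and "b = Sup A"
    have "a \<le> x" "y \<le> b" using xy bdd by (auto simp: a_def b_def intro: cInf_lower cSup_upper)
    then have ab: "-1 \<le> a" "a < b" "b \<le> 1"
      using xy by (auto simp: a_def b_def A_def intro!: cInf_greatest cSup_least)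
    have half: "\<exists>r>0. ball (of_real y) r \<inter> {z. 0 < Im z} \<subseteq> U" if y: "a < y" "y < b" for y
    proof -
      obtain p where p: "p \<in> A" "p < y" using cInf_lessD[OF ne, of y] y(1) by (auto simp: a_def)
      obtain q where q: "q \<in> A" "y < q" using less_cSupD[OF ne, of y] y(2) by (auto simp: b_def)
      obtain d where d: "0 < d" "\<And>t. 0 < t \<Longrightarrow> t \<le> d \<Longrightarrow> Complex p t \<in> U" using p(1) by (auto simp: A_def)
      obtain d' where d': "0 < d'" "\<And>t. 0 < t \<Longrightarrow> t \<le> d' \<Longrightarrow> Complex q t \<in> U" using q(1) by (auto simp: A_def)
      have "-1 < p" "q < 1" using p q by (auto simp: A_def)
      then show ?thesis
        using half_disc_between_accessible[OF assms(1,2,4,5,6) _ p(2) q(2) _ d d'] by blast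
    qed
    define V where "V = reflected_domain U a b"
    have oV: "open V" and sV: "simply_connected V"
      unfolding V_def
      using open_reflected_domain[OF assms(1,2,4,5,6) ab half] simply_connected_reflected_domain[OF assms(1,2,4,5,6) ab half]
      by auto
    have symV: "cnj z \<in> V" if "z \<in> V" for z
      using that by (auto simp: V_def reflected_domain_def)
    have "1 \<notin> V"
      using assms(4) ab by (auto simp: V_def reflected_domain_def complex_eq_iff)
    then have nV: "V \<noteq> UNIV" by auto
    have cV: "of_real ((a + b) / 2) \<in> V"
      unfolding V_def reflected_domain_def using ab by (intro UnI2 imageI) auto
    obtain g S where gS: "S holomorphic_on V" "g holomorphic_on strip"
      "\<And>z. z \<in> V \<Longrightarrow> S z \<in> strip \<and> g (S z) = z"
      "\<And>s. s \<in> strip \<Longrightarrow> g s \<in> V \<and> S (g s) = s"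
      "\<And>s. s \<in> strip \<Longrightarrow> g (cnj s) = cnj (g s)"
      "\<exists>k>0. (g has_field_derivative of_real k) (at 0)"
      using symmetric_strip_map[OF oV sV nV cV symV] by metis
    interpret strip_map U a b g S
      using assms(1,4) ab oV gS unfolding V_def by unfold_locales
    have lev: "level_set U (1/2) = range (\<lambda>x. g (Complex x (pi / 4)))"
    proof (rule level_set_eq)
      show "\<exists>t>0. t < e \<and> Complex x t \<notin> U" if x: "x \<in> {- 1<..<1} - {a..b}" "0 < e" for x e
      proof (rule dips)
        show "x \<notin> A"
        proof
          assume "x \<in> A"
          then have "a \<le> x" "x \<le> b" using bdd by (auto simp: a_def b_def intro: cInf_lower cSup_upper)
          then show False using x by simp
        qed
      qed (use x in auto)
    qed
    have "pi / 2 * (b - a) \<le> pi / 2 * 2" using ab by (intro mult_left_mono) auto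
    then have le: "ennreal (pi / 2 * (b - a)) \<le> ennreal pi" by (intro ennreal_leI) simp
    have "hausdorff1 (level_set U (1/2)) \<le> ennreal pi"
      unfolding lev using hausdorff1_level_curve_le le by (rule order_trans)
    moreover have "hausdorff1 (level_set U (1/2)) \<noteq> ennreal pi" if "U \<noteq> {z. Im z > 0}"
      unfolding lev by (rule less_imp_neq[OF less_le_trans[OF hausdorff1_level_curve_less[OF that] le]])
    moreover have "ennreal pi \<le> hausdorff1 (level_set U (1/2))" if "U = {z. Im z > 0}"
      unfolding that level_set_upper_half_plane by (rule hausdorff1_semicircle_ge)
    ultimately show ?thesis using antisym by blast
  qed
qed

end
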